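(* Let $\Lambda\subset\mathbb R^n$ be a selfdual lattice and let $k\ge 0$ be the integer with $\sigma(\Lambda)=n-8k$. Write $\Lambda\cong\mathbb Z^p\oplus L$ with $L\subset\mathbb R^N$ ($N=n-p$) a selfdual lattice of minimum at least $2$. Then there exist integers $c_1,\dots,c_k$ such that $$\Theta_\Lambda=\theta_3^n+c_1\,\Delta_8\,\theta_3^{n-8}+c_2\,\Delta_8^2\,\theta_3^{n-16}+\cdots+c_k\,\Delta_8^k\,\theta_3^{n-8k}.$$ Moreover, with the convention $c_i=0$ for $i>k$: $c_1=-2N$; if $N>0$, $c_2=(h-46+2N)N$ where $h:=|L_2|/N$; and $c_k=(-1)^k\,2^{-n+12k}\,\bigl|\mathrm{Sh}(\Lambda)_{(n-8k)/4}\bigr|$.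
   Context: A lattice $\Lambda\subset\mathbb R^n$ is selfdual if it is integral ($\langle x,y\rangle\in\mathbb Z$ for $x,y\in\Lambda$) and equals its dual $\{y:\langle y,x\rangle\in\mathbb Z\ \forall x\in\Lambda\}$; it is even if all $\langle x,x\rangle$, $x\in\Lambda$, are even, and odd otherwise. For $A\subset\mathbb R^n$ and $m>0$, the shell of norm $m$ is $A_m=\{x\in A:\langle x,x\rangle=m\}$; the minimum of $\Lambda$ is the least $m>0$ with $\Lambda_m\ne\emptyset$. $\mathbb Z^p$ is the cubic lattice. Shadow: if $\Lambda$ is even, $\mathrm{Sh}(\Lambda)=\Lambda$; if $\Lambda$ is odd, with $\Lambda_0=\{x\in\Lambda:\langle x,x\rangle\text{ even}\}$ and $\Lambda_0^\sharp$ its dual, $\mathrm{Sh}(\Lambda)=\Lambda_0^\sharp\setminus\Lambda$. Define $\sigma(\Lambda)=4\min\{\langle x,x\rangle:x\in\mathrm{Sh}(\Lambda)\}$ (it is of the form $n-8k$ with $k\ge0$ an integer). Theta functions: for $z$ in the upper half-plane put $q=e^{i\pi z}$, $\theta_2=\sum_{m\in\mathbb Z+1/2}q^{m^2}$, $\theta_3=\sum_{m\in\mathbb Z}q^{m^2}$, $\theta_4=\sum_{m\in\mathbb Z}(-q)^{m^2}$, $\Delta_8=\tfrac1{16}\theta_2^4\theta_4^4$. For a discrete $A\subset\mathbb R^n$, $\Theta_A(z)=\sum_{x\in A}q^{\langle x,x\rangle}$. *)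

theory Defs
  imports "HOL-Analysis.Analysis"
begin

text \<open>Vectors of R^n are represented as functions nat => real vanishing outside {0..<n}.\<close>

definition vecs :: "nat \<Rightarrow> (nat \<Rightarrow> real) set" where
  "vecs n = {x. \<forall>i\<ge>n. x i = 0}"

definition ip :: "nat \<Rightarrow> (nat \<Rightarrow> real) \<Rightarrow> (nat \<Rightarrow> real) \<Rightarrow> real" where
  "ip n x y = (\<Sum>i<n. x i * y i)"

definition is_lattice :: "nat \<Rightarrow> (nat \<Rightarrow> real) set \<Rightarrow> bool" where
  "is_lattice n \<Lambda> \<longleftrightarrow> (\<exists>b :: nat \<Rightarrow> nat \<Rightarrow> real.
      (\<forall>i<n. b i \<in> vecs n) \<and>
      (\<forall>c :: nat \<Rightarrow> real. (\<forall>j. (\<Sum>i<n. c i * b i j) = 0) \<longrightarrow> (\<forall>i<n. c i = 0)) \<and>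
      \<Lambda> = {(\<lambda>j. \<Sum>i<n. real_of_int (c i) * b i j) | c :: nat \<Rightarrow> int. True})"

definition integral_lattice :: "nat \<Rightarrow> (nat \<Rightarrow> real) set \<Rightarrow> bool" where
  "integral_lattice n \<Lambda> \<longleftrightarrow> (\<forall>x\<in>\<Lambda>. \<forall>y\<in>\<Lambda>. ip n x y \<in> \<int>)"

definition dual :: "nat \<Rightarrow> (nat \<Rightarrow> real) set \<Rightarrow> (nat \<Rightarrow> real) set" where
  "dual n A = {y \<in> vecs n. \<forall>x\<in>A. ip n y x \<in> \<int>}"

definition selfdual :: "nat \<Rightarrow> (nat \<Rightarrow> real) set \<Rightarrow> bool" where
  "selfdual n \<Lambda> \<longleftrightarrow> is_lattice n \<Lambda> \<and> integral_lattice n \<Lambda> \<and> dual n \<Lambda> = \<Lambda>"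

definition even_norm :: "nat \<Rightarrow> (nat \<Rightarrow> real) \<Rightarrow> bool" where
  "even_norm n x \<longleftrightarrow> (\<exists>m::int. ip n x x = 2 * real_of_int m)"

definition even_lattice :: "nat \<Rightarrow> (nat \<Rightarrow> real) set \<Rightarrow> bool" where
  "even_lattice n \<Lambda> \<longleftrightarrow> (\<forall>x\<in>\<Lambda>. even_norm n x)"

definition shell :: "nat \<Rightarrow> (nat \<Rightarrow> real) set \<Rightarrow> real \<Rightarrow> (nat \<Rightarrow> real) set" where
  "shell n A m = {x \<in> A. ip n x x = m}"

definition shadow :: "nat \<Rightarrow> (nat \<Rightarrow> real) set \<Rightarrow> (nat \<Rightarrow> real) set" where
  "shadow n \<Lambda> = (if even_lattice n \<Lambda> then \<Lambda>
                  else dual n {x \<in> \<Lambda>. even_norm n x} - \<Lambda>)"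

definition sigma :: "nat \<Rightarrow> (nat \<Rightarrow> real) set \<Rightarrow> real" where
  "sigma n \<Lambda> = 4 * Inf ((\<lambda>x. ip n x x) ` shadow n \<Lambda>)"

definition cubic_sum :: "nat \<Rightarrow> nat \<Rightarrow> (nat \<Rightarrow> real) set \<Rightarrow> (nat \<Rightarrow> real) set" where
  "cubic_sum p N L = {x \<in> vecs (p + N). (\<forall>i<p. x i \<in> \<int>) \<and> (\<lambda>j. x (p + j)) \<in> L}"

definition isometric :: "nat \<Rightarrow> (nat \<Rightarrow> real) set \<Rightarrow> (nat \<Rightarrow> real) set \<Rightarrow> bool" where
  "isometric n A B \<longleftrightarrow> (\<exists>f. bij_betw f A B \<and>
      (\<forall>x\<in>A. \<forall>y\<in>A. f (\<lambda>j. x j + y j) = (\<lambda>j. f x j + f y j)) \<and>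
      (\<forall>x\<in>A. \<forall>y\<in>A. ip n (f x) (f y) = ip n x y))"

text \<open>Theta series, q = exp(i pi z).\<close>
definition theta_set :: "nat \<Rightarrow> (nat \<Rightarrow> real) set \<Rightarrow> complex \<Rightarrow> complex" where
  "theta_set n A z = infsum (\<lambda>x. exp (\<i> * of_real pi * z * of_real (ip n x x))) A"

definition theta2 :: "complex \<Rightarrow> complex" where
  "theta2 z = infsum (\<lambda>m::int. exp (\<i> * of_real pi * z * (of_int m + 1/2)^2)) UNIV"

definition theta3 :: "complex \<Rightarrow> complex" where
  "theta3 z = infsum (\<lambda>m::int. exp (\<i> * of_real pi * z * (of_int m)^2)) UNIV"

definition theta4 :: "complex \<Rightarrow> complex" where
  "theta4 z = infsum (\<lambda>m::int. (-1) ^ nat (m^2) * exp (\<i> * of_real pi * z * (of_int m)^2)) UNIV"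

definition Delta8 :: "complex \<Rightarrow> complex" where
  "Delta8 z = theta2 z ^ 4 * theta4 z ^ 4 / 16"

end

theory Submission
  imports Defs "HOL-Complex_Analysis.Complex_Analysis" "HOL-Probability.Characteristic_Functions"
begin

text \<open>
  The quotient \<open>f = \<Theta>\<^sub>\<Lambda> / \<theta>\<^sub>3\<^sup>n\<close> is invariant under \<open>z \<mapsto> z + 2\<close> and \<open>z \<mapsto> -1/z\<close>, as is
  \<open>t = \<Delta>\<^sub>8 / \<theta>\<^sub>3\<^sup>8\<close>, which vanishes only at the cusp \<open>\<infinity>\<close>, to first order in \<open>q\<close>. At the other cusp
  \<open>f(1 - 1/z) = \<Theta>\<^bsub>Sh\<^esub>(z) / \<theta>\<^sub>2(z)\<^sup>n\<close> has a pole of order at most \<open>k\<close> in \<open>q\<^sup>2\<close>, where \<open>t\<close> has a simple one.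
  Hence \<open>(f - f(\<infinity>)) / t\<close> is of the same kind with \<open>k\<close> lowered by one; for \<open>k = 0\<close>, the product of
  \<open>u = f - f(\<infinity>)\<close> and its translates \<open>u(z + 1)\<close>, \<open>u(1 - 1/z)\<close> is a level one function vanishing at infinity,
  so it is zero by the maximum principle. This writes \<open>f\<close> as a polynomial of degree \<open>k\<close> in \<open>t\<close> whose
  leading coefficient is read off at the second cusp; comparing \<open>q\<close>-expansions gives integrality and
  \<open>c\<^sub>1\<close>, \<open>c\<^sub>2\<close>.

  The inversion formula for \<open>\<Lambda>\<close> is reduced to dimension one: \<open>\<Lambda>\<close> lies between a finite-index sublattice
  spanned by orthogonal vectors and the dual of that sublattice, so \<open>\<Theta>\<^sub>\<Lambda>\<close> is a finite sum of products of
  one-dimensional theta series, and a character sum over the quotient picks out the dual.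
\<close>

section \<open>Poisson summation for Gaussians\<close>

text \<open>Square roots shape the argument: \<open>theta3 (- 1 / z)\<close> carries a square root
  of -iz, whose n-th power has no natural branch for odd n. So all inversions are proved at z = it,
  where only real square roots occur, and extended by the identity theorem, either for squares or
  for quotients by \<open>theta3 z ^ n\<close>, in which the root cancels. No determinant is
  computed: the constant in the inversion formula must be 1 because at t = 1 it relates a positive
  sum to itself. The shadow enters because z + 1 multiplies the term of x by (-1)^<x,x>, and
  inverting a series with these signs gives a sum over a translate of the dual. Its norms are at
  least (n-8k)/4, while theta2^n starts with 2^n q^(n/4); this gap bounds the pole order at the
  second cusp. The constant 2^(12k-n) has two sources: 2^n from theta2^n, and t(1-1/z) ~ -1/(4096
  q^2) with 4096 = 16 * 2^8. Integrality holds because Delta8^i theta3^(n-8i) = q^i + ... has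
  integral coefficients, so that the linear system for the c_i is unitriangular.\<close>

lemma periodic_int_shift:
  fixes D :: "real \<Rightarrow> 'b"
  assumes per: "\<And>x. D (x + 1) = D x"
  shows "D (x + of_int m) = D x"
proof (induction m rule: int_induct[of _ 0])
  case (step1 i)
  then show ?case using per[of "x + of_int i"] by (simp add: add.assoc)
next
  case (step2 i)
  then show ?case using per[of "x + of_int (i - 1)"] by (simp add: algebra_simps)
qed simp

lemma periodic_cis_eq:
  fixes D :: "real \<Rightarrow> 'b"
  assumes per: "\<And>x. D (x + 1) = D x" and eq: "cis (2 * pi * x) = cis (2 * pi * y)"
  shows "D x = D y"
proof -
  have "sin (2 * pi * x) = sin (2 * pi * y) \<and> cos (2 * pi * x) = cos (2 * pi * y)"
    using eq by (simp add: complex_eq_iff)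
  then obtain m :: int where "2 * pi * x = 2 * pi * y + 2 * pi * of_int m"
    by (auto simp: sin_cos_eq_iff)
  then have "2 * pi * x = 2 * pi * (y + of_int m)" by (simp add: algebra_simps)
  then have "x = y + of_int m" by simp
  then show ?thesis using periodic_int_shift[of D, OF per] by simp
qed

text \<open>\<open>Arg\<close> jumps across the negative real axis. Near w0 it is replaced by
  \<open>Arg (w / w0) + Arg w0\<close>, continuous there because \<open>w / w0\<close> is close to
  1; the two differ by a multiple of 2 pi, which the periodic \<open>D\<close> does not see.\<close>

lemma periodic_continuous_on_circle:
  fixes D :: "real \<Rightarrow> real"
  assumes cont: "continuous_on UNIV D" and per: "\<And>x. D (x + 1) = D x"
  shows "continuous_on (sphere (0::complex) 1) (\<lambda>w. D (Arg w / (2 * pi)))"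
proof (unfold continuous_on_eq_continuous_within, rule ballI)
  fix w0 :: complex assume w0: "w0 \<in> sphere 0 1"
  have eq: "D ((Arg (w / w0) + Arg w0) / (2 * pi)) = D (Arg w / (2 * pi))" if "w \<in> sphere 0 1" for w
  proof (rule periodic_cis_eq[of D, OF per])
    have nz: "w \<noteq> 0" "w0 \<noteq> 0" using that w0 by auto
    have "cis (Arg (w / w0) + Arg w0) = w"
      using nz that w0 by (simp add: cis_mult[symmetric] cis_Arg sgn_div_norm norm_divide)
    moreover have "cis (Arg w) = w" using nz that by (simp add: cis_Arg sgn_div_norm)
    ultimately show "cis (2 * pi * ((Arg (w / w0) + Arg w0) / (2 * pi))) = cis (2 * pi * (Arg w / (2 * pi)))"
      by simp
  qed
  have "isCont D x" for x using cont by (simp add: continuous_on_eq_continuous_at)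
  moreover have "isCont (\<lambda>w. (Arg (w / w0) + Arg w0) / (2 * pi)) w0"
  proof -
    have "w0 \<noteq> 0" using w0 by auto
    then have "isCont (\<lambda>w. Arg (w / w0)) w0"
      by (intro isCont_o2[where f = "\<lambda>w. w / w0" and g = Arg] continuous_intros continuous_at_Arg) auto
    then show ?thesis by (intro continuous_intros) auto
  qed
  ultimately have "isCont (\<lambda>w. D ((Arg (w / w0) + Arg w0) / (2 * pi))) w0"
    by (intro isCont_o2[where f = "\<lambda>w. (Arg (w / w0) + Arg w0) / (2 * pi)" and g = D]) auto
  then have "continuous (at w0 within sphere 0 1) (\<lambda>w. D ((Arg (w / w0) + Arg w0) / (2 * pi)))"
    by (rule continuous_at_imp_continuous_at_within)
  then show "continuous (at w0 within sphere 0 1) (\<lambda>w. D (Arg w / (2 * pi)))"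
    by (rule continuous_transform_within[OF _ zero_less_one]) (use w0 eq in auto)
qed

text \<open>\<open>D\<close> is orthogonal to every trigonometric polynomial. Stone-Weierstrass on
  the circle supplies such a P within e of \<open>D\<close>, so the integral of D^2 equals that of D
  (D - P) and is at most e times a bound of |D|. Hence it vanishes, and with it the continuous
  \<open>D\<close>.\<close>

lemma fourier_coeffs_zero_imp_zero:
  fixes D :: "real \<Rightarrow> real"
  assumes cont: "continuous_on UNIV D" and per: "\<And>x. D (x + 1) = D x"
    and zero: "\<And>k::int. integral {0..1} (\<lambda>x. of_real (D x) * cis (2 * pi * of_int k * x)) = 0"
  shows "D x = 0"
proof -
  have contS: "continuous_on S D" for S using cont continuous_on_subset by blast
  \<comment> \<open>Quantifying over all k makes \<open>N\<close> stable under multiplication of h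
    by a character. With \<open>poly\<close> stated for every h at once, its product case is mere
    composition.\<close>
  define N where "N h \<longleftrightarrow> continuous_on {0..1} h \<and>
      (\<forall>k::int. integral {0..1} (\<lambda>x. of_real (D x) * h x * cis (2 * pi * of_int k * x)) = (0::complex))"
    for h :: "real \<Rightarrow> complex"
  have intg: "(\<lambda>x. of_real (D x) * h x * cis (2 * pi * of_int k * x)) integrable_on {0..1}"
    if "continuous_on {0..1} h" for h :: "real \<Rightarrow> complex" and k :: int
    by (intro integrable_continuous_interval continuous_intros that contS)
  have N_add: "N (\<lambda>x. f x + g x)" if "N f" "N g" for f g
  proof -
    have "integral {0..1} (\<lambda>x. of_real (D x) * (f x + g x) * cis (2 * pi * of_int k * x)) =
      integral {0..1} (\<lambda>x. of_real (D x) * f x * cis (2 * pi * of_int k * x)) +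
      integral {0..1} (\<lambda>x. of_real (D x) * g x * cis (2 * pi * of_int k * x))" for k :: int
      using that by (subst integral_add[symmetric]) (auto simp: N_def ring_distribs intro!: intg)
    then show ?thesis using that by (auto simp: N_def intro!: continuous_intros)
  qed
  have N_cmult: "N (\<lambda>x. c * f x)" if "N f" for c f
  proof -
    have "integral {0..1} (\<lambda>x. of_real (D x) * (c * f x) * cis (2 * pi * of_int k * x)) =
      c * integral {0..1} (\<lambda>x. of_real (D x) * f x * cis (2 * pi * of_int k * x))" for k :: int
      by (subst integral_mult_right[symmetric]) (simp add: mult_ac)
    then show ?thesis using that by (auto simp: N_def intro!: continuous_intros)
  qed
  have N_cis: "N (\<lambda>x. cis (2 * pi * of_int j * x) * f x)" if "N f" for j f
  proof -
    have "integral {0..1} (\<lambda>x. of_real (D x) * (cis (2 * pi * of_int j * x) * f x) * cis (2 * pi * of_int k * x)) =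
      integral {0..1} (\<lambda>x. of_real (D x) * f x * cis (2 * pi * of_int (j + k) * x))" for k :: int
    proof (rule integral_cong)
      fix x :: real
      have "cis (2 * pi * of_int (j + k) * x) = cis (2 * pi * of_int j * x) * cis (2 * pi * of_int k * x)"
        by (simp add: cis_mult algebra_simps)
      then show "of_real (D x) * (cis (2 * pi * of_int j * x) * f x) * cis (2 * pi * of_int k * x) =
        of_real (D x) * f x * cis (2 * pi * of_int (j + k) * x)" by (simp add: mult_ac)
    qed
    moreover have "continuous_on {0..1} (\<lambda>x. cis (2 * pi * of_int j * x) * f x)"
      using that by (auto simp: N_def intro!: continuous_intros)
    ultimately show ?thesis using that unfolding N_def by presburger
  qed
  have poly: "\<forall>h. N h \<longrightarrow> N (\<lambda>x. of_real (p (cis (2 * pi * x))) * h x)"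
    if "real_polynomial_function p" for p
    using that
  proof induction
    case (linear p)
    interpret p: bounded_linear p by fact
    have pw: "p w = Re w * p 1 + Im w * p \<i>" for w
    proof -
      have "w = Re w *\<^sub>R 1 + Im w *\<^sub>R \<i>" by (simp add: complex_eq_iff)
      then have "p w = p (Re w *\<^sub>R 1 + Im w *\<^sub>R \<i>)" by simp
      then show ?thesis by (simp only: p.add p.scaleR) simp
    qed
    \<comment> \<open>A real-linear functional of w is \<alpha> times w plus \<beta> times the
      conjugate of w, and on the circle both are characters.\<close>
    define \<alpha> \<beta> where "\<alpha> = Complex (p 1 / 2) (- p \<i> / 2)" and "\<beta> = Complex (p 1 / 2) (p \<i> / 2)"
    have "complex_of_real (p (cis (2 * pi * x))) * h x
       = \<alpha> * (cis (2 * pi * of_int 1 * x) * h x) + \<beta> * (cis (2 * pi * of_int (-1) * x) * h x)" for x h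
    proof -
      have "complex_of_real (p (cis (2 * pi * x))) =
        \<alpha> * cis (2 * pi * of_int 1 * x) + \<beta> * cis (2 * pi * of_int (-1) * x)"
        by (simp add: pw[of "cis _"] complex_eq_iff \<alpha>_def \<beta>_def algebra_simps)
      then show ?thesis by (simp add: algebra_simps)
    qed
    then show ?case by (auto intro!: N_add N_cmult N_cis simp only: )
  next
    case (const c)
    then show ?case by (simp add: N_cmult)
  next
    case (add f g)
    then show ?case by (simp add: ring_distribs N_add)
  next
    case (mult f g)
    then show ?case by (simp add: mult.assoc)
  qed
  have N1: "N (\<lambda>x. 1)" using zero by (simp add: N_def)
  have Dcirc: "D (Arg (cis (2 * pi * x)) / (2 * pi)) = D x" for x
    by (rule periodic_cis_eq[of D, OF per]) (simp add: cis_Arg sgn_div_norm)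
  obtain C where C: "\<And>x. x \<in> {0..1} \<Longrightarrow> \<bar>D x\<bar> \<le> C"
  proof -
    have "bounded (D ` {0..1})" by (intro compact_imp_bounded compact_continuous_image contS) auto
    then obtain a where "\<forall>y\<in>D ` {0..1}. norm y \<le> a" unfolding bounded_iff by blast
    then show ?thesis using that[of a] by auto
  qed
  have C0: "C \<ge> 0" using C[of 0] by auto
  have sq: "integral {0..1} (\<lambda>x. D x * D x) \<le> e * C" if e: "e > 0" for e
  proof -
    obtain p where p: "real_polynomial_function p"
      and ap: "\<And>w. w \<in> sphere 0 1 \<Longrightarrow> \<bar>D (Arg w / (2 * pi)) - p w\<bar> < e"
      using Stone_Weierstrass_real_polynomial_function[OF compact_sphere
          periodic_continuous_on_circle[of D, OF cont per] e] by metis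
    define P where "P x = p (cis (2 * pi * x))" for x
    have Pc: "continuous_on {0..1} P" unfolding P_def
      by (rule continuous_on_compose2[OF continuous_on_polymonial_function[of p UNIV]])
         (use p in \<open>auto simp: real_polynomial_function_eq intro!: continuous_intros\<close>)
    have "integral {0..1} (\<lambda>x. complex_of_real (D x * P x)) = 0"
      using poly[OF p, rule_format, OF N1] unfolding N_def P_def by (auto dest: spec[of _ 0])
    moreover have "integral {0..1} (complex_of_real \<circ> (\<lambda>x. D x * P x)) = of_real (integral {0..1} (\<lambda>x. D x * P x))"
      by (intro integral_linear bounded_linear_of_real integrable_continuous_interval continuous_intros contS Pc)
    ultimately have Pz: "integral {0..1} (\<lambda>x. D x * P x) = 0"
      by (simp add: o_def del: of_real_mult)
    have "integral {0..1} (\<lambda>x. D x * D x) = integral {0..1} (\<lambda>x. D x * (D x - P x))"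
      using Pz by (simp add: right_diff_distrib)
        (subst integral_diff, auto intro!: integrable_continuous_interval continuous_intros contS Pc)
    also have "\<dots> \<le> integral {0..1::real} (\<lambda>x. e * C)"
    proof (rule integral_le)
      fix x :: real assume x: "x \<in> {0..1}"
      have "\<bar>D x - P x\<bar> \<le> e" using ap[of "cis (2 * pi * x)"] Dcirc[of x] by (simp add: P_def)
      then have "\<bar>D x * (D x - P x)\<bar> \<le> C * e" unfolding abs_mult
        using C[OF x] C0 by (intro mult_mono) auto
      then show "D x * (D x - P x) \<le> e * C" by (simp add: mult.commute)
    qed (auto intro!: integrable_continuous_interval continuous_intros contS Pc)
    finally show ?thesis by simp
  qed
  have "integral {0..1} (\<lambda>x. D x * D x) \<le> 0"
  proof (rule field_le_epsilon)
    fix e :: real assume "e > 0"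
    \<comment> \<open>The divisor \<open>C + 1\<close> avoids a division by C = 0.\<close>
    have "e / (C + 1) * C \<le> e" using C0 \<open>e > 0\<close> by (simp add: field_simps)
    then show "integral {0..1} (\<lambda>x. D x * D x) \<le> 0 + e" using sq[of "e / (C + 1)"] C0 \<open>e > 0\<close> by auto
  qed
  moreover have "integral {0..1} (\<lambda>x. D x * D x) \<ge> 0"
    by (intro integral_nonneg) (auto intro!: integrable_continuous_interval continuous_intros contS)
  ultimately have I0: "integral {0..1} (\<lambda>x. D x * D x) = 0" by simp
  have Dz: "D x = 0" if "x \<in> {0..1}" for x
  proof -
    have "\<forall>x\<in>cbox 0 1. D x * D x = 0"
    proof (subst integral_cbox_eq_0_iff[symmetric])
      show "integral (cbox 0 1) (\<lambda>x. D x * D x) = 0" using I0 by simp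
    qed (auto intro!: continuous_intros contS simp: box_ne_empty)
    then show ?thesis using that by auto
  qed
  have "D x = D (frac x + of_int \<lfloor>x\<rfloor>)" by (simp add: frac_def)
  also have "\<dots> = D (frac x)" by (rule periodic_int_shift[of D, OF per])
  also have "\<dots> = 0" by (rule Dz) (auto simp: less_imp_le[OF frac_lt_1])
  finally show ?thesis .
qed

section \<open>Gaussian sums and the Gaussian Fourier transform\<close>

lemma summable_on_int_geometric:
  fixes \<rho> :: real
  assumes "0 \<le> \<rho>" "\<rho> < 1"
  shows "(\<lambda>m::int. \<rho> ^ nat \<bar>m\<bar>) summable_on UNIV"
proof -
  have nat: "(\<lambda>n::nat. \<rho> ^ n) summable_on UNIV"
    using assms by (intro summable_nonneg_imp_summable_on) auto
  have "(\<lambda>m::int. \<rho> ^ nat \<bar>m\<bar>) summable_on (range int)"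
    by (subst summable_on_reindex) (use nat in \<open>auto simp: o_def\<close>)
  moreover have "(\<lambda>m::int. \<rho> ^ nat \<bar>m\<bar>) summable_on (range (\<lambda>n. - int n))"
    by (subst summable_on_reindex) (use nat in \<open>auto simp: o_def inj_on_def\<close>)
  moreover have "range int \<union> range (\<lambda>n. - int n) = UNIV"
    by (auto simp: image_iff) (metis int_cases2)
  ultimately show ?thesis by (metis summable_on_union)
qed

text \<open>From (m + 2x)^2 >= 0 follows (m + x)^2 >= m^2/2 - x^2, and m^2 >= |m|. The bound is
  uniform for |x| <= R, as a majorant for the M-test must be.\<close>

lemma gauss_le_geometric:
  fixes s x R :: real and m :: int
  assumes "s > 0" "\<bar>x\<bar> \<le> R"
  shows "exp (- pi * s * (of_int m + x)\<^sup>2) \<le> exp (pi * s * R\<^sup>2) * exp (- pi * s / 2) ^ nat \<bar>m\<bar>"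
proof -
  have "0 \<le> (of_int m + 2 * x)\<^sup>2 / 2" by simp
  also have "\<dots> = (of_int m + x)\<^sup>2 - (of_int m)\<^sup>2 / 2 + x\<^sup>2"
    by (simp add: power2_eq_square field_simps)
  finally have 1: "(of_int m + x)\<^sup>2 \<ge> (of_int m)\<^sup>2 / 2 - x\<^sup>2" by simp
  have 2: "x\<^sup>2 \<le> R\<^sup>2" using assms(2) abs_le_square_iff by fastforce
  have "\<bar>m\<bar> * 1 \<le> \<bar>m\<bar> * \<bar>m\<bar>" by (cases "m = 0") (simp, rule mult_left_mono, auto)
  then have "\<bar>m\<bar> \<le> m\<^sup>2" by (simp add: power2_eq_square)
  then have "real_of_int \<bar>m\<bar> \<le> of_int (m\<^sup>2)" by (rule of_int_le_iff[THEN iffD2])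
  then have 3: "real (nat \<bar>m\<bar>) \<le> (of_int m)\<^sup>2" by simp
  have "real (nat \<bar>m\<bar>) / 2 - R\<^sup>2 \<le> (of_int m + x)\<^sup>2" using 1 2 3 by linarith
  then have "pi * s * (real (nat \<bar>m\<bar>) / 2 - R\<^sup>2) \<le> pi * s * (of_int m + x)\<^sup>2"
    using assms(1) by (intro mult_left_mono) auto
  then show ?thesis
    by (simp add: exp_of_nat_mult[symmetric] exp_add[symmetric] algebra_simps)
qed

lemma gauss_summable_on_int:
  fixes s x :: real
  assumes "s > 0"
  shows "(\<lambda>m::int. exp (- pi * s * (of_int m + x)\<^sup>2)) summable_on UNIV"
  by (rule summable_on_comparison_test[OF summable_on_cmult_right[OF
        summable_on_int_geometric[of "exp (- pi * s / 2)"], of "exp (pi * s * \<bar>x\<bar>\<^sup>2)"]])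
     (use assms gauss_le_geometric[of s x "\<bar>x\<bar>"] in auto)

lemma uniform_infsum_interval:
  fixes f :: "'i \<Rightarrow> real \<Rightarrow> 'c::banach"
  assumes cont: "\<And>i. continuous_on {a..b} (f i)"
    and bound: "\<And>i x. x \<in> {a..b} \<Longrightarrow> norm (f i x) \<le> M i" and M: "M summable_on UNIV"
  shows "continuous_on {a..b} (\<lambda>x. \<Sum>\<^sub>\<infinity>i. f i x)"
    and "((\<lambda>i. integral {a..b} (f i)) has_sum integral {a..b} (\<lambda>x. \<Sum>\<^sub>\<infinity>i. f i x)) UNIV"
proof -
  have ul: "uniform_limit {a..b} (\<lambda>X y. \<Sum>x\<in>X. f x y) (\<lambda>y. \<Sum>\<^sub>\<infinity>x. f x y) (finite_subsets_at_top UNIV)"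
    by (rule Weierstrass_m_test_general) (use bound M in auto)
  show "continuous_on {a..b} (\<lambda>x. \<Sum>\<^sub>\<infinity>i. f i x)"
    by (rule uniform_limit_theorem[OF _ ul]) (auto intro!: continuous_intros cont)
  obtain I J where I: "\<And>X. ((\<lambda>y. \<Sum>x\<in>X. f x y) has_integral I X) {a..b}"
    and J: "((\<lambda>y. \<Sum>\<^sub>\<infinity>x. f x y) has_integral J) {a..b}" and IJ: "(I \<longlongrightarrow> J) (finite_subsets_at_top UNIV)"
    by (rule uniform_limit_integral[OF ul]) (auto intro!: continuous_intros cont)
  have "I X = (\<Sum>i\<in>X. integral {a..b} (f i))" if "finite X" for X
    using integral_unique[OF I[of X]] that
    by (subst (asm) integral_sum) (auto intro!: integrable_continuous_interval cont)
  then have "eventually (\<lambda>X. I X = (\<Sum>i\<in>X. integral {a..b} (f i))) (finite_subsets_at_top UNIV)"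
    by (intro eventually_finite_subsets_at_top_weakI) auto
  then show "((\<lambda>i. integral {a..b} (f i)) has_sum integral {a..b} (\<lambda>x. \<Sum>\<^sub>\<infinity>i. f i x)) UNIV"
    unfolding has_sum_def integral_unique[OF J] using IJ by (rule Lim_transform_eventually[rotated])
qed

text \<open>The substitution x = u sqrt(2 pi s) turns the integral into the characteristic function
  of the standard normal distribution.\<close>

lemma gauss_fourier_transform:
  fixes s y :: real
  assumes s: "s > 0"
  shows "integrable lborel (\<lambda>u. of_real (exp (- pi * s * u\<^sup>2)) * cis (2 * pi * y * u))"
    and "(LINT u|lborel. of_real (exp (- pi * s * u\<^sup>2)) * cis (2 * pi * y * u)) = of_real (exp (- pi * y\<^sup>2 / s) / sqrt s)"
proof -
  define c where "c = sqrt (2 * pi * s)"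
  have c: "c > 0" "c\<^sup>2 = 2 * pi * s" using s by (auto simp: c_def)
  define t where "t = 2 * pi * y / c"
  define g where "g x = std_normal_density x *\<^sub>R iexp (t * x)" for x
  have "integrable lborel g"
    by (rule Bochner_Integration.integrable_bound[OF integrable_normal_density[of 1 0]])
       (auto simp: g_def[abs_def])
  then have gi: "integrable lborel (\<lambda>u. g (0 + c * u))"
    using c by (subst lborel_integrable_real_affine_iff) auto
  have ge: "of_real (exp (- pi * s * u\<^sup>2)) * cis (2 * pi * y * u) = of_real (sqrt (2 * pi)) * g (0 + c * u)" for u
    using c by (simp add: g_def std_normal_density_def scaleR_conv_of_real t_def cis_conv_exp
        power_mult_distrib) (simp add: mult_ac)
  show "integrable lborel (\<lambda>u. of_real (exp (- pi * s * u\<^sup>2)) * cis (2 * pi * y * u))"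
    unfolding ge using gi by simp
  have "char std_normal_distribution t = (LINT x|lborel. g x)"
    unfolding char_def g_def by (subst integral_density) auto
  also have "\<dots> = \<bar>c\<bar> *\<^sub>R (LINT u|lborel. g (0 + c * u))"
    using c by (intro lborel_integral_real_affine) auto
  finally have *: "(LINT u|lborel. g (0 + c * u)) = of_real (exp (- t\<^sup>2 / 2) / c)"
    using c by (simp add: char_std_normal_distribution scaleR_conv_of_real field_simps)
  have "- t\<^sup>2 / 2 = - pi * y\<^sup>2 / s" unfolding t_def power_divide c
    by (simp add: power2_eq_square)
  moreover have "sqrt (2 * pi) / c = 1 / sqrt s" using s by (simp add: c_def real_sqrt_mult)
  ultimately have "sqrt (2 * pi) * (exp (- t\<^sup>2 / 2) / c) = exp (- pi * y\<^sup>2 / s) / sqrt s"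
    by (metis mult.commute mult_1 times_divide_eq_left times_divide_eq_right)
  then show "(LINT u|lborel. of_real (exp (- pi * s * u\<^sup>2)) * cis (2 * pi * y * u)) = of_real (exp (- pi * y\<^sup>2 / s) / sqrt s)"
    unfolding ge * integral_mult_right_zero of_real_mult[symmetric] by simp
qed

text \<open>An unordered sum may be evaluated along any exhaustion by finite sets. Along
  \<open>{- int M..<int M}\<close> the unit intervals join to [-M, M], and integrability of g gives
  the limit.\<close>

lemma has_sum_unit_integrals:
  fixes g :: "real \<Rightarrow> complex"
  assumes cont: "continuous_on UNIV g" and int: "integrable lborel g"
    and sum: "((\<lambda>m::int. integral {of_int m..of_int m + 1} g) has_sum S) UNIV"
  shows "S = (LINT u|lborel. g u)"
proof -
  have contS: "continuous_on A g" for A using cont continuous_on_subset by blast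
  have part: "(\<Sum>m\<in>{- int M..<int M}. integral {of_int m..of_int m + 1} g) = integral {- real M..real M} g" for M
  proof (induction M)
    case (Suc M)
    have "{- int (Suc M)..<int (Suc M)} = insert (- int (Suc M)) (insert (int M) {- int M..<int M})" by auto
    then have "(\<Sum>m\<in>{- int (Suc M)..<int (Suc M)}. integral {of_int m..of_int m + 1} g) =
      integral {- real (Suc M)..- real M} g + (integral {- real M..real M} g + integral {real M..real (Suc M)} g)"
      using Suc by (simp add: add_ac)
    also have "integral {- real M..real M} g + integral {real M..real (Suc M)} g = integral {- real M..real (Suc M)} g"
      by (rule Henstock_Kurzweil_Integration.integral_combine) (auto intro!: integrable_continuous_interval contS)
    also have "integral {- real (Suc M)..- real M} g + \<dots> = integral {- real (Suc M)..real (Suc M)} g"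
      by (rule Henstock_Kurzweil_Integration.integral_combine) (auto intro!: integrable_continuous_interval contS)
    finally show ?case .
  qed simp
  have seti: "set_integrable lborel A g" if "A \<in> sets lborel" for A
    using int that by (simp add: set_integrable_def integrable_mult_indicator)
  have U: "(\<Union>M. {- real M..real M}) = UNIV"
  proof safe
    fix x :: real
    obtain M where "\<bar>x\<bar> \<le> real M" using real_arch_simple by blast
    then show "x \<in> (\<Union>M. {- real M..real M})" by (auto simp: abs_le_iff intro!: exI[of _ M])
  qed auto
  have "(\<lambda>M. LINT u:{- real M..real M}|lborel. g u) \<longlonglongrightarrow> (LINT u:(\<Union>M. {- real M..real M})|lborel. g u)"
    by (rule set_integral_cont_up) (auto intro!: seti simp: U incseq_def)
  then have lim1: "(\<lambda>M. integral {- real M..real M} g) \<longlonglongrightarrow> (LINT u|lborel. g u)"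
    unfolding U by (simp add: set_borel_integral_eq_integral(2)[OF seti] set_lebesgue_integral_def[of _ UNIV])
  have "filterlim (\<lambda>M::nat. {- int M..<int M}) (finite_subsets_at_top UNIV) sequentially"
    unfolding filterlim_finite_subsets_at_top
  proof (intro allI impI)
    fix X :: "int set" assume X: "finite X \<and> X \<subseteq> UNIV"
    then obtain K where K: "\<And>m. m \<in> X \<Longrightarrow> \<bar>m\<bar> \<le> K"
      by (metis finite_imageI finite_has_maximal image_eqI bdd_above.E bdd_above_finite)
    show "\<forall>\<^sub>F M in sequentially. finite {- int M..<int M} \<and> X \<subseteq> {- int M..<int M} \<and> {- int M..<int M} \<subseteq> UNIV"
      using eventually_gt_at_top[of "nat \<bar>K\<bar>"]
    proof eventually_elim
      case (elim M)
      have "m \<in> {- int M..<int M}" if "m \<in> X" for m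
        using K[OF that] elim by auto
      then show ?case by auto
    qed
  qed
  from filterlim_compose[OF sum[unfolded has_sum_def] this]
  have "(\<lambda>M. integral {- real M..real M} g) \<longlonglongrightarrow> S" unfolding part .
  with lim1 show ?thesis using LIMSEQ_unique by blast
qed

text \<open>Both sides are continuous and 1-periodic in x, so comparing Fourier coefficients
  suffices. On the left the integrals of the translates over [0,1] assemble to the Fourier transform
  over the line; on the right orthogonality of characters leaves one term.\<close>

theorem gauss_poisson:
  fixes s x :: real
  assumes s: "s > 0"
  shows "of_real (\<Sum>\<^sub>\<infinity>m::int. exp (- pi * s * (of_int m + x)\<^sup>2)) =
    of_real (1 / sqrt s) * (\<Sum>\<^sub>\<infinity>k::int. of_real (exp (- pi * (of_int k)\<^sup>2 / s)) * cis (2 * pi * of_int k * x))"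
proof -
  define A where "A x = (\<Sum>\<^sub>\<infinity>m::int. exp (- pi * s * (of_int m + x)\<^sup>2))" for x
  define e where "e k = exp (- pi * (of_int k)\<^sup>2 / s)" for k :: int
  define B where "B x = (\<Sum>\<^sub>\<infinity>k::int. of_real (e k) * cis (2 * pi * of_int k * x))" for x
  have e_sum: "e summable_on UNIV"
    using gauss_summable_on_int[of "1 / s" 0] s by (simp add: e_def[abs_def])
  have e_norm: "norm (of_real (e k) * cis (2 * pi * of_int k * x)) \<le> e k" for k x
    by (simp add: norm_mult e_def)
  have Bcont: "continuous_on {a..b} B" for a b unfolding B_def
    by (rule uniform_infsum_interval(1)[OF _ e_norm e_sum]) (auto intro!: continuous_intros)
  define \<rho> where "\<rho> R m = exp (pi * s * R\<^sup>2) * exp (- pi * s / 2) ^ nat \<bar>m\<bar>" for R and m :: int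
  have \<rho>_sum: "\<rho> R summable_on UNIV" for R unfolding \<rho>_def
    by (intro summable_on_cmult_right summable_on_int_geometric) (use s in auto)
  have Abound: "norm (exp (- pi * s * (of_int m + x)\<^sup>2)) \<le> \<rho> (\<bar>a\<bar> + \<bar>b\<bar>) m" if "x \<in> {a..b}" for x a b m
    using gauss_le_geometric[of s x "\<bar>a\<bar> + \<bar>b\<bar>" m] s that by (auto simp: \<rho>_def)
  have Acont: "continuous_on {a..b} A" for a b unfolding A_def
    by (rule uniform_infsum_interval(1)[OF _ Abound \<rho>_sum]) (auto intro!: continuous_intros)
  \<comment> \<open>The uniqueness lemma is for real functions; pairing k with -k shows that
    \<open>B\<close> is real.\<close>
  have Breal: "B x = of_real (Re (B x))" for x
  proof -
    have "cnj (B x) = (\<Sum>\<^sub>\<infinity>k::int. cnj (of_real (e k) * cis (2 * pi * of_int k * x)))"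
      unfolding B_def by (rule infsum_cnj[symmetric])
    also have "\<dots> = (\<Sum>\<^sub>\<infinity>k::int. of_real (e (- k)) * cis (2 * pi * of_int (- k) * x))"
      by (rule infsum_cong) (simp add: e_def cis_cnj)
    also have "\<dots> = B x" unfolding B_def
      by (rule infsum_reindex_bij_betw[where g = uminus and A = UNIV and B = UNIV and
            f = "\<lambda>k. of_real (e k) * cis (2 * pi * of_int k * x)"]) (simp add: bij_uminus)
    finally have "B x \<in> \<real>" using Reals_cnj_iff by blast
    then show ?thesis by (simp add: complex_is_Real_iff complex_eq_iff)
  qed
  define D where "D x = A x - Re (B x) / sqrt s" for x
  have Dcont: "continuous_on UNIV D"
  proof (rule continuous_at_imp_continuous_on, rule ballI)
    fix x
    have "continuous_on {x - 1..x + 1} D" unfolding D_def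
      by (intro continuous_intros Acont Bcont) (use s in auto)
    then show "isCont D x" by (rule continuous_on_interior) auto
  qed
  have Dper: "D (x + 1) = D x" for x
  proof -
    have "A (x + 1) = (\<Sum>\<^sub>\<infinity>m::int. exp (- pi * s * (of_int (m + 1) + x)\<^sup>2))"
      unfolding A_def by (simp add: add_ac)
    also have "\<dots> = A x" unfolding A_def
      by (rule infsum_reindex_bij_betw[where g = "\<lambda>m. m + 1" and A = UNIV and B = UNIV and
            f = "\<lambda>m::int. exp (- pi * s * (of_int m + x)\<^sup>2)"])
         (rule bij_betwI[where g = "\<lambda>m. m - 1"], auto)
    finally have "A (x + 1) = A x" .
    moreover have "cis (2 * pi * of_int k * (x + 1)) = cis (2 * pi * of_int k * x)" for k :: int
      by (simp add: distrib_left cis_mult[symmetric] cis_multiple_2pi)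
    ultimately show ?thesis by (simp add: D_def B_def)
  qed
  have Dcoeff: "integral {0..1} (\<lambda>x. of_real (D x) * cis (2 * pi * of_int j * x)) = 0" for j :: int
  proof -
    define E where "E x = cis (2 * pi * of_int j * x)" for x
    have Econt: "continuous_on X E" for X unfolding E_def by (intro continuous_intros)
    have Eper: "E (x + of_int m) = E x" for x m unfolding E_def
    proof -
      have "cis (2 * pi * of_int (j * m)) = 1" by (rule cis_multiple_2pi) (rule Ints_of_int)
      then have "cis (2 * pi * of_int j * x + 2 * pi * of_int (j * m)) = cis (2 * pi * of_int j * x)"
        by (simp only: cis_mult[symmetric] mult_1_right)
      then show "cis (2 * pi * of_int j * (x + of_int m)) = cis (2 * pi * of_int j * x)"
        by (simp add: algebra_simps)
    qed
    have intA: "integral {0..1} (\<lambda>x. of_real (A x) * E x) = of_real (e j / sqrt s)"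
    proof -
      define g where "g u = of_real (exp (- pi * s * u\<^sup>2)) * E u" for u
      have hs: "((\<lambda>m::int. integral {0..1} (\<lambda>x. of_real (exp (- pi * s * (of_int m + x)\<^sup>2)) * E x)) has_sum
        integral {0..1} (\<lambda>x. \<Sum>\<^sub>\<infinity>m::int. of_real (exp (- pi * s * (of_int m + x)\<^sup>2)) * E x)) UNIV"
      proof (rule uniform_infsum_interval(2)[OF _ _ \<rho>_sum])
        show "norm (of_real (exp (- pi * s * (of_int m + x)\<^sup>2)) * E x) \<le> \<rho> (\<bar>0\<bar> + \<bar>1\<bar>) m" if "x \<in> {0..1}" for m x
          using Abound[OF that, of m] by (simp add: norm_mult E_def)
      qed (auto intro!: continuous_intros Econt)
      have "(\<Sum>\<^sub>\<infinity>m::int. of_real (exp (- pi * s * (of_int m + x)\<^sup>2)) * E x) = of_real (A x) * E x" for x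
      proof -
        have "((\<lambda>m::int. exp (- pi * s * (of_int m + x)\<^sup>2)) has_sum A x) UNIV"
          unfolding A_def using gauss_summable_on_int[OF s] by (rule has_sum_infsum)
        then have "((\<lambda>m::int. complex_of_real (exp (- pi * s * (of_int m + x)\<^sup>2))) has_sum of_real (A x)) UNIV"
          by (rule has_sum_of_real)
        then show ?thesis by (intro infsumI has_sum_cmult_left)
      qed
      moreover have "integral {0..1} (\<lambda>x. of_real (exp (- pi * s * (of_int m + x)\<^sup>2)) * E x) = integral {of_int m..of_int m + 1} g" for m :: int
      proof -
        have "integral {of_int m..of_int m + 1} g = integral {of_int m - of_int m..of_int m + 1 - of_int m} (\<lambda>x. g (x + of_int m))"
          by (rule integral_shift_real_ivl[symmetric])
        then show ?thesis by (simp add: g_def Eper add_ac)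
      qed
      ultimately have "((\<lambda>m::int. integral {of_int m..of_int m + 1} g) has_sum integral {0..1} (\<lambda>x. of_real (A x) * E x)) UNIV"
        using hs by simp
      then have "integral {0..1} (\<lambda>x. of_real (A x) * E x) = (LINT u|lborel. g u)"
        by (rule has_sum_unit_integrals[rotated 2])
          (use gauss_fourier_transform(1)[OF s, of "of_int j"] in
            \<open>auto simp: g_def[abs_def] E_def[abs_def] intro!: continuous_intros\<close>)
      then show ?thesis using gauss_fourier_transform(2)[OF s, of "of_int j"] by (simp add: g_def E_def e_def)
    qed
    have intB: "integral {0..1} (\<lambda>x. B x * E x) = of_real (e j)"
    proof -
      have hs: "((\<lambda>k::int. integral {0..1} (\<lambda>x. of_real (e k) * cis (2 * pi * of_int k * x) * E x)) has_sum
        integral {0..1} (\<lambda>x. \<Sum>\<^sub>\<infinity>k::int. of_real (e k) * cis (2 * pi * of_int k * x) * E x)) UNIV"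
        by (rule uniform_infsum_interval(2)[OF _ _ e_sum]) (auto intro!: continuous_intros Econt simp: norm_mult E_def e_def)
      have "(\<Sum>\<^sub>\<infinity>k::int. of_real (e k) * cis (2 * pi * of_int k * x) * E x) = B x * E x" for x
      proof -
        have "(\<lambda>k::int. of_real (e k) * cis (2 * pi * of_int k * x)) summable_on UNIV"
          by (rule abs_summable_summable) (use e_sum in \<open>simp add: norm_mult e_def[abs_def]\<close>)
        then show ?thesis unfolding B_def by (intro infsumI has_sum_cmult_left has_sum_infsum)
      qed
      \<comment> \<open>Only the frequency k = -j survives, and \<open>e\<close> is an even
        function.\<close>
      moreover have "integral {0..1} (\<lambda>x. of_real (e k) * cis (2 * pi * of_int k * x) * E x) = (if k = - j then of_real (e j) else 0)" for k :: int
      proof -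
        have "cis (2 * pi * of_int k * x) * E x = cis (2 * pi * of_int (k + j) * x)" for x
          by (simp add: E_def cis_mult algebra_simps)
        then have *: "integral {0..1} (\<lambda>x. of_real (e k) * cis (2 * pi * of_int k * x) * E x) = of_real (e k) * integral {0..1} (\<lambda>x. cis (2 * pi * of_int (k + j) * x))"
          by (simp add: mult.assoc)
        show ?thesis
        proof (cases "k = - j")
          case False
          define c where "c = 2 * pi * of_int (k + j)"
          have c: "c \<noteq> 0" using False by (simp add: c_def flip: of_int_add)
          have "((\<lambda>x. cis (c * x)) has_integral (cis (c * 1) / (\<i> * of_real c) - cis (c * 0) / (\<i> * of_real c))) {0..1}"
          proof (rule fundamental_theorem_of_calculus)
            fix x :: real
            have "((\<lambda>z. exp (\<i> * of_real c * z) / (\<i> * of_real c)) has_field_derivative exp (\<i> * of_real c * of_real x)) (at (of_real x))"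
              using c by (auto intro!: derivative_eq_intros)
            then have "((\<lambda>x. exp (\<i> * of_real c * of_real x) / (\<i> * of_real c)) has_vector_derivative exp (\<i> * of_real c * of_real x)) (at x within {0..1})"
              by (rule has_vector_derivative_real_field)
            then show "((\<lambda>x. cis (c * x) / (\<i> * of_real c)) has_vector_derivative cis (c * x)) (at x within {0..1})"
              by (simp add: cis_conv_exp mult.assoc)
          qed auto
          moreover have "cis c = 1" unfolding c_def by (rule cis_multiple_2pi) simp
          ultimately show ?thesis using False * by (simp add: c_def has_integral_integral integral_unique)
        next
          case True
          then show ?thesis unfolding * by (simp add: e_def)
        qed
      qed
      ultimately have "((\<lambda>k::int. if k = - j then complex_of_real (e j) else 0) has_sum integral {0..1} (\<lambda>x. B x * E x)) UNIV"
        using hs by simp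
      moreover have "((\<lambda>k::int. if k = - j then complex_of_real (e j) else 0) has_sum of_real (e j)) UNIV"
        by (rule has_sum_cong_neutral[THEN iffD1, OF _ _ _ has_sum_finite[of "{- j}" "\<lambda>_. of_real (e j)"], simplified]) auto
      ultimately show ?thesis by (rule has_sum_unique)
    qed
    have "integral {0..1} (\<lambda>x. of_real (D x) * E x) =
      integral {0..1} (\<lambda>x. of_real (A x) * E x - of_real (1 / sqrt s) * (B x * E x))"
    proof (rule integral_cong)
      fix x
      show "of_real (D x) * E x = of_real (A x) * E x - of_real (1 / sqrt s) * (B x * E x)"
        by (subst Breal) (simp add: D_def algebra_simps)
    qed
    also have "\<dots> = integral {0..1} (\<lambda>x. of_real (A x) * E x) - of_real (1 / sqrt s) * integral {0..1} (\<lambda>x. B x * E x)"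
      by (subst integral_diff)
        (use s in \<open>auto intro!: integrable_continuous_interval continuous_intros Acont Bcont Econt\<close>)
    finally show ?thesis unfolding intA intB by (simp add: E_def)
  qed
  have "D x = 0" using fourier_coeffs_zero_imp_zero[of D, OF Dcont Dper Dcoeff] .
  then have "of_real (A x) = of_real (1 / sqrt s) * B x" by (subst Breal) (simp add: D_def)
  then show ?thesis by (simp add: A_def B_def e_def)
qed

section \<open>Theta series of selfdual lattices on the imaginary axis\<close>

lemma ip_commute: "ip n x y = ip n y x"
  by (simp add: ip_def mult.commute)

lemma ip_add_left: "ip n (\<lambda>j. x j + y j) z = ip n x z + ip n y z"
  by (simp add: ip_def ring_distribs sum.distrib)

lemma ip_scale_left: "ip n (\<lambda>j. c * x j) z = c * ip n x z"
  by (simp add: ip_def sum_distrib_left mult.assoc)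

lemma ip_sum_left: "ip n (\<lambda>j. \<Sum>i\<in>I. c i * x i j) z = (\<Sum>i\<in>I. c i * ip n (x i) z)"
  unfolding ip_def sum_distrib_left sum_distrib_right
  by (subst sum.swap) (simp add: mult.assoc)

lemma ip_diff_left: "ip n (\<lambda>j. x j - y j) z = ip n x z - ip n y z"
  by (simp add: ip_def ring_distribs sum_subtractf)

lemma ip_self_nonneg: "ip n x x \<ge> 0"
  by (simp add: ip_def sum_nonneg)

lemma ip_self_eq_0:
  assumes "x \<in> vecs n" "ip n x x = 0"
  shows "x = (\<lambda>_. 0)"
proof
  fix j
  have "\<forall>i\<in>{..<n}. x i * x i = 0"
    using assms(2) unfolding ip_def by (subst (asm) sum_nonneg_eq_0_iff) auto
  then show "x j = 0" using assms(1) by (cases "j < n") (auto simp: vecs_def)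
qed

lemma ip_self_add: "ip n (\<lambda>j. x j + y j) (\<lambda>j. x j + y j) = ip n x x + 2 * ip n x y + ip n y y"
  by (simp add: ip_def ring_distribs sum.distrib sum_distrib_left[symmetric] mult.commute)

lemma vecs_add: "x \<in> vecs n \<Longrightarrow> y \<in> vecs n \<Longrightarrow> (\<lambda>j. x j + y j) \<in> vecs n"
  by (simp add: vecs_def)

lemma vecs_sum: "(\<And>i. i \<in> I \<Longrightarrow> x i \<in> vecs n) \<Longrightarrow> (\<lambda>j. \<Sum>i\<in>I. c i * x i j) \<in> vecs n"
  by (simp add: vecs_def)

lemma selfdual_mem:
  "selfdual n \<Lambda> \<Longrightarrow> x \<in> \<Lambda> \<longleftrightarrow> x \<in> vecs n \<and> (\<forall>y\<in>\<Lambda>. ip n x y \<in> \<int>)"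
  unfolding selfdual_def dual_def by blast

lemma selfdual_add: "selfdual n \<Lambda> \<Longrightarrow> x \<in> \<Lambda> \<Longrightarrow> y \<in> \<Lambda> \<Longrightarrow> (\<lambda>j. x j + y j) \<in> \<Lambda>"
  by (auto simp: selfdual_mem ip_add_left intro: vecs_add)

lemma selfdual_zero: "selfdual n \<Lambda> \<Longrightarrow> (\<lambda>_. 0) \<in> \<Lambda>"
  by (auto simp: selfdual_mem ip_def vecs_def)

lemma selfdual_sum:
  assumes "selfdual n \<Lambda>" "\<And>i. i \<in> I \<Longrightarrow> x i \<in> \<Lambda>"
  shows "(\<lambda>j. \<Sum>i\<in>I. of_int (c i) * x i j) \<in> \<Lambda>"
  using assms by (auto simp: selfdual_mem ip_sum_left intro!: vecs_sum Ints_sum)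

text \<open>Gram-Schmidt with cleared denominators: inner products in \<Lambda> are integers, so the
  orthogonal residue of \<open>b m\<close>, multiplied by the product of the earlier norms, lies in
  \<Lambda> again.\<close>

lemma selfdual_orthogonal_vectors:
  assumes sd: "selfdual n \<Lambda>"
  obtains v where "\<And>i. i < n \<Longrightarrow> v i \<in> \<Lambda>" "\<And>i j. i < n \<Longrightarrow> j < n \<Longrightarrow> i \<noteq> j \<Longrightarrow> ip n (v i) (v j) = 0"
    "\<And>i. i < n \<Longrightarrow> ip n (v i) (v i) > 0"
proof -
  from sd obtain b where b: "\<And>i. i < n \<Longrightarrow> b i \<in> vecs n"
    and indep: "\<And>c. (\<And>j. (\<Sum>i<n. c i * b i j) = 0) \<Longrightarrow> \<forall>i<n. c i = 0"
    and \<Lambda>: "\<Lambda> = {(\<lambda>j. \<Sum>i<n. real_of_int (c i) * b i j) | c. True}"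
    unfolding selfdual_def is_lattice_def by blast
  have b\<Lambda>: "b i \<in> \<Lambda>" if "i < n" for i
  proof -
    have "b i = (\<lambda>j. \<Sum>l<n. real_of_int (if l = i then 1 else 0) * b l j)"
      using that by (simp add: if_distrib[of real_of_int] if_distrib[of "\<lambda>x. x * _"] sum.delta cong: if_cong)
    then show ?thesis unfolding \<Lambda> by (intro CollectI exI[of _ "\<lambda>l. if l = i then 1 else 0"] conjI TrueI)
  qed
  have int: "ip n x y \<in> \<int>" if "x \<in> \<Lambda>" "y \<in> \<Lambda>" for x y using sd that by (auto simp: selfdual_mem)
  \<comment> \<open>The induction carries the integral coefficient matrix \<open>c\<close>,
    triangular with nonzero diagonal: with the independence of \<open>b\<close> this makes the next
    vector nonzero.\<close>
  have "\<exists>v c. (\<forall>i<m. v i = (\<lambda>j. \<Sum>l<n. real_of_int (c i l) * b l j) \<and> c i i \<noteq> 0 \<and> (\<forall>l>i. c i l = 0)) \<and>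
        (\<forall>i<m. \<forall>j<m. i \<noteq> j \<longrightarrow> ip n (v i) (v j) = 0) \<and> (\<forall>i<m. ip n (v i) (v i) > 0)" if "m \<le> n" for m
    using that
  proof (induction m)
    case (Suc m)
    from Suc.IH[OF Suc_leD[OF Suc.prems]] obtain v c
      where H: "\<forall>i<m. v i = (\<lambda>j. \<Sum>l<n. real_of_int (c i l) * b l j) \<and> c i i \<noteq> 0 \<and> (\<forall>l>i. c i l = 0)"
        "\<forall>i<m. \<forall>j<m. i \<noteq> j \<longrightarrow> ip n (v i) (v j) = 0" "\<forall>i<m. ip n (v i) (v i) > 0"
      by (elim exE conjE)
    have v: "v i = (\<lambda>j. \<Sum>l<n. real_of_int (c i l) * b l j)" if "i < m" for i using H(1) that by blast
    have c: "c i i \<noteq> 0" "i < l \<Longrightarrow> c i l = 0" if "i < m" for i l using H(1) that by blast+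
    have orth: "ip n (v i) (v j) = 0" if "i < m" "j < m" "i \<noteq> j" for i j using H(2) that by blast
    have pos: "ip n (v i) (v i) > 0" if "i < m" for i using H(3) that by blast
    have v\<Lambda>: "v i \<in> \<Lambda>" if "i < m" for i using v[OF that] unfolding \<Lambda> by blast
    define A where "A i = \<lfloor>ip n (v i) (v i)\<rfloor>" for i
    define B where "B i = \<lfloor>ip n (b m) (v i)\<rfloor>" for i
    have A: "ip n (v i) (v i) = of_int (A i)" if "i < m" for i
      using int[OF v\<Lambda> v\<Lambda>, OF that that] by (simp add: A_def)
    have B: "ip n (b m) (v i) = of_int (B i)" if "i < m" for i
      using int[OF b\<Lambda> v\<Lambda>, of m i] that Suc.prems by (simp add: B_def)
    \<comment> \<open>\<open>D\<close> is a common denominator of the Gram-Schmidt quotients B i / A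
      i, and \<open>e i\<close> is D * B i / A i written without division.\<close>
    define D where "D = (\<Prod>i<m. A i)"
    define e where "e i = B i * (\<Prod>l\<in>{..<m} - {i}. A l)" for i
    have D0: "D \<noteq> 0" unfolding D_def using pos A by (auto simp: prod_zero_iff) (metis less_irrefl of_int_0)
    have eA: "e i * A i = D * B i" if "i < m" for i
      unfolding e_def D_def using that by (subst (2) prod.remove[of _ i]) auto
    define c' where "c' l = (if l = m then D else 0) - (\<Sum>i<m. e i * c i l)" for l
    define u where "u = (\<lambda>j. \<Sum>l<n. real_of_int (c' l) * b l j)"
    have u: "u = (\<lambda>j. of_int D * b m j - (\<Sum>i<m. of_int (e i) * v i j))"
    proof
      fix j
      have "u j = (\<Sum>l<n. (if l = m then of_int D * b l j else 0)) - (\<Sum>l<n. \<Sum>i<m. of_int (e i) * (of_int (c i l) * b l j))"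
        unfolding u_def c'_def sum_subtractf[symmetric]
        by (rule sum.cong) (auto simp: algebra_simps sum_distrib_left sum_distrib_right)
      also have "(\<Sum>l<n. (if l = m then of_int D * b l j else 0)) = of_int D * b m j"
        using Suc.prems by (simp add: sum.delta)
      also have "(\<Sum>l<n. \<Sum>i<m. of_int (e i) * (of_int (c i l) * b l j)) = (\<Sum>i<m. of_int (e i) * v i j)"
        by (subst sum.swap) (simp add: v sum_distrib_left)
      finally show "u j = of_int D * b m j - (\<Sum>i<m. of_int (e i) * v i j)" .
    qed
    have uv: "ip n u (v i) = 0" if i: "i < m" for i
    proof -
      have "ip n u (v i) = of_int D * ip n (b m) (v i) - (\<Sum>l<m. of_int (e l) * ip n (v l) (v i))"
        unfolding u by (simp add: ip_diff_left ip_scale_left ip_sum_left)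
      also have "(\<Sum>l<m. of_int (e l) * ip n (v l) (v i)) = (\<Sum>l<m. if l = i then real_of_int (e i * A i) else 0)"
        by (rule sum.cong) (use orth i in \<open>auto simp: A\<close>)
      also have "\<dots> = of_int (e i * A i)" using i by (simp add: sum.delta)
      finally show ?thesis using eA[OF i] B[OF i] by simp
    qed
    have c'm: "c' m = D" unfolding c'_def using c by simp
    have c'l: "c' l = 0" if "l > m" for l unfolding c'_def using c that by simp
    have uvec: "u \<in> vecs n" unfolding u_def using b by (intro vecs_sum) auto
    have "u \<noteq> (\<lambda>_. 0)"
    proof
      assume "u = (\<lambda>_. 0)"
      then have "(\<Sum>i<n. real_of_int (c' i) * b i j) = 0" for j unfolding u_def by metis
      from indep[of "\<lambda>i. real_of_int (c' i)", OF this] show False using c'm D0 Suc.prems by auto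
    qed
    then have upos: "ip n u u > 0"
      using ip_self_eq_0[OF uvec] ip_self_nonneg[of n u] by fastforce
    show ?case
    proof (intro exI[of _ "v(m := u)"] exI[of _ "c(m := c')"] conjI allI impI)
      fix i assume "i < Suc m"
      then show "(v(m := u)) i = (\<lambda>j. \<Sum>l<n. real_of_int ((c(m := c')) i l) * b l j)"
        using v u_def by (cases "i = m") auto
      show "(c(m := c')) i i \<noteq> 0" using \<open>i < Suc m\<close> c c'm D0 by (cases "i = m") auto
      show "(c(m := c')) i l = 0" if "i < l" for l using \<open>i < Suc m\<close> c c'l that by (cases "i = m") auto
      show "0 < ip n ((v(m := u)) i) ((v(m := u)) i)" using \<open>i < Suc m\<close> pos upos by (cases "i = m") auto
      show "ip n ((v(m := u)) i) ((v(m := u)) j) = 0" if "j < Suc m" "i \<noteq> j" for j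
        using \<open>i < Suc m\<close> that orth uv by (cases "i = m"; cases "j = m") (auto simp: ip_commute[of n _ u])
    qed
  qed simp
  from this[OF order.refl] obtain v c
    where H: "\<forall>i<n. v i = (\<lambda>j. \<Sum>l<n. real_of_int (c i l) * b l j) \<and> c i i \<noteq> 0 \<and> (\<forall>l>i. c i l = 0)"
      "\<forall>i<n. \<forall>j<n. i \<noteq> j \<longrightarrow> ip n (v i) (v j) = 0" "\<forall>i<n. ip n (v i) (v i) > 0"
    by (elim exE conjE)
  have "v i \<in> \<Lambda>" if "i < n" for i using H(1) that unfolding \<Lambda> by blast
  then show ?thesis using that[of v] H(2,3) by blast
qed

text \<open>The integral span M of \<open>v\<close> has finite index in \<Lambda>, so \<Lambda> lies
  between M and its dual. Even norms of the \<open>v i\<close> keep <x,x> mod 2 constant on cosets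
  of M, so that the series with signs (-1)^<x,x> splits over cosets as well.\<close>

locale orthogonal_frame =
  fixes n :: nat and \<Lambda> :: "(nat \<Rightarrow> real) set" and v :: "nat \<Rightarrow> nat \<Rightarrow> real"
  assumes sd: "selfdual n \<Lambda>"
    and v\<Lambda>: "i < n \<Longrightarrow> v i \<in> \<Lambda>"
    and orth: "i < n \<Longrightarrow> j < n \<Longrightarrow> i \<noteq> j \<Longrightarrow> ip n (v i) (v j) = 0"
    and pos: "i < n \<Longrightarrow> ip n (v i) (v i) > 0"
    and even_v: "i < n \<Longrightarrow> even_norm n (v i)"
begin

definition a :: "nat \<Rightarrow> real" where "a i = ip n (v i) (v i)"

definition Msharp :: "(nat \<Rightarrow> real) set" where
  "Msharp = {w \<in> vecs n. \<forall>i<n. ip n w (v i) \<in> \<int>}"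

abbreviation ivecs :: "(nat \<Rightarrow> int) set" where "ivecs \<equiv> PiE {..<n} (\<lambda>_. UNIV)"

text \<open>The v i / a i form the basis dual to \<open>v\<close>, so integral coordinates run
  through the dual of M. Coordinate tuples are extensional functions, which makes them unique and
  lets sums over them factor.\<close>

definition vec :: "(nat \<Rightarrow> int) \<Rightarrow> nat \<Rightarrow> real" where
  "vec k = (\<lambda>j. \<Sum>i<n. of_int (k i) / a i * v i j)"

lemma a_pos: "i < n \<Longrightarrow> a i > 0" using pos by (simp add: a_def)

lemma a_even: "i < n \<Longrightarrow> a i / 2 \<in> \<int>"
  using even_v[of i] by (auto simp: a_def even_norm_def)

lemma ip_Ints: "x \<in> \<Lambda> \<Longrightarrow> y \<in> \<Lambda> \<Longrightarrow> ip n x y \<in> \<int>"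
  using sd by (auto simp: selfdual_mem)

lemma \<Lambda>_vecs: "x \<in> \<Lambda> \<Longrightarrow> x \<in> vecs n"
  using sd by (auto simp: selfdual_mem)

lemma v_vecs: "i < n \<Longrightarrow> v i \<in> vecs n"
  using v\<Lambda> \<Lambda>_vecs by blast

text \<open>Equality in Bessel's inequality for the standard basis: the defects are nonnegative and sum to \<open>n - n = 0\<close>.\<close>

lemma completeness:
  assumes j: "j < n" and l: "l < n"
  shows "(\<Sum>i<n. v i j * v i l / a i) = (if j = l then 1 else 0)"
proof -
  define P where "P j l = (\<Sum>i<n. v i j / a i * v i l)" for j l
  define R where "R j l = (if l = j then 1 else 0) - P j l" for j l
  have "P j = (\<lambda>l. \<Sum>i<n. v i j / a i * v i l)" for j by (simp add: P_def fun_eq_iff)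
  then have ipP: "ip n (P j) z = (\<Sum>i<n. v i j / a i * ip n (v i) z)" for j z
    by (simp only: ip_sum_left)
  have PP: "(\<Sum>l<n. P j l * P j l) = P j j" for j
  proof -
    have "(\<Sum>l<n. P j l * P j l) = ip n (P j) (P j)" by (simp add: ip_def)
    also have "\<dots> = (\<Sum>i<n. v i j / a i * (\<Sum>k<n. v k j / a k * ip n (v k) (v i)))"
      by (subst ipP) (simp only: ip_commute[of n _ "P j"] ipP)
    also have "\<dots> = (\<Sum>i<n. v i j / a i * (\<Sum>k<n. if k = i then v i j else 0))"
      by (intro sum.cong arg_cong2[where f = "(*)"] refl) (use orth a_pos in \<open>force simp: a_def\<close>)
    also have "\<dots> = P j j" by (simp add: P_def sum.delta)
    finally show ?thesis .
  qed
  have RR: "(\<Sum>l<n. (R j l)\<^sup>2) = 1 - P j j" if "j < n" for j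
  proof -
    have "(\<Sum>l<n. (R j l)\<^sup>2) = (\<Sum>l<n. (if l = j then 1 - 2 * P j l else 0) + P j l * P j l)"
      by (rule sum.cong) (auto simp: R_def power2_eq_square algebra_simps)
    also have "\<dots> = 1 - P j j" using that by (simp add: sum.distrib PP sum.delta)
    finally show ?thesis .
  qed
  have "(\<Sum>j<n. P j j) = (\<Sum>i<n. \<Sum>j<n. v i j / a i * v i j)" unfolding P_def by (rule sum.swap)
  also have "\<dots> = (\<Sum>i<n. a i / a i)"
  proof (rule sum.cong[OF refl])
    fix i
    have "(\<Sum>j<n. v i j / a i * v i j) = ip n (v i) (v i) / a i"
      unfolding ip_def sum_divide_distrib by (simp add: mult.commute)
    then show "(\<Sum>j<n. v i j / a i * v i j) = a i / a i" by (simp add: a_def)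
  qed
  also have "\<dots> = (\<Sum>i<n. 1)" using a_pos by (intro sum.cong) force+
  finally have "(\<Sum>j<n. \<Sum>l<n. (R j l)\<^sup>2) = 0" by (simp add: RR sum_subtractf)
  then have "\<forall>j\<in>{..<n}. (\<Sum>l<n. (R j l)\<^sup>2) = 0"
    by (subst (asm) sum_nonneg_eq_0_iff) (auto intro: sum_nonneg)
  then have "(\<Sum>l<n. (R j l)\<^sup>2) = 0" using j by auto
  then have "\<forall>l\<in>{..<n}. (R j l)\<^sup>2 = 0" by (subst (asm) sum_nonneg_eq_0_iff) auto
  then have "P j l = (if l = j then 1 else 0)" using l by (simp add: R_def)
  then show ?thesis by (simp add: P_def eq_commute[of l j])
qed

lemma ip_expansion: "ip n w x = (\<Sum>i<n. ip n w (v i) * ip n x (v i) / a i)"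
proof -
  have "(\<Sum>i<n. ip n w (v i) * ip n x (v i) / a i) = (\<Sum>i<n. \<Sum>j<n. \<Sum>l<n. w j * (x l * (v i j * v i l / a i)))"
    unfolding ip_def sum_product sum_divide_distrib by (simp add: mult_ac)
  also have "\<dots> = (\<Sum>j<n. \<Sum>l<n. \<Sum>i<n. w j * (x l * (v i j * v i l / a i)))"
    by (subst sum.swap, rule sum.cong[OF refl], rule sum.swap)
  also have "\<dots> = (\<Sum>j<n. \<Sum>l<n. if l = j then w j * x j else 0)"
    by (intro sum.cong refl) (simp only: sum_distrib_left[symmetric] completeness lessThan_iff, simp)
  also have "\<dots> = ip n w x" by (simp add: ip_def sum.delta)
  finally show ?thesis by simp
qed

lemma vec_expansion:
  assumes "w \<in> vecs n"
  shows "w = (\<lambda>j. \<Sum>i<n. ip n w (v i) / a i * v i j)"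
proof
  fix j
  show "w j = (\<Sum>i<n. ip n w (v i) / a i * v i j)"
  proof (cases "j < n")
    case True
    have "(\<Sum>i<n. ip n w (v i) / a i * v i j) = (\<Sum>i<n. \<Sum>l<n. w l * (v i j * v i l / a i))"
      unfolding ip_def sum_divide_distrib sum_distrib_right by (simp add: mult_ac)
    also have "\<dots> = (\<Sum>l<n. \<Sum>i<n. w l * (v i j * v i l / a i))" by (rule sum.swap)
    also have "\<dots> = (\<Sum>l<n. if l = j then w j else 0)"
      by (intro sum.cong refl) (simp only: sum_distrib_left[symmetric] completeness lessThan_iff True, simp)
    finally show ?thesis using True by (simp add: sum.delta)
  next
    case False
    then show ?thesis using assms v_vecs by (simp add: vecs_def)
  qed
qed

lemma ip_comb_v: "i < n \<Longrightarrow> ip n (\<lambda>j. \<Sum>l<n. c l * v l j) (v i) = c i * a i"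
proof -
  assume i: "i < n"
  have "ip n (\<lambda>j. \<Sum>l<n. c l * v l j) (v i) = (\<Sum>l<n. if l = i then c i * a i else 0)"
    unfolding ip_sum_left by (rule sum.cong) (use orth i in \<open>auto simp: a_def\<close>)
  then show ?thesis using i by (simp add: sum.delta)
qed

lemma ip_vec_v: "i < n \<Longrightarrow> ip n (vec k) (v i) = of_int (k i)"
  unfolding vec_def using ip_comb_v[of i "\<lambda>l. of_int (k l) / a l"] a_pos[of i] by simp

lemma vec_vecs: "vec k \<in> vecs n"
  unfolding vec_def using v_vecs by (intro vecs_sum) auto

lemma bij_vec: "bij_betw vec ivecs Msharp"
proof (rule bij_betwI[where g = "\<lambda>w. \<lambda>i\<in>{..<n}. \<lfloor>ip n w (v i)\<rfloor>"])
  show "vec \<in> ivecs \<rightarrow> Msharp"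
    by (auto simp: Msharp_def ip_vec_v vec_vecs)
  show "vec (\<lambda>i\<in>{..<n}. \<lfloor>ip n w (v i)\<rfloor>) = w" if "w \<in> Msharp" for w
  proof -
    have "vec (\<lambda>i\<in>{..<n}. \<lfloor>ip n w (v i)\<rfloor>) = (\<lambda>j. \<Sum>i<n. ip n w (v i) / a i * v i j)"
      unfolding vec_def by (intro ext sum.cong) (use that in \<open>auto simp: Msharp_def\<close>)
    also have "\<dots> = w" by (rule vec_expansion[symmetric]) (use that in \<open>simp add: Msharp_def\<close>)
    finally show ?thesis .
  qed
  show "(\<lambda>i\<in>{..<n}. \<lfloor>ip n (vec k) (v i)\<rfloor>) = k" if "k \<in> ivecs" for k
  proof
    show "(\<lambda>i\<in>{..<n}. \<lfloor>ip n (vec k) (v i)\<rfloor>) i = k i" for i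
      using that by (cases "i < n") (auto simp: ip_vec_v PiE_def extensional_def)
  qed
qed auto

lemma ip_vec: "ip n (vec k) x = (\<Sum>i<n. of_int (k i) * ip n x (v i) / a i)"
  by (subst ip_expansion) (simp add: ip_vec_v)

lemma ip_vec_self: "ip n (vec k) (vec k) = (\<Sum>i<n. (of_int (k i))\<^sup>2 / a i)"
  by (subst ip_vec) (simp add: ip_vec_v power2_eq_square)

lemma Lambda_subset_Msharp: "\<Lambda> \<subseteq> Msharp"
  using ip_Ints v\<Lambda> \<Lambda>_vecs by (auto simp: Msharp_def)

lemma summable_Msharp:
  assumes t: "t > 0"
  shows "(\<lambda>w. exp (- pi * t * ip n w w)) summable_on Msharp"
proof -
  define f where "f i m = exp (- pi * (t / a i) * (of_int m + 0)\<^sup>2)" for i and m :: int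
  have fs: "f i summable_on UNIV" if "i < n" for i
    unfolding f_def using t a_pos[OF that] by (intro gauss_summable_on_int) auto
  have nf: "norm (f i m) = f i m" for i m by (simp add: f_def)
  have "infsum (\<lambda>k. \<Prod>i<n. f i (k i)) ivecs = (\<Prod>i<n. infsum (f i) UNIV)"
    by (rule infsum_prod_PiE_abs) (use fs nf in auto)
  moreover have "infsum (f i) UNIV > 0" if "i < n" for i
  proof -
    have "0 < sum (f i) {0}" by (simp add: f_def)
    also have "\<dots> \<le> infsum (f i) UNIV"
      by (rule finite_sum_le_infsum) (use fs[OF that] in \<open>auto simp: f_def\<close>)
    finally show ?thesis .
  qed
  ultimately have "infsum (\<lambda>k. \<Prod>i<n. f i (k i)) ivecs > 0" by (auto intro!: prod_pos)
  \<comment> \<open>An \<open>infsum\<close> that does not exist has the default value 0, so the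
    positive value of the product certifies summability.\<close>
  then have "(\<lambda>k. \<Prod>i<n. f i (k i)) summable_on ivecs" using infsum_not_exists by fastforce
  also have "(\<lambda>k. \<Prod>i<n. f i (k i)) = (\<lambda>k. exp (- pi * t * ip n (vec k) (vec k)))"
    by (simp add: f_def exp_sum[symmetric] ip_vec_self sum_distrib_left sum_negf)
  finally show ?thesis using summable_on_reindex_bij_betw[OF bij_vec, of "\<lambda>w. exp (- pi * t * ip n w w)"] by simp
qed

end

section \<open>Cosets of the orthogonal sublattice and their characters\<close>

lemma prod_cis: "(\<Prod>i\<in>I. cis (f i)) = cis (\<Sum>i\<in>I. f i)"
  by (induction I rule: infinite_finite_induct) (auto simp: cis_mult)

lemma cis_eq_1_iff: "cis (2 * pi * r) = 1 \<longleftrightarrow> r \<in> \<int>"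
proof
  assume "cis (2 * pi * r) = 1"
  then have "cos (2 * pi * r) = 1" by (simp add: complex_eq_iff)
  then obtain m :: int where "2 * pi * r = m * 2 * pi" by (auto simp: cos_one_2pi_int)
  then have "r = m" by simp
  then show "r \<in> \<int>" by simp
qed simp

lemma cis_cong_Ints: "r - r' \<in> \<int> \<Longrightarrow> cis (2 * pi * r) = cis (2 * pi * r')"
  using cis_multiple_2pi[of "r - r'"] cis_mult[of "2 * pi * (r - r')" "2 * pi * r'"]
  by (simp add: algebra_simps)

lemma has_sum_finite_sum:
  fixes f :: "'a \<Rightarrow> 'b \<Rightarrow> 'c::topological_comm_monoid_add"
  assumes "finite I" "\<And>i. i \<in> I \<Longrightarrow> (f i has_sum S i) A"
  shows "((\<lambda>x. \<Sum>i\<in>I. f i x) has_sum (\<Sum>i\<in>I. S i)) A"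
  using assms by (induction I rule: finite_induct) (auto intro: has_sum_add)

text \<open>For \<open>\<epsilon> = 0\<close> this is the dual, for \<open>\<epsilon> = 1\<close> the shadow: the vectors \<open>w\<close> for which
  \<open>x \<mapsto> (-1)\<^bsup>\<epsilon>\<langle>x,x\<rangle>\<^esup> exp (2\<pi>i\<langle>w,x\<rangle>)\<close> is the trivial character.\<close>

definition twisted_dual :: "nat \<Rightarrow> (nat \<Rightarrow> real) set \<Rightarrow> int \<Rightarrow> (nat \<Rightarrow> real) set" where
  "twisted_dual n \<Lambda> \<epsilon> = {w \<in> vecs n. \<forall>x\<in>\<Lambda>. ip n w x + of_int \<epsilon> / 2 * ip n x x \<in> \<int>}"

context orthogonal_frame
begin

text \<open>Representatives of \<Lambda> modulo M: each coset has exactly one vector whose products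
  with the \<open>v i\<close> lie in this box.\<close>

definition G :: "(nat \<Rightarrow> real) set" where
  "G = {x \<in> \<Lambda>. \<forall>i<n. 0 \<le> ip n x (v i) \<and> ip n x (v i) < a i}"

definition shift :: "(nat \<Rightarrow> real) \<Rightarrow> (nat \<Rightarrow> int) \<Rightarrow> nat \<Rightarrow> real" where
  "shift g m = (\<lambda>j. g j + (\<Sum>i<n. of_int (m i) * v i j))"

lemma shift_Lambda: "g \<in> \<Lambda> \<Longrightarrow> shift g m \<in> \<Lambda>"
  unfolding shift_def using v\<Lambda> by (intro selfdual_add[OF sd] selfdual_sum[OF sd]) auto

lemma ip_shift_v: "i < n \<Longrightarrow> ip n (shift g m) (v i) = ip n g (v i) + of_int (m i) * a i"
  unfolding shift_def by (simp add: ip_add_left ip_comb_v)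

lemma vecs_eqI:
  assumes "x \<in> vecs n" "y \<in> vecs n" "\<And>i. i < n \<Longrightarrow> ip n x (v i) = ip n y (v i)"
  shows "x = y"
  using vec_expansion[OF assms(1)] vec_expansion[OF assms(2)] assms(3) by simp

lemma floor_quotient:
  fixes c :: real
  assumes "i < n" "0 \<le> c" "c < a i"
  shows "\<lfloor>(c + of_int m * a i) / a i\<rfloor> = m"
  using a_pos[OF assms(1)] assms by (intro floor_unique) (auto simp: field_simps)

text \<open>Division with remainder of \<open>ip n x (v i)\<close> by \<open>a i\<close> in each
  coordinate: the quotients give m, the remainders determine the representative.\<close>

lemma bij_shift: "bij_betw (\<lambda>(g, m). shift g m) (G \<times> ivecs) \<Lambda>"
proof (rule bij_betw_imageI)
  show "inj_on (\<lambda>(g, m). shift g m) (G \<times> ivecs)"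
  proof (rule inj_onI, clarify)
    fix g m g' m' assume g: "g \<in> G" "g' \<in> G" and m: "m \<in> ivecs" "m' \<in> ivecs" and eq: "shift g m = shift g' m'"
    have i: "m i = m' i \<and> ip n g (v i) = ip n g' (v i)" if "i < n" for i
    proof -
      have *: "ip n g (v i) + of_int (m i) * a i = ip n g' (v i) + of_int (m' i) * a i"
        using eq ip_shift_v[OF that] by metis
      have "m i = m' i"
        using floor_quotient[OF that, of "ip n g (v i)" "m i"] floor_quotient[OF that, of "ip n g' (v i)" "m' i"] g that *
        by (simp add: G_def)
      then show ?thesis using * by simp
    qed
    have "g = g'" by (rule vecs_eqI) (use g i \<Lambda>_vecs in \<open>auto simp: G_def\<close>)
    moreover have "m = m'" using m i by (intro PiE_ext[OF m]) auto
    ultimately show "g = g' \<and> m = m'" by simp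
  qed
  show "(\<lambda>(g, m). shift g m) ` (G \<times> ivecs) = \<Lambda>"
  proof (intro equalityI subsetI)
    fix x assume "x \<in> (\<lambda>(g, m). shift g m) ` (G \<times> ivecs)"
    then show "x \<in> \<Lambda>" by (auto simp: G_def shift_Lambda)
  next
    fix x assume x: "x \<in> \<Lambda>"
    define m where "m = (\<lambda>i\<in>{..<n}. \<lfloor>ip n x (v i) / a i\<rfloor>)"
    define g where "g = shift x (\<lambda>i. - m i)"
    have "ip n g (v i) = a i * frac (ip n x (v i) / a i)" if "i < n" for i
      using that a_pos[OF that] by (simp add: g_def ip_shift_v m_def frac_def field_simps)
    then have "g \<in> G" using x a_pos frac_lt_1
      by (auto simp: G_def g_def shift_Lambda less_imp_le)
    moreover have "shift g m = x" by (simp add: g_def shift_def sum_negf fun_eq_iff)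
    moreover have "m \<in> ivecs" by (simp add: m_def)
    ultimately show "x \<in> (\<lambda>(g, m). shift g m) ` (G \<times> ivecs)" by force
  qed
qed

lemma finite_G: "finite G"
proof -
  have "G \<subseteq> vec ` PiE {..<n} (\<lambda>i. {0..\<lfloor>a i\<rfloor>})"
  proof
    fix x assume x: "x \<in> G"
    then have "x \<in> vec ` ivecs"
      using Lambda_subset_Msharp bij_vec by (auto simp: G_def bij_betw_def)
    then obtain k where k: "k \<in> ivecs" "x = vec k" by blast
    have "k i \<in> {0..\<lfloor>a i\<rfloor>}" if "i < n" for i
    proof -
      have "0 \<le> k i \<and> of_int (k i) < a i" using x that k by (auto simp: G_def ip_vec_v)
      then show ?thesis by (auto simp: le_floor_iff)
    qed
    then show "x \<in> vec ` PiE {..<n} (\<lambda>i. {0..\<lfloor>a i\<rfloor>})" using k by (auto simp: PiE_def)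
  qed
  then show ?thesis by (rule finite_subset) (auto intro!: finite_PiE)
qed

lemma ip_shift_self: "ip n (shift g m) (shift g m) = (\<Sum>i<n. a i * (of_int (m i) + ip n g (v i) / a i)\<^sup>2)"
proof (subst ip_expansion, rule sum.cong[OF refl])
  fix i assume "i \<in> {..<n}"
  then show "ip n (shift g m) (v i) * ip n (shift g m) (v i) / a i = a i * (of_int (m i) + ip n g (v i) / a i)\<^sup>2"
    using a_pos[of i] by (simp add: ip_shift_v power2_eq_square field_simps)
qed

text \<open>Expanding the squares, the norm changes by 2 (m i) <g, v i> + (m i)^2 (a i) in each
  coordinate; the last term is even because \<open>a i\<close> is.\<close>

lemma ip_shift_self_diff:
  assumes "g \<in> \<Lambda>"
  shows "\<exists>k::int. ip n (shift g m) (shift g m) = ip n g g + 2 * of_int k"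
proof -
  define r where "r = (\<Sum>i<n. of_int (m i) * ip n g (v i) + (of_int (m i))\<^sup>2 * (a i / 2))"
  have "ip n (shift g m) (shift g m) = (\<Sum>i<n. ip n g (v i) * ip n g (v i) / a i + 2 * (of_int (m i) * ip n g (v i) + (of_int (m i))\<^sup>2 * (a i / 2)))"
    unfolding ip_shift_self
    by (rule sum.cong) (use a_pos in \<open>force simp: power2_eq_square field_simps\<close>)+
  also have "\<dots> = ip n g g + 2 * r"
    by (simp only: r_def ip_expansion[of g g] sum.distrib sum_distrib_left distrib_left)
  finally have "ip n (shift g m) (shift g m) = ip n g g + 2 * r" .
  moreover have "r \<in> \<int>" unfolding r_def
    by (intro Ints_sum Ints_add Ints_mult Ints_power Ints_of_int a_even ip_Ints[OF assms v\<Lambda>]) auto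
  ultimately show ?thesis by (auto elim: Ints_cases)
qed

text \<open>Orthogonality of characters on \<Lambda>/M. The summand is multiplicative in g in spite
  of its quadratic term, because the cross term \<epsilon> times <x,y> is an integer, and it is 1 on
  M because w lies in \<open>Msharp\<close> and norms in M are even. It is 1 on all of \<Lambda>
  exactly for w in the twisted dual.\<close>

lemma character_sum:
  assumes w: "w \<in> Msharp"
  shows "(\<Sum>g\<in>G. cis (2 * pi * (ip n w g + of_int \<epsilon> / 2 * ip n g g))) =
    (if w \<in> twisted_dual n \<Lambda> \<epsilon> then of_nat (card G) else 0)"
proof -
  define \<psi> where "\<psi> x = cis (2 * pi * (ip n w x + of_int \<epsilon> / 2 * ip n x x))" for x
  have add: "\<psi> (\<lambda>j. x j + y j) = \<psi> x * \<psi> y" if "x \<in> \<Lambda>" "y \<in> \<Lambda>" for x y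
  proof -
    have "\<psi> (\<lambda>j. x j + y j) = cis (2 * pi * ((ip n w x + of_int \<epsilon> / 2 * ip n x x) + (ip n w y + of_int \<epsilon> / 2 * ip n y y)))"
      unfolding \<psi>_def
    proof (rule cis_cong_Ints)
      have "of_int \<epsilon> * ip n x y \<in> \<int>" using ip_Ints[OF that] by auto
      then show "ip n w (\<lambda>j. x j + y j) + of_int \<epsilon> / 2 * ip n (\<lambda>j. x j + y j) (\<lambda>j. x j + y j) -
        ((ip n w x + of_int \<epsilon> / 2 * ip n x x) + (ip n w y + of_int \<epsilon> / 2 * ip n y y)) \<in> \<int>"
        unfolding ip_self_add ip_commute[of n w "\<lambda>j. x j + y j"] ip_add_left
        by (simp add: algebra_simps ip_commute[of n w])
    qed
    then show ?thesis by (simp add: \<psi>_def cis_mult distrib_left)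
  qed
  have sh: "\<psi> (shift x m) = \<psi> x" if "x \<in> \<Lambda>" for x m
    unfolding \<psi>_def
  proof (rule cis_cong_Ints)
    obtain k :: int where k: "ip n (shift x m) (shift x m) = ip n x x + 2 * of_int k"
      using ip_shift_self_diff[OF \<open>x \<in> \<Lambda>\<close>] by blast
    have "ip n w (shift x m) = ip n w x + (\<Sum>i<n. of_int (m i) * ip n w (v i))"
      unfolding ip_commute[of n w] shift_def ip_add_left ip_sum_left ..
    moreover have "(\<Sum>i<n. of_int (m i) * ip n w (v i)) \<in> \<int>"
      using w by (intro Ints_sum Ints_mult) (auto simp: Msharp_def)
    moreover have "of_int \<epsilon> * of_int k \<in> (\<int>::real set)" by simp
    ultimately show "ip n w (shift x m) + of_int \<epsilon> / 2 * ip n (shift x m) (shift x m) -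
        (ip n w x + of_int \<epsilon> / 2 * ip n x x) \<in> \<int>"
      unfolding k by (simp add: algebra_simps)
  qed
  have one: "\<psi> x = 1 \<longleftrightarrow> ip n w x + of_int \<epsilon> / 2 * ip n x x \<in> \<int>" for x
    unfolding \<psi>_def by (rule cis_eq_1_iff)
  have wv: "w \<in> vecs n" using w by (simp add: Msharp_def)
  have G\<Lambda>: "g \<in> \<Lambda>" if "g \<in> G" for g using that by (simp add: G_def)
  show ?thesis
  proof (cases "w \<in> twisted_dual n \<Lambda> \<epsilon>")
    case True
    then have "\<psi> g = 1" if "g \<in> G" for g using one G\<Lambda>[OF that] by (auto simp: twisted_dual_def)
    then show ?thesis using True by (simp add: \<psi>_def)
  next
    case False
    then obtain x where x: "x \<in> \<Lambda>" "\<psi> x \<noteq> 1" using one wv by (auto simp: twisted_dual_def)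
    have "\<forall>y\<in>\<Lambda>. \<exists>p. p \<in> G \<times> ivecs \<and> y = shift (fst p) (snd p)"
      using bij_shift by (force simp: bij_betw_def)
    from bchoice[OF this] obtain P where P: "\<forall>y\<in>\<Lambda>. P y \<in> G \<times> ivecs \<and> y = shift (fst (P y)) (snd (P y))" ..
    define red where "red y = fst (P y)" for y
    have redG: "red y \<in> G" if "y \<in> \<Lambda>" for y using P that by (auto simp: red_def mem_Times_iff)
    have redeq: "y = shift (red y) (snd (P y))" if "y \<in> \<Lambda>" for y using P that unfolding red_def by blast
    \<comment> \<open>Translation by x on the quotient, expressed on representatives. It permutes
      \<open>G\<close> and multiplies the sum by \<psi> x, which is not 1.\<close>
    define f where "f g = red (\<lambda>j. g j + x j)" for g
    have gx: "(\<lambda>j. g j + x j) \<in> \<Lambda>" if "g \<in> G" for g using selfdual_add[OF sd G\<Lambda>[OF that] x(1)] .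
    have fG: "f g \<in> G" if "g \<in> G" for g using redG[OF gx[OF that]] by (simp add: f_def)
    have inj: "inj_on f G"
    proof (rule inj_onI)
      fix g g' assume g: "g \<in> G" "g' \<in> G" and eq: "f g = f g'"
      define m m' where "m = snd (P (\<lambda>j. g j + x j))" and "m' = snd (P (\<lambda>j. g' j + x j))"
      have e: "(\<lambda>j. g j + x j) = shift (f g) m" "(\<lambda>j. g' j + x j) = shift (f g) m'"
        using redeq[OF gx[OF g(1)]] redeq[OF gx[OF g(2)]] eq by (simp_all add: f_def m_def m'_def)
      have "ip n g (v i) = ip n g' (v i)" if i: "i < n" for i
      proof -
        have "ip n g (v i) + ip n x (v i) = ip n (f g) (v i) + of_int (m i) * a i"
          "ip n g' (v i) + ip n x (v i) = ip n (f g) (v i) + of_int (m' i) * a i"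
          using arg_cong[OF e(1), of "\<lambda>y. ip n y (v i)"] arg_cong[OF e(2), of "\<lambda>y. ip n y (v i)"] i
          by (simp_all add: ip_add_left ip_shift_v)
        then have *: "ip n g (v i) = ip n g' (v i) + of_int (m i - m' i) * a i" by (simp add: algebra_simps)
        have "m i - m' i = 0"
          using floor_quotient[OF i, of "ip n g' (v i)" "m i - m' i"] floor_quotient[OF i, of "ip n g (v i)" 0] g i
          unfolding *[symmetric] by (simp add: G_def)
        then show ?thesis using * by simp
      qed
      then show "g = g'" using g G\<Lambda> \<Lambda>_vecs by (intro vecs_eqI) auto
    qed
    have "f ` G = G" using finite_G fG inj by (intro endo_inj_surj) auto
    then have "(\<Sum>g\<in>G. \<psi> g) = (\<Sum>g\<in>G. \<psi> (f g))" using sum.reindex[OF inj, of \<psi>] by (simp add: o_def)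
    also have "\<dots> = (\<Sum>g\<in>G. \<psi> g * \<psi> x)"
    proof (rule sum.cong[OF refl])
      fix g assume g: "g \<in> G"
      have "\<psi> (f g) = \<psi> (shift (f g) (snd (P (\<lambda>j. g j + x j))))" using sh G\<Lambda> fG g by simp
      also have "shift (f g) (snd (P (\<lambda>j. g j + x j))) = (\<lambda>j. g j + x j)"
        using redeq[OF gx[OF g]] by (simp add: f_def)
      finally show "\<psi> (f g) = \<psi> g * \<psi> x" using add[OF G\<Lambda>[OF g] x(1)] by simp
    qed
    also have "\<dots> = (\<Sum>g\<in>G. \<psi> g) * \<psi> x" by (simp add: sum_distrib_right)
    finally have "(\<Sum>g\<in>G. \<psi> g) * (1 - \<psi> x) = 0" by (simp add: algebra_simps)
    then show ?thesis using x False by (simp add: \<psi>_def)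
  qed
qed

lemma twisted_dual_subset: "twisted_dual n \<Lambda> \<epsilon> \<subseteq> Msharp"
proof
  fix w assume w: "w \<in> twisted_dual n \<Lambda> \<epsilon>"
  have "ip n w (v i) \<in> \<int>" if "i < n" for i
  proof -
    have "ip n w (v i) + of_int \<epsilon> / 2 * ip n (v i) (v i) \<in> \<int>"
      using w v\<Lambda>[OF that] by (simp add: twisted_dual_def)
    moreover have "of_int \<epsilon> * (a i / 2) \<in> \<int>" using a_even[OF that] by (intro Ints_mult) auto
    ultimately have "(ip n w (v i) + of_int \<epsilon> / 2 * ip n (v i) (v i)) - of_int \<epsilon> * (a i / 2) \<in> \<int>" by (rule Ints_diff)
    then show ?thesis by (simp add: a_def)
  qed
  then show "w \<in> Msharp" using w by (auto simp: Msharp_def twisted_dual_def)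
qed

end

lemma infsum_complex_of_real:
  "f summable_on A \<Longrightarrow> (\<Sum>\<^sub>\<infinity>x\<in>A. complex_of_real (f x)) = of_real (\<Sum>\<^sub>\<infinity>x\<in>A. f x)"
  by (intro infsumI has_sum_of_real has_sum_infsum)

context orthogonal_frame
begin

text \<open>In frame coordinates the Gaussian sum over a coset is a product of one-dimensional sums
  with parameters t * a i and shifts <g, v i> / a i. \<open>gauss_poisson\<close> inverts each
  factor; the dual variables together run through \<open>Msharp\<close>.\<close>

lemma coset_theta_inversion:
  assumes t: "t > 0" and g: "g \<in> \<Lambda>"
  shows "(\<Sum>\<^sub>\<infinity>m\<in>ivecs. complex_of_real (exp (- pi * t * ip n (shift g m) (shift g m)))) =
    of_real (1 / (\<Prod>i<n. sqrt (t * a i))) *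
      (\<Sum>\<^sub>\<infinity>w\<in>Msharp. of_real (exp (- pi * ip n w w / t)) * cis (2 * pi * ip n w g))"
proof -
  define \<gamma> where "\<gamma> i = ip n g (v i) / a i" for i
  define f where "f i m = exp (- pi * (t * a i) * (of_int m + \<gamma> i)\<^sup>2)" for i and m :: int
  define h where "h i k = complex_of_real (exp (- pi * (of_int k)\<^sup>2 / (t * a i))) * cis (2 * pi * of_int k * \<gamma> i)"
    for i and k :: int
  have ta: "t * a i > 0" if "i < n" for i using t a_pos[OF that] by simp
  have fs: "f i summable_on UNIV" if "i < n" for i
    unfolding f_def by (rule gauss_summable_on_int[OF ta[OF that]])
  have nf: "norm (complex_of_real (f i m)) = f i m" for i m by (simp add: f_def)
  have nh: "norm (h i k) = exp (- pi * (1 / (t * a i)) * (of_int k + 0)\<^sup>2)" for i k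
    by (simp add: h_def norm_mult)
  have hs: "(\<lambda>k. norm (h i k)) summable_on UNIV" if "i < n" for i
    unfolding nh by (rule gauss_summable_on_int) (use ta[OF that] in simp)
  have "complex_of_real (exp (- pi * t * ip n (shift g m) (shift g m))) = (\<Prod>i<n. complex_of_real (f i (m i)))" for m
    unfolding f_def of_real_prod[symmetric] exp_sum[OF finite_lessThan, symmetric] ip_shift_self \<gamma>_def
    by (simp add: sum_distrib_left mult.assoc sum_negf)
  then have "(\<Sum>\<^sub>\<infinity>m\<in>ivecs. complex_of_real (exp (- pi * t * ip n (shift g m) (shift g m)))) =
      (\<Sum>\<^sub>\<infinity>m\<in>ivecs. \<Prod>i<n. complex_of_real (f i (m i)))" by simp
  also have "\<dots> = (\<Prod>i<n. \<Sum>\<^sub>\<infinity>m. complex_of_real (f i m))"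
    by (rule infsum_prod_PiE_abs) (use fs nf in auto)
  also have "\<dots> = (\<Prod>i<n. of_real (1 / sqrt (t * a i)) * (\<Sum>\<^sub>\<infinity>k. h i k))"
  proof (rule prod.cong[OF refl])
    fix i assume i: "i \<in> {..<n}"
    then show "(\<Sum>\<^sub>\<infinity>m. complex_of_real (f i m)) = of_real (1 / sqrt (t * a i)) * (\<Sum>\<^sub>\<infinity>k. h i k)"
      using gauss_poisson[OF ta, of i "\<gamma> i"] infsum_complex_of_real[OF fs, of i] by (simp add: f_def h_def)
  qed
  also have "\<dots> = of_real (1 / (\<Prod>i<n. sqrt (t * a i))) * (\<Prod>i<n. \<Sum>\<^sub>\<infinity>k. h i k)"
    by (simp add: prod.distrib prod_dividef)
  also have "(\<Prod>i<n. \<Sum>\<^sub>\<infinity>k. h i k) = (\<Sum>\<^sub>\<infinity>k\<in>ivecs. \<Prod>i<n. h i (k i))"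
    by (rule infsum_prod_PiE_abs[symmetric]) (use hs in auto)
  also have "\<dots> = (\<Sum>\<^sub>\<infinity>k\<in>ivecs. of_real (exp (- pi * ip n (vec k) (vec k) / t)) * cis (2 * pi * ip n (vec k) g))"
  proof (rule infsum_cong)
    fix k
    have "(\<Prod>i<n. complex_of_real (exp (- pi * (of_int (k i))\<^sup>2 / (t * a i)))) = of_real (exp (- pi * ip n (vec k) (vec k) / t))"
      unfolding of_real_prod[symmetric] exp_sum[OF finite_lessThan, symmetric] ip_vec_self
      by (simp add: sum_distrib_left sum_divide_distrib mult.commute sum_negf)
    moreover have "(\<Prod>i<n. cis (2 * pi * of_int (k i) * \<gamma> i)) = cis (2 * pi * ip n (vec k) g)"
      unfolding prod_cis ip_vec \<gamma>_def by (simp add: sum_distrib_left mult.assoc)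
    ultimately show "(\<Prod>i<n. h i (k i)) = of_real (exp (- pi * ip n (vec k) (vec k) / t)) * cis (2 * pi * ip n (vec k) g)"
      unfolding h_def prod.distrib by simp
  qed
  also have "\<dots> = (\<Sum>\<^sub>\<infinity>w\<in>Msharp. of_real (exp (- pi * ip n w w / t)) * cis (2 * pi * ip n w g))"
    by (rule infsum_reindex_bij_betw[OF bij_vec, of "\<lambda>w. of_real (exp (- pi * ip n w w / t)) * cis (2 * pi * ip n w g)"])
  finally show ?thesis .
qed

text \<open>Once every coset is inverted, the finite sum over \<open>G\<close> moves inside the sum
  over \<open>Msharp\<close>, where \<open>character_sum\<close> retains only the twisted dual. The
  index of M is left unevaluated.\<close>

lemma theta_inversion_index:
  assumes t: "t > 0"
  shows "(\<Sum>\<^sub>\<infinity>x\<in>\<Lambda>. cis (pi * of_int \<epsilon> * ip n x x) * of_real (exp (- pi * t * ip n x x))) =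
    of_real (real (card G) / (\<Prod>i<n. sqrt (t * a i)) * (\<Sum>\<^sub>\<infinity>w\<in>twisted_dual n \<Lambda> \<epsilon>. exp (- pi * ip n w w / t)))"
proof -
  define F where "F x = cis (pi * of_int \<epsilon> * ip n x x) * complex_of_real (exp (- pi * t * ip n x x))" for x
  define E where "E w = exp (- pi * ip n w w / t)" for w
  define C where "C = 1 / (\<Prod>i<n. sqrt (t * a i))"
  let ?B = "\<lambda>g. \<Sum>\<^sub>\<infinity>w\<in>Msharp. complex_of_real (E w) * cis (2 * pi * ip n w g)"
  let ?\<chi> = "\<lambda>g. cis (pi * of_int \<epsilon> * ip n g g)"
  let ?e = "\<lambda>g m. complex_of_real (exp (- pi * t * ip n (shift g m) (shift g m)))"
  have nF: "norm (F x) = exp (- pi * t * ip n x x)" for x by (simp add: F_def norm_mult)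
  have Fs: "F summable_on \<Lambda>"
    by (rule abs_summable_summable) (use summable_on_subset_banach[OF summable_Msharp[OF t] Lambda_subset_Msharp] nF in simp)
  have Es: "E summable_on Msharp" using summable_Msharp[of "1 / t"] t by (simp add: E_def[abs_def])
  have "(\<lambda>p. F (case p of (g, m) \<Rightarrow> shift g m)) summable_on (G \<times> ivecs)"
    using summable_on_reindex_bij_betw[OF bij_shift, of F] Fs by simp
  then have Fs2: "(\<lambda>(g, m). F (shift g m)) summable_on (G \<times> ivecs)" by (simp add: case_prod_unfold)
  have chi: "cis (pi * of_int \<epsilon> * ip n (shift g m) (shift g m)) = ?\<chi> g" if g: "g \<in> G" for g m
  proof -
    obtain k :: int where k: "ip n (shift g m) (shift g m) = ip n g g + 2 * of_int k"
      using ip_shift_self_diff[of g m] g by (auto simp: G_def)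
    have "cis (2 * pi * (of_int \<epsilon> / 2 * ip n (shift g m) (shift g m))) = cis (2 * pi * (of_int \<epsilon> / 2 * ip n g g))"
      by (rule cis_cong_Ints) (simp add: k algebra_simps flip: of_int_mult)
    then show ?thesis by (simp add: mult_ac)
  qed
  have hsum: "((\<lambda>w. of_real (E w) * cis (2 * pi * ip n w g)) has_sum ?B g) Msharp" for g
    by (rule has_sum_infsum, rule abs_summable_summable) (use Es in \<open>simp add: norm_mult E_def[abs_def]\<close>)
  have "infsum F \<Lambda> = infsum (\<lambda>p. F (case p of (g, m) \<Rightarrow> shift g m)) (G \<times> ivecs)"
    by (rule infsum_reindex_bij_betw[OF bij_shift, symmetric])
  also have "\<dots> = infsum (\<lambda>(g, m). F (shift g m)) (G \<times> ivecs)" by (simp add: case_prod_unfold)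
  also have "\<dots> = (\<Sum>\<^sub>\<infinity>g\<in>G. \<Sum>\<^sub>\<infinity>m\<in>ivecs. F (shift g m))"
    by (rule infsum_Sigma'_banach[symmetric, OF Fs2])
  also have "\<dots> = (\<Sum>g\<in>G. \<Sum>\<^sub>\<infinity>m\<in>ivecs. F (shift g m))" using finite_G by simp
  also have "\<dots> = (\<Sum>g\<in>G. ?\<chi> g * (of_real C * ?B g))"
  proof (rule sum.cong[OF refl])
    fix g assume g: "g \<in> G"
    have "(\<Sum>\<^sub>\<infinity>m\<in>ivecs. F (shift g m)) = (\<Sum>\<^sub>\<infinity>m\<in>ivecs. ?\<chi> g * ?e g m)"
      by (rule infsum_cong) (simp only: F_def chi[OF g])
    also have "\<dots> = ?\<chi> g * (\<Sum>\<^sub>\<infinity>m\<in>ivecs. ?e g m)"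
      by (rule infsum_cmult_right')
    finally show "(\<Sum>\<^sub>\<infinity>m\<in>ivecs. F (shift g m)) = ?\<chi> g * (of_real C * ?B g)"
      using coset_theta_inversion[OF t, of g] g by (simp add: C_def E_def G_def)
  qed
  also have "\<dots> = of_real C * (\<Sum>g\<in>G. ?\<chi> g * ?B g)"
    by (simp add: sum_distrib_left mult_ac)
  also have "(\<Sum>g\<in>G. ?\<chi> g * ?B g) =
      (\<Sum>\<^sub>\<infinity>w\<in>Msharp. \<Sum>g\<in>G. ?\<chi> g * (of_real (E w) * cis (2 * pi * ip n w g)))"
    by (rule infsumI[symmetric], rule has_sum_finite_sum[OF finite_G], rule has_sum_cmult_right, rule hsum)
  also have "\<dots> = (\<Sum>\<^sub>\<infinity>w\<in>twisted_dual n \<Lambda> \<epsilon>. of_real (real (card G) * E w))"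
  proof (rule infsum_cong_neutral)
    have eq: "(\<Sum>g\<in>G. ?\<chi> g * (of_real (E w) * cis (2 * pi * ip n w g))) =
      of_real (E w) * (if w \<in> twisted_dual n \<Lambda> \<epsilon> then of_nat (card G) else 0)" if "w \<in> Msharp" for w
      unfolding character_sum[OF that, symmetric] sum_distrib_left
    proof (rule sum.cong[OF refl])
      fix g
      have "?\<chi> g * cis (2 * pi * ip n w g) = cis (2 * pi * (ip n w g + of_int \<epsilon> / 2 * ip n g g))"
        by (simp add: cis_mult algebra_simps)
      then show "?\<chi> g * (of_real (E w) * cis (2 * pi * ip n w g)) =
        of_real (E w) * cis (2 * pi * (ip n w g + of_int \<epsilon> / 2 * ip n g g))" by (metis mult.left_commute)
    qed
    show "(\<Sum>g\<in>G. ?\<chi> g * (of_real (E w) * cis (2 * pi * ip n w g))) = 0"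
      if "w \<in> Msharp - twisted_dual n \<Lambda> \<epsilon>" for w using that eq by simp
    show "(\<Sum>g\<in>G. ?\<chi> g * (of_real (E w) * cis (2 * pi * ip n w g))) = of_real (real (card G) * E w)"
      if "w \<in> Msharp \<inter> twisted_dual n \<Lambda> \<epsilon>" for w using that eq by simp
    show "complex_of_real (real (card G) * E w) = 0" if "w \<in> twisted_dual n \<Lambda> \<epsilon> - Msharp" for w
      using that twisted_dual_subset by auto
  qed
  also have "\<dots> = of_real (real (card G) * (\<Sum>\<^sub>\<infinity>w\<in>twisted_dual n \<Lambda> \<epsilon>. E w))"
    using summable_on_subset_banach[OF Es twisted_dual_subset, of \<epsilon>]
    by (subst infsum_complex_of_real) (auto intro!: summable_on_cmult_right simp: infsum_cmult_right')
  finally show ?thesis by (simp add: F_def C_def E_def)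
qed

end

section \<open>The inversion formula for the lattice, and the shadow\<close>

lemma twisted_dual_0: "selfdual n \<Lambda> \<Longrightarrow> twisted_dual n \<Lambda> 0 = \<Lambda>"
  by (auto simp: twisted_dual_def selfdual_mem)

lemma infsum_pos:
  fixes f :: "'a \<Rightarrow> real"
  assumes "f summable_on A" "\<And>x. x \<in> A \<Longrightarrow> f x \<ge> 0" "x0 \<in> A" "f x0 > 0"
  shows "infsum f A > 0"
proof -
  have "0 < sum f {x0}" using assms by simp
  also have "\<dots> \<le> infsum f A" by (rule finite_sum_le_infsum) (use assms in auto)
  finally show ?thesis .
qed

lemma ex_orthogonal_frame:
  assumes sd: "selfdual n \<Lambda>"
  obtains v where "orthogonal_frame n \<Lambda> v"
proof -
  obtain v where v: "\<And>i. i < n \<Longrightarrow> v i \<in> \<Lambda>" "\<And>i j. i < n \<Longrightarrow> j < n \<Longrightarrow> i \<noteq> j \<Longrightarrow> ip n (v i) (v j) = 0"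
    "\<And>i. i < n \<Longrightarrow> ip n (v i) (v i) > 0" using selfdual_orthogonal_vectors[OF sd] by blast
  have ipv: "ip n (\<lambda>l. 2 * v i l) (\<lambda>l. 2 * v j l) = 4 * ip n (v i) (v j)" for i j
    by (simp add: ip_def sum_distrib_left mult_ac)
  \<comment> \<open>Doubling the vectors multiplies their integral norms by 4, hence makes them
    even.\<close>
  have "orthogonal_frame n \<Lambda> (\<lambda>i l. 2 * v i l)"
  proof
    show "(\<lambda>l. 2 * v i l) \<in> \<Lambda>" if "i < n" for i
      using selfdual_add[OF sd v(1) v(1), OF that that] by (simp only: mult_2)
    show "even_norm n (\<lambda>l. 2 * v i l)" if i: "i < n" for i
    proof -
      have "ip n (v i) (v i) \<in> \<int>" using sd v(1)[OF i] by (auto simp: selfdual_mem)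
      then obtain m :: int where "ip n (v i) (v i) = of_int m" by (auto elim: Ints_cases)
      then show ?thesis unfolding even_norm_def ipv by (intro exI[of _ "2 * m"]) simp
    qed
  qed (use sd v ipv in auto)
  then show ?thesis using that by blast
qed

text \<open>For \<epsilon> = 0 and t = 1 both sides of \<open>theta_inversion_index\<close> contain
  the same positive sum over \<Lambda>, the twisted dual being \<Lambda> itself. This forces
  \<open>card G\<close> to be the product of the sqrt (a i), which then serves every t and
  \<epsilon>.\<close>

theorem lattice_theta_inversion:
  assumes sd: "selfdual n \<Lambda>" and t: "t > 0"
  shows "(\<Sum>\<^sub>\<infinity>x\<in>\<Lambda>. cis (pi * of_int \<epsilon> * ip n x x) * of_real (exp (- pi * t * ip n x x))) =
    of_real (1 / sqrt t ^ n * (\<Sum>\<^sub>\<infinity>w\<in>twisted_dual n \<Lambda> \<epsilon>. exp (- pi * ip n w w / t)))"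
proof -
  obtain v where "orthogonal_frame n \<Lambda> v" using ex_orthogonal_frame[OF sd] .
  then interpret orthogonal_frame n \<Lambda> v .
  define S where "S = (\<Sum>\<^sub>\<infinity>x\<in>\<Lambda>. exp (- pi * ip n x x))"
  have summ: "(\<lambda>x. exp (- pi * ip n x x)) summable_on \<Lambda>"
    using summable_on_subset_banach[OF summable_Msharp[of 1] Lambda_subset_Msharp] by simp
  have "S > 0" unfolding S_def
    by (rule infsum_pos[OF summ _ selfdual_zero[OF sd]]) auto
  have "complex_of_real S = of_real (real (card G) / (\<Prod>i<n. sqrt (a i)) * S)"
    using theta_inversion_index[of 1 0] infsum_complex_of_real[OF summ] by (simp add: twisted_dual_0[OF sd] S_def)
  then have "S = real (card G) / (\<Prod>i<n. sqrt (a i)) * S" by (simp only: of_real_eq_iff)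
  then have "(real (card G) / (\<Prod>i<n. sqrt (a i)) - 1) * S = 0" by (simp only: left_diff_distrib)
  with \<open>S > 0\<close> have one: "real (card G) / (\<Prod>i<n. sqrt (a i)) = 1"
    by (metis eq_iff_diff_eq_0 less_irrefl mult_eq_0_iff)
  have "(\<Prod>i<n. sqrt (t * a i)) = sqrt t ^ n * (\<Prod>i<n. sqrt (a i))"
    by (simp add: real_sqrt_mult prod.distrib)
  then have "real (card G) / (\<Prod>i<n. sqrt (t * a i)) = 1 / sqrt t ^ n"
    using one by (metis divide_divide_eq_left' mult.commute)
  then show ?thesis using theta_inversion_index[OF t, of \<epsilon>] by simp
qed

lemma summable_gauss_twisted_dual:
  assumes sd: "selfdual n \<Lambda>" and t: "t > 0"
  shows "(\<lambda>w. exp (- pi * t * ip n w w)) summable_on twisted_dual n \<Lambda> \<epsilon>"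
proof -
  obtain v where "orthogonal_frame n \<Lambda> v" using ex_orthogonal_frame[OF sd] .
  then interpret orthogonal_frame n \<Lambda> v .
  show ?thesis using summable_on_subset_banach[OF summable_Msharp[OF t] twisted_dual_subset] .
qed

text \<open>For even \<Lambda> the term <x,x>/2 is an integer and the condition is that of the dual.
  For odd \<Lambda>, two vectors of odd norm add up to one of even norm. So a w in the dual of the
  even part that is integral on one vector of odd norm is integral on all of \<Lambda> and lies in
  it; any other w is half an odd integer on vectors of odd norm, which compensates <x,x>/2.\<close>

lemma shadow_eq_twisted_dual:
  assumes sd: "selfdual n \<Lambda>"
  shows "shadow n \<Lambda> = twisted_dual n \<Lambda> 1"
proof (cases "even_lattice n \<Lambda>")
  case True
  have "ip n w x + 1 / 2 * ip n x x \<in> \<int> \<longleftrightarrow> ip n w x \<in> \<int>" if x: "x \<in> \<Lambda>" for w x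
  proof -
    obtain m :: int where "ip n x x = 2 * of_int m" using True x unfolding even_lattice_def even_norm_def by blast
    then have "1 / 2 * ip n x x \<in> \<int>" by simp
    then show ?thesis by (rule add_in_Ints_iff_right)
  qed
  then have "twisted_dual n \<Lambda> 1 = dual n \<Lambda>" by (auto simp: twisted_dual_def dual_def)
  then have "twisted_dual n \<Lambda> 1 = \<Lambda>" using sd by (simp add: selfdual_def)
  then show ?thesis using True by (simp add: shadow_def)
next
  case False
  have ints: "ip n x y \<in> \<int>" if "x \<in> \<Lambda>" "y \<in> \<Lambda>" for x y using sd that by (auto simp: selfdual_mem)
  have odd: "ip n x x / 2 + 1 / 2 \<in> \<int>" if x: "x \<in> \<Lambda>" "\<not> even_norm n x" for x
  proof -
    obtain m :: int where m: "ip n x x = of_int m" using ints[OF x(1) x(1)] by (auto elim: Ints_cases)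
    have "odd m"
    proof
      assume "even m"
      then obtain k where "m = 2 * k" by (elim evenE)
      then show False using m x(2) by (auto simp: even_norm_def)
    qed
    then obtain k where "m = 2 * k + 1" by (elim oddE)
    then have "ip n x x / 2 + 1 / 2 = of_int (k + 1)" using m by (simp add: field_simps)
    then show ?thesis by (metis Ints_of_int)
  qed
  have ev: "ip n x x / 2 \<in> \<int>" if "even_norm n x" for x using that by (auto simp: even_norm_def)
  have half: "(1 / 2 :: real) \<notin> \<int>"
  proof
    assume "(1 / 2 :: real) \<in> \<int>"
    then obtain k :: int where "1 / 2 = real_of_int k" by (auto elim: Ints_cases)
    then have "1 = 2 * k" by linarith
    then show False by presburger
  qed
  obtain x0 where x0: "x0 \<in> \<Lambda>" "\<not> even_norm n x0" using False by (auto simp: even_lattice_def)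
  have "w \<in> dual n {x \<in> \<Lambda>. even_norm n x} - \<Lambda> \<longleftrightarrow> w \<in> twisted_dual n \<Lambda> 1" for w
  proof
    assume w: "w \<in> twisted_dual n \<Lambda> 1"
    have tw: "ip n w x + ip n x x / 2 \<in> \<int>" if "x \<in> \<Lambda>" for x using w that by (simp add: twisted_dual_def)
    have "ip n w x \<in> \<int>" if "x \<in> \<Lambda>" "even_norm n x" for x
      using Ints_diff[OF tw[OF that(1)] ev[OF that(2)]] by simp
    moreover have "w \<notin> \<Lambda>"
    proof
      assume w\<Lambda>: "w \<in> \<Lambda>"
      have "(ip n x0 x0 / 2 + 1 / 2) - ((ip n w x0 + ip n x0 x0 / 2) - ip n w x0) \<in> \<int>"
        by (rule Ints_diff[OF odd[OF x0] Ints_diff[OF tw[OF x0(1)] ints[OF w\<Lambda> x0(1)]]])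
      then show False using half by simp
    qed
    ultimately show "w \<in> dual n {x \<in> \<Lambda>. even_norm n x} - \<Lambda>" using w by (auto simp: dual_def twisted_dual_def)
  next
    assume w: "w \<in> dual n {x \<in> \<Lambda>. even_norm n x} - \<Lambda>"
    have w0: "ip n w x \<in> \<int>" if "x \<in> \<Lambda>" "even_norm n x" for x using w that by (auto simp: dual_def)
    have wv: "w \<in> vecs n" using w by (simp add: dual_def)
    have sum_even: "even_norm n (\<lambda>j. x j + y j)" if x: "x \<in> \<Lambda>" "\<not> even_norm n x" and y: "y \<in> \<Lambda>" "\<not> even_norm n y" for x y
    proof -
      have "(ip n x x / 2 + 1 / 2) + (ip n y y / 2 + 1 / 2) + ip n x y - 1 \<in> \<int>"
        by (rule Ints_diff[OF Ints_add[OF Ints_add[OF odd[OF x] odd[OF y]] ints[OF x(1) y(1)]] Ints_1])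
      then obtain k :: int where "(ip n x x / 2 + 1 / 2) + (ip n y y / 2 + 1 / 2) + ip n x y - 1 = of_int k" by (auto elim: Ints_cases)
      then have "ip n x x + 2 * ip n x y + ip n y y = 2 * of_int k" by simp
      then show ?thesis unfolding even_norm_def ip_self_add by blast
    qed
    have wsum: "ip n w x + ip n w y \<in> \<int>" if x: "x \<in> \<Lambda>" "\<not> even_norm n x" and y: "y \<in> \<Lambda>" "\<not> even_norm n y" for x y
      using w0[OF selfdual_add[OF sd x(1) y(1)] sum_even[OF x y]]
      by (simp add: ip_commute[of n w] ip_add_left)
    have nonint: "ip n w x \<notin> \<int>" if x: "x \<in> \<Lambda>" "\<not> even_norm n x" for x
    proof
      assume *: "ip n w x \<in> \<int>"
      have "ip n w y \<in> \<int>" if "y \<in> \<Lambda>" for y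
      proof (cases "even_norm n y")
        case False
        then show ?thesis using Ints_diff[OF wsum[OF x that False] *] by simp
      qed (use w0 that in auto)
      then have "w \<in> \<Lambda>" using wv selfdual_mem[OF sd, of w] by blast
      then show False using w by simp
    qed
    have "ip n w x + ip n x x / 2 \<in> \<int>" if x: "x \<in> \<Lambda>" for x
    proof (cases "even_norm n x")
      case True
      then show ?thesis using w0[OF x] ev by auto
    next
      case False
      obtain k :: int where k: "ip n w x + ip n w x = of_int k" using wsum[OF x False x False] by (auto elim: Ints_cases)
      have "odd k"
      proof
        assume "even k"
        then obtain l where "k = 2 * l" by (elim evenE)
        then have "ip n w x = of_int l" using k by simp
        then show False using nonint[OF x False] by simp
      qed
      then obtain l where "k = 2 * l + 1" by (elim oddE)
      then have "ip n w x - 1 / 2 = of_int l" using k by simp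
      then have "ip n w x - 1 / 2 \<in> \<int>" by (metis Ints_of_int)
      then show ?thesis using Ints_add[OF _ odd[OF x False]] by fastforce
    qed
    then show "w \<in> twisted_dual n \<Lambda> 1" using wv by (simp add: twisted_dual_def)
  qed
  then show ?thesis using False by (auto simp: shadow_def)
qed

text \<open>Doubling the condition of the twisted dual shows that 2w pairs integrally with
  \<Lambda>; by selfduality 2w lies in \<Lambda>, so <2w,2w> is an integer.\<close>

lemma shadow_norm_quarter:
  assumes sd: "selfdual n \<Lambda>" and w: "w \<in> shadow n \<Lambda>"
  shows "\<exists>j::nat. ip n w w = real j / 4"
proof -
  have w: "w \<in> twisted_dual n \<Lambda> 1" using w shadow_eq_twisted_dual[OF sd] by simp
  have ints: "ip n x y \<in> \<int>" if "x \<in> \<Lambda>" "y \<in> \<Lambda>" for x y using sd that by (auto simp: selfdual_mem)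
  have "(\<lambda>j. 2 * w j) \<in> \<Lambda>"
  proof (subst selfdual_mem[OF sd], intro conjI ballI)
    show "(\<lambda>j. 2 * w j) \<in> vecs n" using w by (simp add: twisted_dual_def vecs_def)
    fix x assume x: "x \<in> \<Lambda>"
    have "ip n w x + ip n x x / 2 \<in> \<int>" using w x by (simp add: twisted_dual_def)
    then have "2 * (ip n w x + ip n x x / 2) - ip n x x \<in> \<int>" using ints[OF x x] by (intro Ints_diff Ints_mult) auto
    then show "ip n (\<lambda>j. 2 * w j) x \<in> \<int>" by (simp add: ip_scale_left)
  qed
  then have "ip n (\<lambda>j. 2 * w j) (\<lambda>j. 2 * w j) \<in> \<int>" using ints by blast
  then have "4 * ip n w w \<in> \<int>" by (simp add: ip_def sum_distrib_left mult_ac)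
  then obtain k :: int where k: "4 * ip n w w = of_int k" by (auto elim: Ints_cases)
  then have "k \<ge> 0" using ip_self_nonneg[of n w] by (metis mult_nonneg_nonneg of_int_0_le_iff zero_le_numeral)
  then show ?thesis using k by (intro exI[of _ "nat k"]) simp
qed

section \<open>Functions on the upper half-plane invariant under the theta group\<close>

definition uhp :: "complex set" where "uhp = {z. Im z > 0}"

definition qexp :: "complex \<Rightarrow> complex" where "qexp z = exp (\<i> * of_real pi * z)"

text \<open>Neighbourhoods are half-planes Im z >= c, so limits are uniform in Re z and survive the
  translation z + 1.\<close>

definition at_cusp :: "complex filter" where "at_cusp = filtercomap Im at_top"

lemma open_uhp: "open uhp"
  unfolding uhp_def using open_halfspace_Im_gt[of 0] by simp

lemma connected_uhp: "connected uhp"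
  unfolding uhp_def using convex_halfspace_Im_gt[of 0] by (intro convex_connected) simp

lemma uhp_nonzero: "z \<in> uhp \<Longrightarrow> z \<noteq> 0"
  by (auto simp: uhp_def)

lemma Im_inverse_neg: "Im (- 1 / z) = Im z / (norm z)\<^sup>2"
  by (simp add: Im_divide cmod_power2)

lemma uhp_inverse: "z \<in> uhp \<Longrightarrow> - 1 / z \<in> uhp"
  using uhp_nonzero[of z] unfolding uhp_def mem_Collect_eq Im_inverse_neg by auto

lemma uhp_add_real: "z \<in> uhp \<Longrightarrow> Im c = 0 \<Longrightarrow> z + c \<in> uhp"
  by (auto simp: uhp_def)

lemma uhp_cusp1: "z \<in> uhp \<Longrightarrow> 1 - 1 / z \<in> uhp"
  using uhp_add_real[OF uhp_inverse, of z 1] by simp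

lemma norm_qexp: "norm (qexp z) = exp (- pi * Im z)"
  by (simp add: qexp_def norm_exp_eq_Re)

lemma qexp_nonzero: "qexp z \<noteq> 0"
  by (simp add: qexp_def)

lemma qexp_in_ball: "z \<in> uhp \<Longrightarrow> qexp z \<in> ball 0 1"
  by (auto simp: norm_qexp uhp_def)

lemma holomorphic_qexp [holomorphic_intros]: "qexp holomorphic_on A"
  unfolding qexp_def[abs_def] by (intro holomorphic_intros)

lemma qexp_add_2: "qexp (z + 2) = qexp z"
proof -
  have "\<i> * of_real pi * (z + 2) = \<i> * of_real pi * z + 2 * of_real pi * \<i>" by (simp add: algebra_simps)
  then show ?thesis unfolding qexp_def by (simp add: exp_add exp_two_pi_i)
qed

lemma qexp_add_1: "qexp (z + 1) = - qexp z"
proof -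
  have "\<i> * of_real pi * (z + 1) = \<i> * of_real pi * z + of_real pi * \<i>" by (simp add: algebra_simps)
  then show ?thesis unfolding qexp_def by (simp add: exp_add)
qed

lemma ex_qexp:
  assumes "0 < norm q" "norm q < 1"
  obtains z where "z \<in> uhp" "qexp z = q"
proof
  define z where "z = Ln q / (\<i> * of_real pi)"
  have "q \<noteq> 0" using assms by auto
  then show "qexp z = q" by (simp add: qexp_def z_def)
  then have "exp (- pi * Im z) < exp 0" using assms norm_qexp[of z] by simp
  then show "z \<in> uhp" by (simp add: uhp_def zero_less_mult_iff)
qed

lemma at_cusp_neq_bot [simp]: "at_cusp \<noteq> bot"
  unfolding at_cusp_def by (rule filtercomap_neq_bot_surj) (auto intro!: surjI[of _ "Complex 0"])

lemma filterlim_qexp_at_cusp: "(qexp \<longlongrightarrow> 0) at_cusp"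
proof (rule tendsto_norm_zero_cancel)
  have "filterlim Im at_top at_cusp" unfolding at_cusp_def by (rule filterlim_filtercomap)
  then have "filterlim (\<lambda>z. - pi * Im z) at_bot at_cusp"
    by (intro filterlim_tendsto_neg_mult_at_bot[OF tendsto_const]) auto
  then show "((\<lambda>z. norm (qexp z)) \<longlongrightarrow> 0) at_cusp"
    unfolding norm_qexp by (rule filterlim_compose[OF exp_at_bot])
qed

lemma filterlim_add_1_at_cusp: "filterlim (\<lambda>z. z + 1) at_cusp at_cusp"
  unfolding at_cusp_def filterlim_filtercomap_iff
  using filterlim_filtercomap[of Im at_top] by (simp add: o_def)

lemma eventually_uhp_at_cusp: "eventually (\<lambda>z. z \<in> uhp) at_cusp"
  using filterlim_filtercomap[of Im at_top] unfolding at_cusp_def uhp_def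
  by (simp add: filterlim_at_top_dense)

text \<open>The positive imaginary axis accumulates at i inside the connected \<open>uhp\<close>.
  This turns real inversion formulas into identities of holomorphic functions.\<close>

lemma uhp_identity:
  assumes f: "f holomorphic_on uhp" and g: "g holomorphic_on uhp"
    and eq: "\<And>t. t > 0 \<Longrightarrow> f (\<i> * of_real t) = g (\<i> * of_real t)" and z: "z \<in> uhp"
  shows "f z = g z"
proof -
  have "f z - g z = 0"
  proof (rule analytic_continuation[where f = "\<lambda>z. f z - g z" and S = uhp and \<xi> = \<i> and
        U = "(\<lambda>t. \<i> * of_real t) ` {0<..}"])
    show "\<i> islimpt (\<lambda>t. \<i> * complex_of_real t) ` {0<..}"
    proof (rule islimptI)
      fix T :: "complex set" assume T: "\<i> \<in> T" "open T"
      then obtain e where e: "e > 0" "ball \<i> e \<subseteq> T" using openE by blast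
      define y where "y = \<i> * complex_of_real (1 + e / 2)"
      have d: "y - \<i> = \<i> * of_real (e / 2)" by (simp add: y_def algebra_simps)
      have "dist \<i> y = norm (y - \<i>)" by (simp add: dist_norm norm_minus_commute)
      also have "\<dots> = e / 2" unfolding d using e by (simp add: norm_mult)
      finally have "dist \<i> y = e / 2" .
      then have "y \<in> T" "y \<noteq> \<i>" using e by auto
      moreover have "y \<in> (\<lambda>t. \<i> * complex_of_real t) ` {0<..}" unfolding y_def using e by (intro imageI) auto
      ultimately show "\<exists>y\<in>(\<lambda>t. \<i> * complex_of_real t) ` {0<..}. y \<in> T \<and> y \<noteq> \<i>" by blast
    qed
  qed (use f g eq z open_uhp connected_uhp in \<open>auto intro!: holomorphic_intros simp: uhp_def\<close>)
  then show ?thesis by simp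
qed

text \<open>No zero divisors: f is nonzero near z0, so g vanishes on a small disc and then on all of
  S.\<close>

lemma holomorphic_product_zero:
  assumes f: "f holomorphic_on S" and g: "g holomorphic_on S" and S: "open S" "connected S"
    and eq: "\<And>z. z \<in> S \<Longrightarrow> f z * g z = 0" and z0: "z0 \<in> S" "f z0 \<noteq> 0" and z: "z \<in> S"
  shows "g z = (0::complex)"
proof -
  have "isCont f z0" using f S z0 holomorphic_on_imp_continuous_on continuous_on_eq_continuous_at by blast
  then obtain e where e: "e > 0" "\<And>y. dist z0 y < e \<Longrightarrow> f y \<noteq> 0"
    using continuous_at_avoid[of z0 f 0] z0 by auto
  show ?thesis
  proof (rule analytic_continuation[where f = g and S = S and U = "S \<inter> ball z0 e" and \<xi> = z0])
    show "z0 islimpt S \<inter> ball z0 e"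
      using S z0 e by (intro interior_limit_point) (auto simp: interior_open open_Int)
    show "g w = 0" if "w \<in> S \<inter> ball z0 e" for w using eq[of w] e(2)[of w] that by auto
  qed (use g S z0 z in auto)
qed

text \<open>Outside \<open>Im z \<ge> 1/2\<close>, translating to \<open>\<bar>Re z\<bar> \<le> 1/2\<close> and inverting at least doubles the imaginary part.\<close>

lemma modular_reduction:
  assumes z: "z \<in> uhp"
    and base: "\<And>z. \<bar>Re z\<bar> \<le> 1 / 2 \<Longrightarrow> Im z \<ge> 1 / 2 \<Longrightarrow> Q z"
    and T: "\<And>z. z \<in> uhp \<Longrightarrow> Q (z + 1) \<longleftrightarrow> Q z"
    and S: "\<And>z. z \<in> uhp \<Longrightarrow> Q (- 1 / z) \<longleftrightarrow> Q z"
  shows "Q z"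
proof -
  have shift: "Q (z + of_int m) \<longleftrightarrow> Q z" if z: "z \<in> uhp" for z m
  proof (induction m rule: int_induct[of _ 0])
    case (step1 i)
    then show ?case using T[OF uhp_add_real[OF z, of "of_int i"]] by (simp add: add.assoc)
  next
    case (step2 i)
    then show ?case using T[OF uhp_add_real[OF z, of "of_int (i - 1)"]] by (simp add: algebra_simps)
  qed simp
  have "Q z" if "z \<in> uhp" "Im z \<ge> 1 / 2 / 2 ^ k" for k z
    using that
  proof (induction k arbitrary: z)
    case (0 z)
    have "Q (z + of_int (- round (Re z)))"
      using of_int_round_abs_le[of "Re z"] 0 by (intro base) (auto simp: abs_minus_commute)
    then show ?case using shift[OF 0(1)] by blast
  next
    case (Suc k z)
    define w where "w = z + of_int (- round (Re z))"
    have w: "\<bar>Re w\<bar> \<le> 1 / 2" "Im w = Im z"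
      using of_int_round_abs_le[of "Re z"] by (auto simp: w_def abs_minus_commute)
    have wu: "w \<in> uhp" using Suc.prems w by (simp add: uhp_def)
    have "Q w"
    proof (cases "Im w \<ge> 1 / 2")
      case False
      have "(Re w)\<^sup>2 \<le> (1 / 2)\<^sup>2" using w(1) by (metis abs_le_square_iff abs_of_nonneg zero_le_divide_1_iff zero_le_numeral)
      moreover have "(Im w)\<^sup>2 \<le> (1 / 2)\<^sup>2" using False wu by (intro power_mono) (auto simp: uhp_def)
      ultimately have "(Re w)\<^sup>2 + (Im w)\<^sup>2 \<le> (1 / 2)\<^sup>2 + (1 / 2)\<^sup>2" by (rule add_mono)
      then have "(norm w)\<^sup>2 \<le> 1 / 2" unfolding cmod_power2 by (simp add: power_divide)
      moreover have "0 < (norm w)\<^sup>2" using uhp_nonzero[OF wu] by simp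
      ultimately have "Im w * 2 \<le> Im w / (norm w)\<^sup>2"
        using wu by (simp add: uhp_def field_simps mult_left_mono)
      moreover have "(1 / 2 / 2 ^ k :: real) = 1 / 2 / 2 ^ Suc k * 2" by simp
      ultimately have "Im (- 1 / w) \<ge> 1 / 2 / 2 ^ k"
        using Suc.prems w(2) unfolding Im_inverse_neg by linarith
      then have "Q (- 1 / w)" using Suc.IH uhp_inverse[OF wu] by blast
      then show ?thesis using S[OF wu] by simp
    qed (use base w in auto)
    then show ?case using shift[OF Suc.prems(1)] unfolding w_def by blast
  qed
  moreover obtain k where "1 / 2 / 2 ^ k \<le> Im z"
  proof -
    have "Im z > 0" using z by (simp add: uhp_def)
    then obtain k where "(1 / 2) ^ k < Im z" using real_arch_pow_inv[of "Im z" "1 / 2"] by auto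
    moreover have "1 / 2 / 2 ^ k \<le> (1 / 2 :: real) ^ k" by (simp add: power_one_over field_simps)
    ultimately show ?thesis using that[of k] by linarith
  qed
  ultimately show ?thesis using z by blast
qed

text \<open>If U z were nonzero, then |U| < |U z| high up, while every other point is equivalent to
  a high one or to one in the compact \<open>K\<close>. So |U| attains a maximum over
  \<open>uhp\<close> in \<open>K\<close>, U is constant by the maximum principle, and the limit
  makes the constant 0.\<close>

lemma level_one_zero:
  assumes hol: "U holomorphic_on uhp"
    and T: "\<And>z. z \<in> uhp \<Longrightarrow> U (z + 1) = U z" and S: "\<And>z. z \<in> uhp \<Longrightarrow> U (- 1 / z) = U z"
    and lim: "(U \<longlongrightarrow> 0) at_cusp" and z: "z \<in> uhp"
  shows "U z = 0"
proof (rule ccontr)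
  assume nz: "U z \<noteq> 0"
  have "eventually (\<lambda>y. norm (U y) < norm (U z)) at_cusp"
    using tendsto_norm_zero[OF lim] nz by (intro order_tendstoD(2)) auto
  then obtain Y0 where Y0: "\<And>y. Im y \<ge> Y0 \<Longrightarrow> norm (U y) < norm (U z)"
    unfolding at_cusp_def eventually_filtercomap eventually_at_top_linorder by blast
  define Y where "Y = max Y0 1"
  define K where "K = cbox (Complex (- 1 / 2) (1 / 2)) (Complex (1 / 2) Y)"
  have K: "w \<in> K \<longleftrightarrow> \<bar>Re w\<bar> \<le> 1 / 2 \<and> 1 / 2 \<le> Im w \<and> Im w \<le> Y" for w
    by (auto simp: K_def in_cbox_complex_iff)
  have "Complex 0 1 \<in> K" by (auto simp: K Y_def)
  then have Kne: "K \<noteq> {}" by blast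
  have Ku: "K \<subseteq> uhp" by (auto simp: K uhp_def)
  have "continuous_on K (\<lambda>w. norm (U w))"
    using holomorphic_on_imp_continuous_on[OF hol] Ku by (intro continuous_intros) (auto intro: continuous_on_subset)
  moreover have "compact K" by (simp add: K_def)
  ultimately obtain w where w: "w \<in> K" "\<And>y. y \<in> K \<Longrightarrow> norm (U y) \<le> norm (U w)"
    using continuous_attains_sup[of K "\<lambda>w. norm (U w)"] Kne by blast
  have far: "norm (U y) < norm (U z)" if "Im y \<ge> Y" for y using Y0 that by (auto simp: Y_def)
  have le: "norm (U y) \<le> norm (U w) \<or> norm (U y) < norm (U z)" if "y \<in> uhp" for y
    by (rule modular_reduction[OF that, of "\<lambda>y. norm (U y) \<le> norm (U w) \<or> norm (U y) < norm (U z)"])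
       (use T S w(2) far K in force)+
  have zw: "norm (U z) \<le> norm (U w)" using le[OF z] by auto
  have max: "norm (U y) \<le> norm (U w)" if "y \<in> uhp" for y using le[OF that] zw by auto
  have "U constant_on uhp"
    by (rule maximum_modulus_principle[OF hol open_uhp connected_uhp open_uhp order.refl, of w])
       (use w Ku max in auto)
  then obtain c where c: "\<And>y. y \<in> uhp \<Longrightarrow> U y = c" unfolding constant_on_def by blast
  have "eventually (\<lambda>y. U y = c) at_cusp" using eventually_uhp_at_cusp by eventually_elim (rule c)
  then have "(U \<longlongrightarrow> c) at_cusp" by (rule tendsto_eventually)
  then have "c = 0" using lim tendsto_unique at_cusp_neq_bot by blast
  then show False using c[OF z] nz by simp
qed

text \<open>The product of the three translates of \<open>u\<close> over the cosets of the theta group is a level one function.\<close>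

lemma theta_group_zero:
  assumes hol: "u holomorphic_on uhp"
    and T2: "\<And>z. z \<in> uhp \<Longrightarrow> u (z + 2) = u z" and S: "\<And>z. z \<in> uhp \<Longrightarrow> u (- 1 / z) = u z"
    and lim: "(u \<longlongrightarrow> 0) at_cusp" and lim1: "((\<lambda>z. u (1 - 1 / z)) \<longlongrightarrow> l) at_cusp" and z: "z \<in> uhp"
  shows "u z = 0"
proof (rule ccontr)
  assume nz: "u z \<noteq> 0"
  have h1: "(\<lambda>z. u (z + 1)) holomorphic_on uhp"
    by (rule holomorphic_on_compose_gen[OF _ hol, unfolded o_def]) (auto intro!: holomorphic_intros simp: uhp_def)
  have h2: "(\<lambda>z. u (1 - 1 / z)) holomorphic_on uhp"
    by (rule holomorphic_on_compose_gen[OF _ hol, unfolded o_def])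
       (auto intro!: holomorphic_intros uhp_cusp1 dest: uhp_nonzero)
  define U where "U z = u z * (u (z + 1) * u (1 - 1 / z))" for z
  have U0: "U w = 0" if w: "w \<in> uhp" for w
  proof (rule level_one_zero[OF _ _ _ _ w])
    show "U holomorphic_on uhp" unfolding U_def[abs_def] by (intro holomorphic_intros hol h1 h2)
    \<comment> \<open>Two factors tend to 0; from the third, a finite limit at the second cusp is
      enough.\<close>
    have "(U \<longlongrightarrow> 0 * (0 * l)) at_cusp" unfolding U_def[abs_def]
      by (intro tendsto_mult lim lim1 filterlim_compose[OF lim filterlim_add_1_at_cusp])
    then show "(U \<longlongrightarrow> 0) at_cusp" by simp
    fix w assume w: "w \<in> uhp"
    have w1: "w + 1 \<in> uhp" using w by (simp add: uhp_def)
    have nz: "w \<noteq> 0" "w + 1 \<noteq> 0" using uhp_nonzero[OF w] uhp_nonzero[OF w1] by auto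
    \<comment> \<open>The translation swaps the first two factors and must fix the third: -1/z sends
      w/(w+1) to -1 - 1/w, and adding 2 gives 1 - 1/w.\<close>
    have "1 - 1 / (w + 1) = w / (w + 1)" using nz by (simp add: field_simps)
    then have e1: "- 1 / (1 - 1 / (w + 1)) + 2 = 1 - 1 / w" using nz by (simp add: field_simps)
    have "u (1 - 1 / (w + 1)) = u (- 1 / (1 - 1 / (w + 1)) + 2)"
      using S[OF uhp_cusp1[OF w1]] T2[OF uhp_inverse[OF uhp_cusp1[OF w1]]] by simp
    then have "u (1 - 1 / (w + 1)) = u (1 - 1 / w)" unfolding e1 .
    then show "U (w + 1) = U w" using T2[OF w] by (simp add: U_def add.assoc)
    show "U (- 1 / w) = U w"
      using S[OF w] by (simp add: U_def add.commute)
  qed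
  \<comment> \<open>The factors are cancelled one after the other. The last one, evaluated at w =
    -1/(z - 1), is u z itself.\<close>
  have "u (w + 1) * u (1 - 1 / w) = 0" if "w \<in> uhp" for w
    by (rule holomorphic_product_zero[OF hol _ open_uhp connected_uhp _ z nz that])
       (use U0 in \<open>auto simp: U_def intro!: holomorphic_intros h1 h2\<close>)
  moreover have "z - 1 \<in> uhp" using z by (simp add: uhp_def)
  ultimately have "u (1 - 1 / w) = 0" if "w \<in> uhp" for w
    using holomorphic_product_zero[OF h1 h2 open_uhp connected_uhp _ \<open>z - 1 \<in> uhp\<close> _ that] nz by simp
  then have "u (1 - 1 / (- 1 / (z - 1))) = 0" using uhp_inverse[OF \<open>z - 1 \<in> uhp\<close>] by blast
  then show False using nz uhp_nonzero[OF \<open>z - 1 \<in> uhp\<close>] by simp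
qed

text \<open>Taking F as a function on the q-disc encodes both the period 2 and holomorphy at
  infinity. The reduction then only meets a removable singularity at q = 0, where t has a simple
  zero. Each division by t divides the limit l at the second cusp by \<kappa>, which yields the last
  coefficient.\<close>

lemma polynomial_in_hauptmodul:
  fixes \<tau> F :: "complex \<Rightarrow> complex"
  assumes \<tau>: "\<tau> holomorphic_on ball 0 1" "\<And>q. q \<in> ball 0 1 \<Longrightarrow> \<tau> q \<noteq> 0"
    and t: "\<And>z. z \<in> uhp \<Longrightarrow> t z = qexp z * \<tau> (qexp z)"
    and tS: "\<And>z. z \<in> uhp \<Longrightarrow> t (- 1 / z) = t z"
    and t1: "((\<lambda>z. t (1 - 1 / z) * qexp z ^ 2) \<longlongrightarrow> \<kappa>) at_cusp" and \<kappa>: "\<kappa> \<noteq> 0"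
    and F: "F holomorphic_on ball 0 1"
    and FS: "\<And>z. z \<in> uhp \<Longrightarrow> F (qexp (- 1 / z)) = F (qexp z)"
    and F1: "((\<lambda>z. F (qexp (1 - 1 / z)) * qexp z ^ (2 * k)) \<longlongrightarrow> l) at_cusp"
  shows "\<exists>c. (\<forall>z\<in>uhp. F (qexp z) = (\<Sum>i\<le>k. c i * t z ^ i)) \<and> c k * \<kappa> ^ k = l"
  using F FS F1
proof (induction k arbitrary: F l)
  case (0 F l)
  have zero: "F (qexp z) - F 0 = 0" if z: "z \<in> uhp" for z
  proof (rule theta_group_zero[where u = "\<lambda>z. F (qexp z) - F 0", OF _ _ _ _ _ z])
    show "(\<lambda>z. F (qexp z) - F 0) holomorphic_on uhp"
      by (intro holomorphic_intros holomorphic_on_compose_gen[OF _ "0.prems"(1), of qexp, unfolded o_def])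
         (use qexp_in_ball in auto)
    show "((\<lambda>z. F (qexp z) - F 0) \<longlongrightarrow> 0) at_cusp"
    proof (rule LIM_zero)
      have "isCont F 0"
        using holomorphic_on_imp_continuous_on[OF "0.prems"(1)] by (simp add: continuous_on_eq_continuous_at)
      then show "((\<lambda>z. F (qexp z)) \<longlongrightarrow> F 0) at_cusp"
        by (rule isCont_tendsto_compose[OF _ filterlim_qexp_at_cusp])
    qed
    show "((\<lambda>z. F (qexp (1 - 1 / z)) - F 0) \<longlongrightarrow> l - F 0) at_cusp"
      using tendsto_diff[OF "0.prems"(3) tendsto_const[of "F 0"]] by (simp only: mult_0_right power_0 mult_1_right)
    show "F (qexp (z + 2)) - F 0 = F (qexp z) - F 0" for z by (simp only: qexp_add_2)
    show "F (qexp (- 1 / z)) - F 0 = F (qexp z) - F 0" if "z \<in> uhp" for z using "0.prems"(2)[OF that] by simp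
  qed
  have "eventually (\<lambda>z. F (qexp (1 - 1 / z)) * qexp z ^ (2 * 0) = F 0) at_cusp"
    using eventually_uhp_at_cusp by eventually_elim (use zero uhp_cusp1 in simp)
  from tendsto_unique[OF at_cusp_neq_bot "0.prems"(3) tendsto_eventually[OF this]] have "l = F 0" .
  then show ?case using zero by (intro exI[of _ "\<lambda>_. F 0"]) simp
next
  case (Suc k F l)
  \<comment> \<open>The derivative at 0 fills the removable singularity of the difference
    quotient.\<close>
  define H where "H q = (if q = 0 then deriv F 0 else (F q - F 0) / (q - 0)) / \<tau> q" for q
  have t0: "t z \<noteq> 0" if "z \<in> uhp" for z
    using t[OF that] \<tau>(2)[OF qexp_in_ball[OF that]] qexp_nonzero by simp
  have Hq: "H (qexp z) = (F (qexp z) - F 0) / t z" if "z \<in> uhp" for z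
    using qexp_nonzero t[OF that] by (simp add: H_def)
  have "\<exists>c. (\<forall>z\<in>uhp. H (qexp z) = (\<Sum>i\<le>k. c i * t z ^ i)) \<and> c k * \<kappa> ^ k = l / \<kappa>"
  proof (rule Suc.IH)
    show "H holomorphic_on ball 0 1" unfolding H_def[abs_def]
      by (intro holomorphic_on_divide pole_lemma_open[OF Suc.prems(1)] \<tau>) auto
    show "H (qexp (- 1 / z)) = H (qexp z)" if "z \<in> uhp" for z
      using Hq that uhp_inverse[OF that] tS Suc.prems(2) by simp
    \<comment> \<open>The subtracted constant is damped by a positive power of
      \<open>qexp z\<close>, so it leaves the limit l unchanged.\<close>
    have "((\<lambda>z. (F (qexp (1 - 1 / z)) * qexp z ^ (2 * Suc k) - F 0 * qexp z ^ (2 * Suc k)) /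
        (t (1 - 1 / z) * qexp z ^ 2)) \<longlongrightarrow> (l - F 0 * 0 ^ (2 * Suc k)) / \<kappa>) at_cusp"
      by (intro tendsto_intros Suc.prems(3) t1 \<kappa> filterlim_qexp_at_cusp)
    then have *: "((\<lambda>z. (F (qexp (1 - 1 / z)) * qexp z ^ (2 * Suc k) - F 0 * qexp z ^ (2 * Suc k)) /
        (t (1 - 1 / z) * qexp z ^ 2)) \<longlongrightarrow> l / \<kappa>) at_cusp" by simp
    show "((\<lambda>z. H (qexp (1 - 1 / z)) * qexp z ^ (2 * k)) \<longlongrightarrow> l / \<kappa>) at_cusp"
    proof (rule Lim_transform_eventually[OF *])
      show "\<forall>\<^sub>F z in at_cusp. (F (qexp (1 - 1 / z)) * qexp z ^ (2 * Suc k) - F 0 * qexp z ^ (2 * Suc k)) /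
        (t (1 - 1 / z) * qexp z ^ 2) = H (qexp (1 - 1 / z)) * qexp z ^ (2 * k)"
        using eventually_uhp_at_cusp
      proof eventually_elim
        case (elim z)
        have "qexp z ^ (2 * Suc k) = qexp z ^ (2 * k) * qexp z ^ 2" by (simp add: power_add[symmetric])
        then have "F (qexp (1 - 1 / z)) * qexp z ^ (2 * Suc k) - F 0 * qexp z ^ (2 * Suc k) =
            ((F (qexp (1 - 1 / z)) - F 0) * qexp z ^ (2 * k)) * qexp z ^ 2"
          by (simp only: left_diff_distrib mult.assoc)
        moreover have "(((F (qexp (1 - 1 / z)) - F 0) * qexp z ^ (2 * k)) * qexp z ^ 2) / (t (1 - 1 / z) * qexp z ^ 2)
            = (F (qexp (1 - 1 / z)) - F 0) * qexp z ^ (2 * k) / t (1 - 1 / z)"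
          using qexp_nonzero[of z] by (intro mult_divide_mult_cancel_right) simp
        ultimately show ?case unfolding Hq[OF uhp_cusp1[OF elim]] by simp
      qed
    qed
  qed
  then obtain c where c: "\<And>z. z \<in> uhp \<Longrightarrow> H (qexp z) = (\<Sum>i\<le>k. c i * t z ^ i)" "c k * \<kappa> ^ k = l / \<kappa>" by blast
  define c' where "c' i = (case i of 0 \<Rightarrow> F 0 | Suc j \<Rightarrow> c j)" for i
  have "F (qexp z) = (\<Sum>i\<le>Suc k. c' i * t z ^ i)" if "z \<in> uhp" for z
  proof -
    have "F (qexp z) = F 0 + t z * (\<Sum>i\<le>k. c i * t z ^ i)"
      using Hq[OF that] c(1)[OF that] t0[OF that] by (simp add: field_simps)
    also have "\<dots> = (\<Sum>i\<le>Suc k. c' i * t z ^ i)"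
      unfolding sum.atMost_Suc_shift by (simp add: c'_def sum_distrib_left mult_ac)
    finally show ?thesis .
  qed
  moreover have "c' (Suc k) * \<kappa> ^ Suc k = l" using c(2) \<kappa> by (simp add: c'_def field_simps)
  ultimately show ?case by blast
qed

section \<open>Expansions of theta functions at infinity\<close>

text \<open>The sum of q^(e i) over I, collected by powers. An infinite fibre would be counted as 0
  by \<open>card\<close>; \<open>fibre_finite\<close> excludes it whenever the series
  converges.\<close>

definition fibre_fps :: "('i \<Rightarrow> nat) \<Rightarrow> 'i set \<Rightarrow> complex fps" where
  "fibre_fps e I = Abs_fps (\<lambda>j. of_nat (card {i \<in> I. e i = j}))"

lemma fibre_fps_nth: "fps_nth (fibre_fps e I) j = of_nat (card {i \<in> I. e i = j})"
  by (simp add: fibre_fps_def)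

lemma fibre_finite:
  assumes "(\<lambda>i. (1 / 2 :: real) ^ e i) summable_on I"
  shows "finite {i \<in> I. e i = j}"
proof (rule ccontr)
  assume inf: "infinite {i \<in> I. e i = j}"
  have "(\<lambda>i. (1 / 2 :: real) ^ e i) summable_on {i \<in> I. e i = j}"
    using assms by (rule summable_on_subset_banach) auto
  then have "(\<lambda>i. (1 / 2 :: real) ^ j) summable_on {i \<in> I. e i = j}"
    by (subst (asm) summable_on_cong[where g = "\<lambda>_. (1 / 2) ^ j"]) auto
  then show False using infsum_diverge_constant[OF inf, of "(1 / 2 :: real) ^ j"] by simp
qed

lemma fibre_sums:
  fixes q :: complex
  assumes summ: "\<And>r::real. 0 \<le> r \<Longrightarrow> r < 1 \<Longrightarrow> (\<lambda>i. r ^ e i) summable_on I" and q: "norm q < 1"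
  shows "(\<lambda>j. fps_nth (fibre_fps e I) j * q ^ j) sums (\<Sum>\<^sub>\<infinity>i\<in>I. q ^ e i)"
proof -
  define B where "B j = {i \<in> I. e i = j}" for j
  have bij: "bij_betw snd (Sigma UNIV B) I"
    by (rule bij_betwI[where g = "\<lambda>i. (e i, i)"]) (auto simp: B_def)
  have "(\<lambda>i. q ^ e i) summable_on I"
    by (rule abs_summable_summable) (use summ[of "norm q"] q in \<open>simp add: norm_power\<close>)
  then have "(\<lambda>p. q ^ e (snd p)) summable_on Sigma UNIV B"
    using summable_on_reindex_bij_betw[OF bij, of "\<lambda>i. q ^ e i"] by simp
  then have s: "(\<lambda>(j, i). q ^ e i) summable_on Sigma UNIV B" by (simp add: case_prod_unfold)
  have "(\<Sum>\<^sub>\<infinity>i\<in>B j. q ^ e i) = fps_nth (fibre_fps e I) j * q ^ j" for j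
  proof -
    have "(\<Sum>\<^sub>\<infinity>i\<in>B j. q ^ e i) = (\<Sum>\<^sub>\<infinity>i\<in>B j. q ^ j)" by (rule infsum_cong) (auto simp: B_def)
    also have "\<dots> = of_nat (card (B j)) * q ^ j"
      using fibre_finite[of e I j] summ[of "1 / 2"] by (simp add: B_def)
    finally show ?thesis by (simp add: fibre_fps_nth B_def)
  qed
  then have "((\<lambda>j. fps_nth (fibre_fps e I) j * q ^ j) has_sum (\<Sum>\<^sub>\<infinity>p\<in>Sigma UNIV B. case p of (j, i) \<Rightarrow> q ^ e i)) UNIV"
    using has_sum_infsum[OF summable_on_Sigma_banach[OF s]] infsum_Sigma'_banach[OF s] by simp
  moreover have "(\<Sum>\<^sub>\<infinity>p\<in>Sigma UNIV B. case p of (j, i) \<Rightarrow> q ^ e i) = (\<Sum>\<^sub>\<infinity>i\<in>I. q ^ e i)"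
    using infsum_reindex_bij_betw[OF bij, of "\<lambda>i. q ^ e i"] by (simp add: case_prod_unfold)
  ultimately show ?thesis using has_sum_imp_sums by fastforce
qed

lemma fps_conv_radius_fibre:
  assumes "\<And>r::real. 0 \<le> r \<Longrightarrow> r < 1 \<Longrightarrow> (\<lambda>i. r ^ e i) summable_on I"
  shows "fps_conv_radius (fibre_fps e I) \<ge> 1"
  unfolding fps_conv_radius_def
proof (rule conv_radius_geI_ex')
  fix r :: real assume "0 < r" "ereal r < 1"
  then show "summable (\<lambda>n. fps_nth (fibre_fps e I) n * of_real r ^ n)"
    using fibre_sums[of e I "of_real r"] assms by (auto simp: sums_iff)
qed

lemma eval_fibre_fps:
  assumes "\<And>r::real. 0 \<le> r \<Longrightarrow> r < 1 \<Longrightarrow> (\<lambda>i. r ^ e i) summable_on I" and "norm q < 1"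
  shows "eval_fps (fibre_fps e I) q = (\<Sum>\<^sub>\<infinity>i\<in>I. q ^ e i)"
  using fibre_sums[of e I q] assms by (simp add: eval_fps_def sums_iff)

lemma norm_less_conv_radius:
  "fps_conv_radius f \<ge> 1 \<Longrightarrow> norm q < 1 \<Longrightarrow> ereal (norm q) < fps_conv_radius f"
  by (rule less_le_trans[of _ 1]) auto

lemma holomorphic_eval_fps_ball:
  "fps_conv_radius f \<ge> 1 \<Longrightarrow> eval_fps f holomorphic_on ball (0::complex) 1"
  by (rule holomorphic_on_eval_fps) (auto simp: in_eball_iff norm_less_conv_radius)

lemma holomorphic_eval_fps_qexp:
  "fps_conv_radius f \<ge> 1 \<Longrightarrow> (\<lambda>z. eval_fps f (qexp z)) holomorphic_on uhp"
  by (rule holomorphic_on_compose_gen[OF holomorphic_qexp holomorphic_eval_fps_ball, unfolded o_def])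
     (use qexp_in_ball in auto)

lemma eval_fps_at_cusp:
  assumes "fps_conv_radius f \<ge> 1"
  shows "((\<lambda>z. eval_fps f (qexp z)) \<longlongrightarrow> fps_nth f 0) at_cusp"
proof -
  have "isCont (eval_fps f) 0"
    using norm_less_conv_radius[OF assms, of 0] by (intro continuous_eval_fps) simp
  from isCont_tendsto_compose[OF this filterlim_qexp_at_cusp] show ?thesis by (simp add: eval_fps_at_0)
qed

text \<open>The tail is bounded by 2|q|/(1 - |q|), which is below 1 for |q| < 1/3 and cannot cancel
  the constant term.\<close>

lemma eval_fps_nonzero:
  fixes q :: complex
  assumes f0: "fps_nth f 0 = 1" and f: "\<And>j. norm (fps_nth f j) \<le> 2" and q: "norm q < 1 / 3"
    and conv: "fps_conv_radius f \<ge> 1"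
  shows "eval_fps f q \<noteq> 0"
proof
  assume 0: "eval_fps f q = 0"
  have "summable (\<lambda>j. fps_nth f j * q ^ j)"
    using q by (intro summable_fps norm_less_conv_radius conv) simp
  then have "(\<Sum>j. fps_nth f (Suc j) * q ^ Suc j) = - 1"
    using suminf_split_head[of "\<lambda>j. fps_nth f j * q ^ j"] 0 f0 by (simp add: eval_fps_def)
  moreover have "norm (\<Sum>j. fps_nth f (Suc j) * q ^ Suc j) \<le> (\<Sum>j. 2 * norm q * norm q ^ j)"
  proof (rule norm_suminf_le)
    show "norm (fps_nth f (Suc j) * q ^ Suc j) \<le> 2 * norm q * norm q ^ j" for j
      using mult_right_mono[OF f[of "Suc j"], of "norm (q ^ Suc j)"] by (simp add: norm_mult norm_power)
    show "summable (\<lambda>j. 2 * norm q * norm q ^ j)" using q by (intro summable_mult summable_geometric) auto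
  qed
  moreover have "(\<Sum>j. 2 * norm q * norm q ^ j) = 2 * norm q * (1 / (1 - norm q))"
    using q by (subst suminf_mult) (auto intro!: summable_geometric simp: suminf_geometric)
  moreover have "2 * norm q * (1 / (1 - norm q)) < 1" using q by (simp add: field_simps)
  ultimately show False by simp
qed

section \<open>Power series of the theta functions\<close>

definition theta3_fps :: "complex fps" where "theta3_fps = fibre_fps (\<lambda>m::int. nat (m\<^sup>2)) UNIV"

definition theta4_fps :: "complex fps" where "theta4_fps = Abs_fps (\<lambda>j. (- 1) ^ j * fps_nth theta3_fps j)"

text \<open>Since (m + 1/2)^2 = m(m+1) + 1/4, and m and -1 - m give the same exponent, theta2 is 2
  q^(1/4) times this series. Splitting off the fractional power leaves a genuine power series in
  q.\<close>

definition psi_fps :: "complex fps" where "psi_fps = fibre_fps (\<lambda>m::nat. m * (m + 1)) UNIV"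

lemma summable_squares:
  assumes "0 \<le> (r::real)" "r < 1"
  shows "(\<lambda>m::int. r ^ nat (m\<^sup>2)) summable_on UNIV"
proof (rule summable_on_comparison_test[OF summable_on_int_geometric[OF assms]])
  fix m :: int
  have "\<bar>m\<bar> * 1 \<le> \<bar>m\<bar> * \<bar>m\<bar>" by (cases "m = 0") (simp, rule mult_left_mono, auto)
  then have "nat \<bar>m\<bar> \<le> nat (m\<^sup>2)" by (simp add: power2_eq_square)
  then show "r ^ nat (m\<^sup>2) \<le> r ^ nat \<bar>m\<bar>" using assms by (intro power_decreasing) auto
qed (use assms in auto)

lemma summable_pronic:
  assumes "0 \<le> (r::real)" "r < 1"
  shows "(\<lambda>m::nat. r ^ (m * (m + 1))) summable_on UNIV"
proof (rule summable_on_comparison_test)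
  show "(\<lambda>n::nat. r ^ n) summable_on UNIV"
    using assms by (intro summable_nonneg_imp_summable_on) auto
  show "r ^ (m * (m + 1)) \<le> r ^ m" for m :: nat using assms by (intro power_decreasing) auto
qed (use assms in auto)

lemma theta3_fps_conv: "fps_conv_radius theta3_fps \<ge> 1"
  unfolding theta3_fps_def by (rule fps_conv_radius_fibre[OF summable_squares])

lemma psi_fps_conv: "fps_conv_radius psi_fps \<ge> 1"
  unfolding psi_fps_def by (rule fps_conv_radius_fibre[OF summable_pronic])

lemma theta4_fps_conv: "fps_conv_radius theta4_fps \<ge> 1"
  unfolding fps_conv_radius_def
proof (rule conv_radius_geI_ex')
  fix r :: real assume "0 < r" "ereal r < 1"
  then have "summable (\<lambda>j. fps_nth theta3_fps j * (- of_real r) ^ j)"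
    by (intro summable_fps norm_less_conv_radius theta3_fps_conv) simp
  then show "summable (\<lambda>j. fps_nth theta4_fps j * of_real r ^ j)"
    by (simp add: theta4_fps_def power_minus[of "of_real r"] mult_ac)
qed

lemma eval_T4: "eval_fps theta4_fps q = eval_fps theta3_fps (- q)"
  by (simp add: eval_fps_def theta4_fps_def power_minus[of q] mult_ac)

lemma qexp_power: "qexp z ^ k = exp (\<i> * of_real pi * z * of_nat k)"
  unfolding qexp_def exp_of_nat_mult[symmetric] by (simp add: mult_ac)

lemma qexp_power_square: "qexp z ^ nat (m\<^sup>2) = exp (\<i> * of_real pi * z * (of_int m)\<^sup>2)"
proof -
  have "of_nat (nat (m\<^sup>2)) = (of_int (m\<^sup>2) :: complex)" by (simp only: of_nat_nat zero_le_power2)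
  then show ?thesis unfolding qexp_power by simp
qed

lemma theta3_eval: "z \<in> uhp \<Longrightarrow> theta3 z = eval_fps theta3_fps (qexp z)"
  using qexp_in_ball[of z] unfolding theta3_fps_def
  by (subst eval_fibre_fps[OF summable_squares]) (auto simp: theta3_def qexp_power_square)

lemma theta4_eval: "z \<in> uhp \<Longrightarrow> theta4 z = eval_fps theta4_fps (qexp z)"
  using qexp_in_ball[of z] unfolding theta3_fps_def eval_T4
  by (subst eval_fibre_fps[OF summable_squares])
     (auto simp: theta4_def qexp_power_square power_minus[of "qexp z"])

lemma theta2_eval:
  assumes z: "z \<in> uhp"
  shows "theta2 z = 2 * qexp (z / 4) * eval_fps psi_fps (qexp z)"
proof -
  define f where "f m = exp (\<i> * of_real pi * z * (of_int m + 1 / 2)\<^sup>2)" for m :: int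
  have f1: "f (int k) = qexp (z / 4) * qexp z ^ (k * (k + 1))" for k
    unfolding qexp_power unfolding qexp_def f_def exp_add[symmetric]
    by (rule arg_cong[of _ _ exp]) (simp add: power2_eq_square field_simps)
  have f2: "f (- 1 - int k) = f (int k)" for k
    unfolding f_def by (rule arg_cong[of _ _ exp]) (simp add: power2_eq_square field_simps)
  have psi_fps: "eval_fps psi_fps (qexp z) = (\<Sum>\<^sub>\<infinity>k. qexp z ^ (k * (k + 1)))"
    unfolding psi_fps_def using qexp_in_ball[OF z] by (intro eval_fibre_fps summable_pronic) auto
  have "(\<lambda>k. qexp z ^ (k * (k + 1))) summable_on UNIV"
    by (rule abs_summable_summable) (use summable_pronic[of "norm (qexp z)"] qexp_in_ball[OF z] in \<open>simp add: norm_power\<close>)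
  then have hs: "((\<lambda>k. f (int k)) has_sum qexp (z / 4) * eval_fps psi_fps (qexp z)) UNIV"
    unfolding f1 psi_fps by (intro has_sum_cmult_right has_sum_infsum)
  have "(f has_sum qexp (z / 4) * eval_fps psi_fps (qexp z)) (range int)"
    using hs by (subst has_sum_reindex) (auto simp: o_def)
  moreover have "(f has_sum qexp (z / 4) * eval_fps psi_fps (qexp z)) (range (\<lambda>k. - 1 - int k))"
    using hs by (subst has_sum_reindex) (auto simp: o_def inj_on_def f2)
  ultimately have "(f has_sum (qexp (z / 4) * eval_fps psi_fps (qexp z) + qexp (z / 4) * eval_fps psi_fps (qexp z)))
      (range int \<union> range (\<lambda>k. - 1 - int k))"
    by (rule has_sum_Un_disjoint) auto
  moreover have "range int \<union> range (\<lambda>k. - 1 - int k) = UNIV"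
  proof safe
    fix m :: int assume "m \<notin> range (\<lambda>k. - 1 - int k)"
    moreover have "m = - 1 - int (nat (- 1 - m))" if "m < 0" using that by simp
    ultimately have "m \<ge> 0" by (metis not_le rangeI)
    then show "m \<in> range int" by (metis nat_0_le rangeI)
  qed auto
  ultimately have "(f has_sum 2 * qexp (z / 4) * eval_fps psi_fps (qexp z)) UNIV" by (simp add: mult_ac)
  then show ?thesis unfolding theta2_def f_def[symmetric] by (rule infsumI)
qed

lemma theta3_add_1: "z \<in> uhp \<Longrightarrow> theta3 (z + 1) = theta4 z"
  using uhp_add_real[of z 1] by (simp add: theta3_eval theta4_eval qexp_add_1 eval_T4)

lemma theta4_add_1: "z \<in> uhp \<Longrightarrow> theta4 (z + 1) = theta3 z"
  using uhp_add_real[of z 1] by (simp add: theta3_eval theta4_eval qexp_add_1 eval_T4)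

text \<open>(m + 1/2)^2 is 1/4 plus an even integer, so all terms acquire the same eighth root of
  unity.\<close>

lemma theta2_add_1:
  assumes "z \<in> uhp"
  shows "theta2 (z + 1) = exp (\<i> * of_real pi / 4) * theta2 z"
  unfolding theta2_def infsum_cmult_right'[symmetric]
proof (rule infsum_cong)
  fix m :: int
  have "even (m * (m + 1))" by simp
  then obtain k where k: "m * (m + 1) = 2 * k" by (elim evenE)
  have "(of_int m + 1 / 2 :: complex)\<^sup>2 = of_int (m * (m + 1)) + 1 / 4"
    by (simp add: power2_eq_square field_simps)
  then have sq: "(of_int m + 1 / 2 :: complex)\<^sup>2 = 2 * of_int k + 1 / 4" unfolding k by simp
  have "\<i> * of_real pi * (z + 1) * (of_int m + 1 / 2)\<^sup>2 =
      \<i> * of_real pi / 4 + \<i> * of_real pi * z * (of_int m + 1 / 2)\<^sup>2 + 2 * of_real pi * of_int k * \<i>"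
    unfolding sq by (simp add: algebra_simps)
  moreover have "exp (2 * of_real pi * of_int k * \<i>) = 1"
    using exp_integer_2pi[of "of_int k"] by (simp add: mult_ac)
  ultimately show "exp (\<i> * of_real pi * (z + 1) * (of_int m + 1 / 2)\<^sup>2) =
      exp (\<i> * of_real pi / 4) * exp (\<i> * of_real pi * z * (of_int m + 1 / 2)\<^sup>2)"
    by (simp only: exp_add mult_1_right)
qed

lemma theta3_holomorphic: "theta3 holomorphic_on uhp"
  by (rule holomorphic_transform[OF holomorphic_eval_fps_qexp[OF theta3_fps_conv]]) (simp add: theta3_eval)

lemma theta4_holomorphic: "theta4 holomorphic_on uhp"
  by (rule holomorphic_transform[OF holomorphic_eval_fps_qexp[OF theta4_fps_conv]]) (simp add: theta4_eval)

lemma theta2_holomorphic: "theta2 holomorphic_on uhp"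
proof -
  have "(\<lambda>z. eval_fps psi_fps (qexp z)) holomorphic_on uhp"
    by (rule holomorphic_eval_fps_qexp[OF psi_fps_conv])
  moreover have "(\<lambda>z. qexp (z / 4)) holomorphic_on uhp"
    unfolding qexp_def by (intro holomorphic_intros) auto
  ultimately have "(\<lambda>z. 2 * qexp (z / 4) * eval_fps psi_fps (qexp z)) holomorphic_on uhp"
    by (intro holomorphic_intros)
  then show ?thesis by (rule holomorphic_transform) (simp add: theta2_eval)
qed

lemma theta3_fps_0: "fps_nth theta3_fps 0 = 1"
proof -
  have "{m::int. nat (m\<^sup>2) = 0} = {0}" by auto
  then show ?thesis by (simp add: theta3_fps_def fibre_fps_nth)
qed

lemma theta3_fps_1: "fps_nth theta3_fps 1 = 2"
proof -
  have "m = 1 \<or> m = - 1" if "nat (m\<^sup>2) = 1" for m :: int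
  proof -
    have "m\<^sup>2 = 1" using that by linarith
    then show ?thesis by (simp add: power2_eq_1_iff)
  qed
  then have "{m::int. nat (m\<^sup>2) = 1} = {1, - 1}" by auto
  then show ?thesis by (simp add: theta3_fps_def fibre_fps_nth)
qed

lemma theta3_fps_2: "fps_nth theta3_fps 2 = 0"
proof -
  have "nat (m\<^sup>2) \<noteq> 2" for m :: int
  proof
    assume "nat (m\<^sup>2) = 2"
    then have "m\<^sup>2 = 2" by linarith
    then have "\<bar>m\<bar> * \<bar>m\<bar> = 2" by (simp add: power2_eq_square)
    moreover have "\<bar>m\<bar> \<le> 1 \<or> \<bar>m\<bar> \<ge> 2" by linarith
    moreover have "\<bar>m\<bar> \<ge> 2 \<Longrightarrow> \<bar>m\<bar> * \<bar>m\<bar> \<ge> 2 * 2" by (intro mult_mono) auto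
    moreover have "\<bar>m\<bar> \<le> 1 \<Longrightarrow> \<bar>m\<bar> * \<bar>m\<bar> \<le> 1 * 1" by (intro mult_mono) auto
    ultimately show False by linarith
  qed
  then show ?thesis by (simp add: theta3_fps_def fibre_fps_nth)
qed

lemma theta3_fps_le: "norm (fps_nth theta3_fps j) \<le> 2"
proof (cases "{m::int. nat (m\<^sup>2) = j} = {}")
  case True
  then show ?thesis by (simp add: theta3_fps_def fibre_fps_nth)
next
  case False
  then obtain m :: int where m: "nat (m\<^sup>2) = j" by blast
  have "{m'::int. nat (m'\<^sup>2) = j} \<subseteq> {m, - m}"
  proof
    fix m' :: int assume "m' \<in> {m'. nat (m'\<^sup>2) = j}"
    then have "m'\<^sup>2 = m\<^sup>2" using m eq_nat_nat_iff[of "m'\<^sup>2" "m\<^sup>2"] by simp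
    then show "m' \<in> {m, - m}" by (simp add: power2_eq_iff)
  qed
  then have "card {m'::int. nat (m'\<^sup>2) = j} \<le> card {m, - m}" by (intro card_mono) auto
  also have "\<dots> \<le> 2" by (simp add: card_insert_if)
  finally show ?thesis by (simp add: theta3_fps_def fibre_fps_nth)
qed

lemma psi_fps_inj: "card {m::nat. m * (m + 1) = j} \<le> 1"
proof -
  have "m = m'" if "m * (m + 1) = j" "m' * (m' + 1) = j" for m m' :: nat
  proof (rule ccontr)
    assume "m \<noteq> m'"
    then consider "m < m'" | "m' < m" by linarith
    then show False
    proof cases
      case 1
      then have "m * (m + 1) < m' * (m' + 1)" by (intro mult_less_le_imp_less) auto
      then show ?thesis using that by simp
    next
      case 2
      then have "m' * (m' + 1) < m * (m + 1)" by (intro mult_less_le_imp_less) auto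
      then show ?thesis using that by simp
    qed
  qed
  then have "finite {m::nat. m * (m + 1) = j} \<Longrightarrow> ?thesis"
    unfolding One_nat_def by (subst card_le_Suc0_iff_eq) blast+
  then show ?thesis by (cases "finite {m::nat. m * (m + 1) = j}") auto
qed

lemma psi_fps_0: "fps_nth psi_fps 0 = 1"
proof -
  have "{m::nat. m * (m + 1) = 0} = {0}" by auto
  then show ?thesis by (simp add: psi_fps_def fibre_fps_nth)
qed

lemma psi_fps_1: "fps_nth psi_fps 1 = 0"
proof -
  have "m * (m + 1) \<noteq> 1" for m :: nat by (cases m) auto
  then have "{m::nat. m * (m + 1) = 1} = {}" by blast
  then show ?thesis by (simp add: psi_fps_def fibre_fps_nth)
qed

lemma theta4_fps_0: "fps_nth theta4_fps 0 = 1" and theta4_fps_1: "fps_nth theta4_fps 1 = - 2"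
  using theta3_fps_0 theta3_fps_1 by (simp_all add: theta4_fps_def)

text \<open>Here pi Im z > 3/2, and the quadratic Taylor polynomial of exp already exceeds 3 at 3/2.
  The bounds 1/2 and 1/3 are those of \<open>modular_reduction\<close> and
  \<open>eval_fps_nonzero\<close>.\<close>

lemma qexp_small:
  assumes "Im z \<ge> 1 / 2"
  shows "norm (qexp z) < 1 / 3"
proof -
  have "3 < 1 + (3 / 2) + (3 / 2)\<^sup>2 / (2::real)" by (simp add: power2_eq_square)
  also have "\<dots> \<le> exp (3 / 2)" by (rule exp_lower_Taylor_quadratic) simp
  also have "\<dots> \<le> exp (pi * Im z)"
  proof -
    have "3 * (1 / 2) \<le> pi * Im z" using pi_gt3 assms by (intro mult_mono) auto
    then show ?thesis by simp
  qed
  finally have "inverse (exp (pi * Im z)) < inverse 3" by (intro less_imp_inverse_less) auto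
  then show ?thesis by (simp add: norm_qexp exp_minus inverse_eq_divide)
qed

lemma theta_nonzero_small:
  assumes "Im z \<ge> 1 / 2"
  shows "theta2 z \<noteq> 0" "theta3 z \<noteq> 0" "theta4 z \<noteq> 0"
proof -
  have z: "z \<in> uhp" using assms by (simp add: uhp_def)
  have "norm (fps_nth psi_fps j) \<le> 2" for j
    using psi_fps_inj[of j] by (simp add: psi_fps_def fibre_fps_nth)
  then show "theta2 z \<noteq> 0"
    using eval_fps_nonzero[OF psi_fps_0 _ qexp_small[OF assms] psi_fps_conv] qexp_nonzero by (simp add: theta2_eval[OF z])
  show "theta3 z \<noteq> 0"
    using eval_fps_nonzero[OF theta3_fps_0 theta3_fps_le qexp_small[OF assms] theta3_fps_conv] by (simp add: theta3_eval[OF z])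
  have "norm (fps_nth theta4_fps j) \<le> 2" for j using theta3_fps_le[of j] by (simp add: theta4_fps_def norm_mult norm_power)
  then show "theta4 z \<noteq> 0"
    using eval_fps_nonzero[OF theta4_fps_0 _ qexp_small[OF assms] theta4_fps_conv] by (simp add: theta4_eval[OF z])
qed

text \<open>The signs of \<open>theta4\<close> are written as values of \<open>cis\<close>, as they
  appear on the dual side of \<open>gauss_poisson\<close> at x = 1/2.\<close>

lemma theta_imaginary:
  assumes t: "t > 0"
  shows "theta3 (\<i> * of_real t) = of_real (\<Sum>\<^sub>\<infinity>m::int. exp (- pi * t * (of_int m)\<^sup>2))"
    and "theta2 (\<i> * of_real t) = of_real (\<Sum>\<^sub>\<infinity>m::int. exp (- pi * t * (of_int m + 1 / 2)\<^sup>2))"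
    and "theta4 (\<i> * of_real t) = (\<Sum>\<^sub>\<infinity>m::int. of_real (exp (- pi * t * (of_int m)\<^sup>2)) * cis (2 * pi * of_int m * (1 / 2)))"
proof -
  have e: "exp (\<i> * of_real pi * (\<i> * of_real t) * of_real x) = complex_of_real (exp (- pi * t * x))" for x
  proof -
    have "\<i> * of_real pi * (\<i> * of_real t) * of_real x = complex_of_real (- pi * t * x)"
      by (simp add: complex_eq_iff)
    then show ?thesis by (simp only: exp_of_real)
  qed
  have e1: "exp (\<i> * of_real pi * (\<i> * of_real t) * (of_int m)\<^sup>2) = complex_of_real (exp (- pi * t * (of_int m)\<^sup>2))" for m
    using e[of "(of_int m)\<^sup>2"] by simp
  have e2: "exp (\<i> * of_real pi * (\<i> * of_real t) * (of_int m + 1 / 2)\<^sup>2) = complex_of_real (exp (- pi * t * (of_int m + 1 / 2)\<^sup>2))" for m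
    using e[of "(of_int m + 1 / 2)\<^sup>2"] by simp
  show "theta3 (\<i> * of_real t) = of_real (\<Sum>\<^sub>\<infinity>m::int. exp (- pi * t * (of_int m)\<^sup>2))"
    unfolding theta3_def e1 using gauss_summable_on_int[OF t, of 0] by (intro infsum_complex_of_real) simp
  show "theta2 (\<i> * of_real t) = of_real (\<Sum>\<^sub>\<infinity>m::int. exp (- pi * t * (of_int m + 1 / 2)\<^sup>2))"
    unfolding theta2_def e2 using gauss_summable_on_int[OF t, of "1 / 2"] by (intro infsum_complex_of_real)
  show "theta4 (\<i> * of_real t) = (\<Sum>\<^sub>\<infinity>m::int. of_real (exp (- pi * t * (of_int m)\<^sup>2)) * cis (2 * pi * of_int m * (1 / 2)))"
    unfolding theta4_def e1
  proof (rule infsum_cong)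
    fix m :: int
    have "even (nat (m\<^sup>2)) \<longleftrightarrow> even m" by (simp add: even_nat_iff)
    moreover have "cis (2 * pi * of_int m * (1 / 2)) = (if even m then 1 else - 1)"
    proof (cases "even m")
      case True
      then obtain k where "m = 2 * k" by (elim evenE)
      then have "2 * pi * of_int m * (1 / 2) = 2 * pi * of_int k" by simp
      then show ?thesis using True by (simp only: cis_multiple_2pi[OF Ints_of_int] if_True)
    next
      case False
      then obtain k where "m = 2 * k + 1" by (elim oddE)
      then have "2 * pi * of_int m * (1 / 2) = 2 * pi * of_int k + pi" by (simp add: algebra_simps)
      then show ?thesis using False by (simp only: cis_mult[symmetric] cis_multiple_2pi[OF Ints_of_int] cis_pi) simp
    qed
    ultimately show "(- 1) ^ nat (m\<^sup>2) * complex_of_real (exp (- pi * t * (of_int m)\<^sup>2)) =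
      of_real (exp (- pi * t * (of_int m)\<^sup>2)) * cis (2 * pi * of_int m * (1 / 2))"
      by (simp add: uminus_power_if)
  qed
qed

lemma theta3_inversion_imaginary:
  assumes "t > 0"
  shows "theta3 (\<i> * of_real t) = of_real (1 / sqrt t) * theta3 (\<i> * of_real (1 / t))"
proof -
  have "theta3 (\<i> * of_real (1 / t)) = (\<Sum>\<^sub>\<infinity>k::int. of_real (exp (- pi * (of_int k)\<^sup>2 / t)) * cis (2 * pi * of_int k * 0))"
    using theta_imaginary(1)[of "1 / t"] assms gauss_summable_on_int[of "1 / t" 0]
    by (simp add: infsum_complex_of_real)
  then show ?thesis using gauss_poisson[OF assms, of 0] theta_imaginary(1)[OF assms] by simp
qed

text \<open>Poisson summation exchanges the shift by 1/2 with alternating signs, hence theta2 with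
  theta4.\<close>

lemma theta2_inversion_imaginary:
  assumes "t > 0"
  shows "theta2 (\<i> * of_real t) = of_real (1 / sqrt t) * theta4 (\<i> * of_real (1 / t))"
  using gauss_poisson[OF assms, of "1 / 2"] theta_imaginary(2)[OF assms] theta_imaginary(3)[of "1 / t"] assms by simp

section \<open>Modular behaviour of the theta functions\<close>

lemma neg_inverse_imaginary: "- 1 / (\<i> * of_real t) = \<i> * of_real (1 / t)"
  by (simp add: divide_inverse)

lemma holomorphic_uhp_inverse:
  assumes "f holomorphic_on uhp"
  shows "(\<lambda>z. f (- 1 / z)) holomorphic_on uhp"
proof (rule holomorphic_on_compose_gen[OF _ assms, unfolded o_def])
  show "(\<lambda>z. - 1 / z) holomorphic_on uhp" by (intro holomorphic_intros) (auto dest: uhp_nonzero)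
  show "(\<lambda>z. - 1 / z) ` uhp \<subseteq> uhp" using uhp_inverse by blast
qed

text \<open>Squaring replaces the root of -iz by -iz itself, so no branch has to be chosen; the
  quotient \<open>haupt\<close> contains only even powers.\<close>

lemma theta3_inversion:
  assumes z: "z \<in> uhp"
  shows "theta3 (- 1 / z) ^ 2 = - \<i> * z * theta3 z ^ 2"
proof (rule uhp_identity[OF _ _ _ z])
  show "(\<lambda>z. theta3 (- 1 / z) ^ 2) holomorphic_on uhp"
    by (intro holomorphic_intros holomorphic_uhp_inverse theta3_holomorphic)
  show "(\<lambda>z. - \<i> * z * theta3 z ^ 2) holomorphic_on uhp"
    by (intro holomorphic_intros theta3_holomorphic)
  fix t :: real assume t: "t > 0"
  have "theta3 (\<i> * of_real t) ^ 2 = of_real (1 / t) * theta3 (\<i> * of_real (1 / t)) ^ 2"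
    unfolding theta3_inversion_imaginary[OF t] power_mult_distrib of_real_power[symmetric]
    using t by (simp add: power_divide)
  then show "theta3 (- 1 / (\<i> * of_real t)) ^ 2 = - \<i> * (\<i> * of_real t) * theta3 (\<i> * of_real t) ^ 2"
    unfolding neg_inverse_imaginary using t by simp
qed

lemma theta4_inversion:
  assumes z: "z \<in> uhp"
  shows "theta4 (- 1 / z) ^ 2 = - \<i> * z * theta2 z ^ 2"
proof (rule uhp_identity[OF _ _ _ z])
  show "(\<lambda>z. theta4 (- 1 / z) ^ 2) holomorphic_on uhp"
    by (intro holomorphic_intros holomorphic_uhp_inverse theta4_holomorphic)
  show "(\<lambda>z. - \<i> * z * theta2 z ^ 2) holomorphic_on uhp"
    by (intro holomorphic_intros theta2_holomorphic)
  fix t :: real assume t: "t > 0"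
  have "theta2 (\<i> * of_real t) ^ 2 = of_real (1 / t) * theta4 (\<i> * of_real (1 / t)) ^ 2"
    unfolding theta2_inversion_imaginary[OF t] power_mult_distrib of_real_power[symmetric]
    using t by (simp add: power_divide)
  then show "theta4 (- 1 / (\<i> * of_real t)) ^ 2 = - \<i> * (\<i> * of_real t) * theta2 (\<i> * of_real t) ^ 2"
    unfolding neg_inverse_imaginary using t by simp
qed

lemma theta2_inversion:
  assumes z: "z \<in> uhp"
  shows "theta2 (- 1 / z) ^ 2 = - \<i> * z * theta4 z ^ 2"
proof -
  have nz: "z \<noteq> 0" using uhp_nonzero[OF z] .
  have "theta4 z ^ 2 = - \<i> * (- 1 / z) * theta2 (- 1 / z) ^ 2"
    using theta4_inversion[OF uhp_inverse[OF z]] by simp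
  then have "- \<i> * z * theta4 z ^ 2 = (- \<i> * z * (- \<i> * (- 1 / z))) * theta2 (- 1 / z) ^ 2" by (simp only: mult.assoc)
  also have "- \<i> * z * (- \<i> * (- 1 / z)) = 1" using nz by simp
  finally show ?thesis by simp
qed

text \<open>Up to nonzero factors the generators permute the three functions, so only the joint
  statement is invariant. \<open>modular_reduction\<close> then leads to the region where the
  leading terms of the q-series dominate.\<close>

lemma theta_nonzero:
  assumes z: "z \<in> uhp"
  shows "theta2 z \<noteq> 0" "theta3 z \<noteq> 0" "theta4 z \<noteq> 0"
proof -
  have "theta2 z \<noteq> 0 \<and> theta3 z \<noteq> 0 \<and> theta4 z \<noteq> 0"
  proof (rule modular_reduction[OF z, of "\<lambda>z. theta2 z \<noteq> 0 \<and> theta3 z \<noteq> 0 \<and> theta4 z \<noteq> 0"])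
    show "theta2 z \<noteq> 0 \<and> theta3 z \<noteq> 0 \<and> theta4 z \<noteq> 0" if "1 / 2 \<le> Im z" for z
      using theta_nonzero_small[OF that] by blast
    show "theta2 (z + 1) \<noteq> 0 \<and> theta3 (z + 1) \<noteq> 0 \<and> theta4 (z + 1) \<noteq> 0 \<longleftrightarrow> theta2 z \<noteq> 0 \<and> theta3 z \<noteq> 0 \<and> theta4 z \<noteq> 0"
      if "z \<in> uhp" for z using that by (auto simp: theta2_add_1 theta3_add_1 theta4_add_1)
    show "theta2 (- 1 / z) \<noteq> 0 \<and> theta3 (- 1 / z) \<noteq> 0 \<and> theta4 (- 1 / z) \<noteq> 0 \<longleftrightarrow> theta2 z \<noteq> 0 \<and> theta3 z \<noteq> 0 \<and> theta4 z \<noteq> 0"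
      if z: "z \<in> uhp" for z
    proof -
      have "z \<noteq> 0" using uhp_nonzero[OF z] .
      then have "theta2 (- 1 / z) = 0 \<longleftrightarrow> theta4 z = 0" "theta3 (- 1 / z) = 0 \<longleftrightarrow> theta3 z = 0" "theta4 (- 1 / z) = 0 \<longleftrightarrow> theta2 z = 0"
        using arg_cong[OF theta2_inversion[OF z], of "\<lambda>x. x = 0"] arg_cong[OF theta3_inversion[OF z], of "\<lambda>x. x = 0"]
          arg_cong[OF theta4_inversion[OF z], of "\<lambda>x. x = 0"] by simp_all
      then show ?thesis by blast
    qed
  qed
  then show "theta2 z \<noteq> 0" "theta3 z \<noteq> 0" "theta4 z \<noteq> 0" by auto
qed

lemma eval_theta_fps_nonzero:
  assumes "norm q < 1"
  shows "eval_fps theta3_fps q \<noteq> 0" "eval_fps theta4_fps q \<noteq> 0" "eval_fps psi_fps q \<noteq> 0"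
proof -
  have "eval_fps theta3_fps q \<noteq> 0 \<and> eval_fps theta4_fps q \<noteq> 0 \<and> eval_fps psi_fps q \<noteq> 0"
  proof (cases "q = 0")
    case True
    then show ?thesis by (simp add: eval_fps_at_0 theta3_fps_0 theta4_fps_0 psi_fps_0)
  next
    case False
    then obtain z where z: "z \<in> uhp" "qexp z = q" using ex_qexp[of q] assms by auto
    then show ?thesis
      using theta_nonzero[OF z(1)] theta2_eval[OF z(1)] theta3_eval[OF z(1)] theta4_eval[OF z(1)] by auto
  qed
  then show "eval_fps theta3_fps q \<noteq> 0" "eval_fps theta4_fps q \<noteq> 0" "eval_fps psi_fps q \<noteq> 0" by auto
qed

lemma qexp_quarter: "qexp (z / 4) ^ 4 = qexp z"
  unfolding qexp_power by (simp add: qexp_def)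

lemma Delta8_eval:
  assumes z: "z \<in> uhp"
  shows "Delta8 z = qexp z * (eval_fps psi_fps (qexp z) ^ 4 * eval_fps theta4_fps (qexp z) ^ 4)"
  unfolding Delta8_def theta2_eval[OF z] theta4_eval[OF z] power_mult_distrib qexp_quarter by simp

definition haupt :: "complex \<Rightarrow> complex" where "haupt z = Delta8 z / theta3 z ^ 8"

text \<open>The quotient t / q, continued to q = 0. That it vanishes nowhere on the disc makes q = 0
  the only zero of t, and a simple one.\<close>

definition haupt_disc :: "complex \<Rightarrow> complex" where
  "haupt_disc q = eval_fps psi_fps q ^ 4 * eval_fps theta4_fps q ^ 4 / eval_fps theta3_fps q ^ 8"

lemma haupt_eval: "z \<in> uhp \<Longrightarrow> haupt z = qexp z * haupt_disc (qexp z)"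
  by (simp add: haupt_def haupt_disc_def Delta8_eval theta3_eval)

lemma haupt_disc_holomorphic: "haupt_disc holomorphic_on ball 0 1"
  unfolding haupt_disc_def[abs_def]
  by (intro holomorphic_intros holomorphic_eval_fps_ball psi_fps_conv theta4_fps_conv theta3_fps_conv) (auto simp: eval_theta_fps_nonzero)

lemma haupt_disc_nonzero: "q \<in> ball 0 1 \<Longrightarrow> haupt_disc q \<noteq> 0"
  by (simp add: haupt_disc_def eval_theta_fps_nonzero)

lemma power_4_8: "(x::complex) ^ 4 = (x ^ 2) ^ 2" "(x::complex) ^ 8 = (x ^ 2) ^ 4"
  by (simp_all flip: power_mult)

lemma power4_square: "((x::complex) ^ 2) ^ 2 = x ^ 2 * x ^ 2" "((x::complex) ^ 2) ^ 4 = x ^ 4 * x ^ 4"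
  by (simp_all flip: power_mult power_add)

text \<open>Numerator and denominator are both of degree 8 in theta functions, so each acquires the
  factor (-iz)^4.\<close>

lemma haupt_inversion:
  assumes z: "z \<in> uhp"
  shows "haupt (- 1 / z) = haupt z"
proof -
  define w where "w = - \<i> * z"
  have w: "w \<noteq> 0" using uhp_nonzero[OF z] by (simp add: w_def)
  have "haupt (- 1 / z) = (w ^ 4 * (theta2 z ^ 4 * theta4 z ^ 4 / 16)) / (w ^ 4 * theta3 z ^ 8)"
    unfolding haupt_def Delta8_def power_4_8 theta2_inversion[OF z] theta3_inversion[OF z] theta4_inversion[OF z] w_def[symmetric]
      power_mult_distrib by (simp add: power2_eq_square)
  also have "\<dots> = haupt z" unfolding haupt_def Delta8_def using w by simp
  finally show ?thesis .
qed

text \<open>With y = -1/z the point is y + 1. The translation swaps theta3 with theta4 and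
  multiplies theta2^4 by exp(i pi), the source of the sign; the inversion then swaps theta2 with
  theta4.\<close>

lemma haupt_cusp1:
  assumes z: "z \<in> uhp"
  shows "haupt (1 - 1 / z) = - (theta4 z ^ 4 * theta3 z ^ 4) / (16 * theta2 z ^ 8)"
proof -
  define w where "w = - \<i> * z"
  have w: "w \<noteq> 0" using uhp_nonzero[OF z] by (simp add: w_def)
  define y where "y = - 1 / z"
  have y: "y \<in> uhp" unfolding y_def by (rule uhp_inverse[OF z])
  have "exp (\<i> * of_real pi / 4) ^ 4 = exp (of_nat 4 * (\<i> * of_real pi / 4))" by (rule exp_of_nat_mult[symmetric])
  also have "of_nat 4 * (\<i> * of_real pi / 4) = of_real pi * \<i>" by simp
  finally have e: "exp (\<i> * of_real pi / 4) ^ 4 = - 1" by simp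
  have eq: "1 - 1 / z = y + 1" by (simp add: y_def)
  have "haupt (1 - 1 / z) = - (theta2 y ^ 4 * theta3 y ^ 4) / (16 * theta4 y ^ 8)"
    unfolding eq haupt_def Delta8_def theta2_add_1[OF y] theta3_add_1[OF y] theta4_add_1[OF y] power_mult_distrib e
    by simp
  also have "\<dots> = - (w ^ 4 * (theta4 z ^ 4 * theta3 z ^ 4)) / (w ^ 4 * (16 * theta2 z ^ 8))"
    unfolding power_4_8 y_def theta2_inversion[OF z] theta3_inversion[OF z] theta4_inversion[OF z] w_def[symmetric]
      power_mult_distrib power4_square by (simp only: mult_ac)
  also have "\<dots> = - (theta4 z ^ 4 * theta3 z ^ 4) / (16 * theta2 z ^ 8)" using w by simp
  finally show ?thesis .
qed

text \<open>theta2^8 = 2^8 q^2 psi^8, and 16 * 2^8 = 4096.\<close>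

lemma haupt_cusp1_limit: "((\<lambda>z. haupt (1 - 1 / z) * qexp z ^ 2) \<longlongrightarrow> - 1 / 4096) at_cusp"
proof -
  have "((\<lambda>z. - (eval_fps theta4_fps (qexp z) ^ 4 * eval_fps theta3_fps (qexp z) ^ 4) / (4096 * eval_fps psi_fps (qexp z) ^ 8)) \<longlongrightarrow>
      - (fps_nth theta4_fps 0 ^ 4 * fps_nth theta3_fps 0 ^ 4) / (4096 * fps_nth psi_fps 0 ^ 8)) at_cusp"
    by (intro tendsto_intros eval_fps_at_cusp theta4_fps_conv theta3_fps_conv psi_fps_conv) (simp add: psi_fps_0)
  then have *: "((\<lambda>z. - (eval_fps theta4_fps (qexp z) ^ 4 * eval_fps theta3_fps (qexp z) ^ 4) / (4096 * eval_fps psi_fps (qexp z) ^ 8)) \<longlongrightarrow> - 1 / 4096) at_cusp"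
    by (simp add: theta3_fps_0 theta4_fps_0 psi_fps_0)
  show ?thesis
  proof (rule Lim_transform_eventually[OF *])
    show "\<forall>\<^sub>F z in at_cusp. - (eval_fps theta4_fps (qexp z) ^ 4 * eval_fps theta3_fps (qexp z) ^ 4) / (4096 * eval_fps psi_fps (qexp z) ^ 8) =
      haupt (1 - 1 / z) * qexp z ^ 2"
      using eventually_uhp_at_cusp
    proof eventually_elim
      case (elim z)
      have "qexp (z / 4) ^ 8 = (qexp (z / 4) ^ 4) ^ 2" by (simp flip: power_mult)
      then have q: "qexp (z / 4) ^ 8 = qexp z ^ 2" by (simp only: qexp_quarter)
      have "haupt (1 - 1 / z) = - (eval_fps theta4_fps (qexp z) ^ 4 * eval_fps theta3_fps (qexp z) ^ 4) / (4096 * eval_fps psi_fps (qexp z) ^ 8 * qexp z ^ 2)"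
        unfolding haupt_cusp1[OF elim] theta2_eval[OF elim] theta3_eval[OF elim] theta4_eval[OF elim] power_mult_distrib q
        by (simp add: mult_ac)
      then show ?case using qexp_nonzero[of z] by simp
    qed
  qed
qed

section \<open>Theta series of the lattice and of its shadow\<close>

text \<open>The factor d clears the denominators of the norms: 1 for a selfdual lattice, 4 for its
  shadow, whose theta series is a power series in q^(1/4).\<close>

lemma theta_set_eval:
  fixes e :: "(nat \<Rightarrow> real) \<Rightarrow> nat" and d :: nat
  assumes summ: "\<And>t. t > 0 \<Longrightarrow> (\<lambda>x. exp (- pi * t * ip n x x)) summable_on A"
    and e: "\<And>x. x \<in> A \<Longrightarrow> real (e x) = real d * ip n x x" and d: "d > 0"
  shows "fps_conv_radius (fibre_fps e A) \<ge> 1"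
    and "z \<in> uhp \<Longrightarrow> theta_set n A z = eval_fps (fibre_fps e A) (qexp (z / of_nat d))"
proof -
  have pos: "(\<lambda>x. r ^ e x) summable_on A" if r: "0 < r" "r < 1" for r :: real
  proof -
    \<comment> \<open>Chosen so that r^(e x) = exp(-pi t <x,x>).\<close>
    define t where "t = real d * (- ln r) / pi"
    have t: "t > 0" unfolding t_def using r d by (intro divide_pos_pos mult_pos_pos) auto
    have "(\<lambda>x. r ^ e x) summable_on A \<longleftrightarrow> (\<lambda>x. exp (- pi * t * ip n x x)) summable_on A"
    proof (rule summable_on_cong)
      fix x assume "x \<in> A"
      have "r ^ e x = exp (ln r) ^ e x" using r by simp
      also have "\<dots> = exp (ln r * real (e x))" by (simp only: exp_of_nat_mult[symmetric] mult.commute)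
      also have "ln r * real (e x) = - pi * t * ip n x x" using e[OF \<open>x \<in> A\<close>] by (simp add: t_def)
      finally show "r ^ e x = exp (- pi * t * ip n x x)" .
    qed
    then show ?thesis using summ[OF t] by simp
  qed
  have all: "(\<lambda>x. r ^ e x) summable_on A" if r: "0 \<le> r" "r < 1" for r :: real
  proof (cases "r = 0")
    case True
    show ?thesis
      by (rule summable_on_comparison_test[OF pos[of "1 / 2"]]) (auto simp: True power_0_left)
  qed (use pos r in auto)
  show "fps_conv_radius (fibre_fps e A) \<ge> 1" by (rule fps_conv_radius_fibre[OF all])
  assume z: "z \<in> uhp"
  then have "z / of_nat d \<in> uhp" using d by (simp add: uhp_def Im_divide_of_nat)
  then have "eval_fps (fibre_fps e A) (qexp (z / of_nat d)) = (\<Sum>\<^sub>\<infinity>x\<in>A. qexp (z / of_nat d) ^ e x)"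
    using qexp_in_ball by (intro eval_fibre_fps[OF all]) auto
  also have "\<dots> = theta_set n A z" unfolding theta_set_def
  proof (rule infsum_cong)
    fix x assume "x \<in> A"
    have "of_nat (e x) = complex_of_real (real (e x))" by simp
    also have "\<dots> = of_nat d * of_real (ip n x x)" unfolding e[OF \<open>x \<in> A\<close>] by simp
    finally have "of_nat (e x) = of_nat d * complex_of_real (ip n x x)" .
    then show "qexp (z / of_nat d) ^ e x = exp (\<i> * of_real pi * z * of_real (ip n x x))"
      unfolding qexp_power using d by (intro arg_cong[of _ _ exp]) (simp add: field_simps)
  qed
  finally show "theta_set n A z = eval_fps (fibre_fps e A) (qexp (z / of_nat d))" by simp
qed

lemma theta_set_imaginary:
  "theta_set n A (\<i> * of_real t) = (\<Sum>\<^sub>\<infinity>x\<in>A. complex_of_real (exp (- pi * t * ip n x x)))"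
  unfolding theta_set_def
proof (rule infsum_cong)
  fix x
  have "\<i> * of_real pi * (\<i> * of_real t) * of_real (ip n x x) = complex_of_real (- pi * t * ip n x x)"
    by (simp add: complex_eq_iff)
  then show "exp (\<i> * of_real pi * (\<i> * of_real t) * of_real (ip n x x)) = complex_of_real (exp (- pi * t * ip n x x))"
    by (simp only: exp_of_real)
qed

text \<open>The real part 1 contributes exp(i pi <x,x>), which is the case \<epsilon> = 1 of
  \<open>lattice_theta_inversion\<close>.\<close>

lemma theta_set_1_imaginary:
  "theta_set n A (1 + \<i> * of_real t) = (\<Sum>\<^sub>\<infinity>x\<in>A. cis (pi * of_int 1 * ip n x x) * complex_of_real (exp (- pi * t * ip n x x)))"
  unfolding theta_set_def
proof (rule infsum_cong)
  fix x
  have "\<i> * of_real pi * (1 + \<i> * of_real t) * of_real (ip n x x) =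
      \<i> * of_real (pi * of_int 1 * ip n x x) + complex_of_real (- pi * t * ip n x x)"
    by (simp add: complex_eq_iff)
  then show "exp (\<i> * of_real pi * (1 + \<i> * of_real t) * of_real (ip n x x)) =
      cis (pi * of_int 1 * ip n x x) * complex_of_real (exp (- pi * t * ip n x x))"
    by (simp only: exp_add exp_of_real cis_conv_exp)
qed

context
  fixes n \<Lambda> assumes sd: "selfdual n \<Lambda>"
begin

lemma summable_selfdual: "t > 0 \<Longrightarrow> (\<lambda>x. exp (- pi * t * ip n x x)) summable_on \<Lambda>"
  using summable_gauss_twisted_dual[OF sd, of t 0] by (simp add: twisted_dual_0[OF sd])

lemma summable_shadow: "t > 0 \<Longrightarrow> (\<lambda>x. exp (- pi * t * ip n x x)) summable_on shadow n \<Lambda>"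
  using summable_gauss_twisted_dual[OF sd, of t 1] by (simp add: shadow_eq_twisted_dual[OF sd])

lemma selfdual_norm: "x \<in> \<Lambda> \<Longrightarrow> real (nat \<lfloor>ip n x x\<rfloor>) = real 1 * ip n x x"
proof -
  assume x: "x \<in> \<Lambda>"
  then have "ip n x x \<in> \<int>" using selfdual_mem[OF sd, of x] by blast
  then show ?thesis using ip_self_nonneg[of n x] by (auto elim!: Ints_cases)
qed

lemma shadow_norm: "x \<in> shadow n \<Lambda> \<Longrightarrow> real (nat \<lfloor>4 * ip n x x\<rfloor>) = real 4 * ip n x x"
proof -
  assume "x \<in> shadow n \<Lambda>"
  then obtain j :: nat where "ip n x x = real j / 4" using shadow_norm_quarter[OF sd] by blast
  then have j: "4 * ip n x x = real j" by simp
  show ?thesis by (simp add: j)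
qed

definition "lattice_fps = fibre_fps (\<lambda>x. nat \<lfloor>ip n x x\<rfloor>) \<Lambda>"

definition "shadow_fps = fibre_fps (\<lambda>x. nat \<lfloor>4 * ip n x x\<rfloor>) (shadow n \<Lambda>)"

lemma lattice_fps_conv: "fps_conv_radius lattice_fps \<ge> 1"
  unfolding lattice_fps_def by (rule theta_set_eval(1)[OF summable_selfdual selfdual_norm]) auto

lemma shadow_fps_conv: "fps_conv_radius shadow_fps \<ge> 1"
  unfolding shadow_fps_def by (rule theta_set_eval(1)[OF summable_shadow shadow_norm]) auto

lemma theta_lattice_eval: "z \<in> uhp \<Longrightarrow> theta_set n \<Lambda> z = eval_fps lattice_fps (qexp z)"
  unfolding lattice_fps_def using theta_set_eval(2)[OF summable_selfdual selfdual_norm] by simp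

lemma theta_shadow_eval: "z \<in> uhp \<Longrightarrow> theta_set n (shadow n \<Lambda>) z = eval_fps shadow_fps (qexp (z / 4))"
  unfolding shadow_fps_def using theta_set_eval(2)[OF summable_shadow shadow_norm, of z] by simp

lemma theta_lattice_holomorphic: "theta_set n \<Lambda> holomorphic_on uhp"
  by (rule holomorphic_transform[OF holomorphic_eval_fps_qexp[OF lattice_fps_conv]]) (simp add: theta_lattice_eval)

lemma theta_shadow_holomorphic: "theta_set n (shadow n \<Lambda>) holomorphic_on uhp"
proof -
  have "(\<lambda>z. eval_fps shadow_fps (qexp (z / 4))) holomorphic_on uhp"
    by (rule holomorphic_on_compose_gen[OF _ holomorphic_eval_fps_qexp[OF shadow_fps_conv], of "\<lambda>z. z / 4", unfolded o_def])
       (auto intro!: holomorphic_intros simp: uhp_def Im_divide_of_nat)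
  then show ?thesis by (rule holomorphic_transform) (simp add: theta_shadow_eval)
qed

text \<open>On the imaginary axis lattice and \<open>theta3 z ^ n\<close> acquire the same power of
  sqrt t. It cancels in the quotient, so the identity extends to \<open>uhp\<close> also for odd
  n.\<close>

lemma theta_lattice_inversion:
  assumes z: "z \<in> uhp"
  shows "theta_set n \<Lambda> (- 1 / z) / theta3 (- 1 / z) ^ n = theta_set n \<Lambda> z / theta3 z ^ n"
proof (rule uhp_identity[OF _ _ _ z])
  have h: "(\<lambda>z. theta_set n \<Lambda> z / theta3 z ^ n) holomorphic_on uhp"
    by (intro holomorphic_intros theta_lattice_holomorphic theta3_holomorphic) (simp add: theta_nonzero)
  then show "(\<lambda>z. theta_set n \<Lambda> z / theta3 z ^ n) holomorphic_on uhp" .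
  show "(\<lambda>z. theta_set n \<Lambda> (- 1 / z) / theta3 (- 1 / z) ^ n) holomorphic_on uhp"
    by (rule holomorphic_uhp_inverse[OF h])
  fix t :: real assume t: "t > 0"
  have "theta_set n \<Lambda> (\<i> * of_real t) = of_real (1 / sqrt t) ^ n * theta_set n \<Lambda> (\<i> * of_real (1 / t))"
    unfolding theta_set_imaginary
    using lattice_theta_inversion[OF sd t, of 0] infsum_complex_of_real[OF summable_selfdual, of "1 / t"] t
    by (simp add: twisted_dual_0[OF sd] power_divide)
  then show "theta_set n \<Lambda> (- 1 / (\<i> * of_real t)) / theta3 (- 1 / (\<i> * of_real t)) ^ n =
      theta_set n \<Lambda> (\<i> * of_real t) / theta3 (\<i> * of_real t) ^ n"
    unfolding neg_inverse_imaginary theta3_inversion_imaginary[OF t] power_mult_distrib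
    using t by simp
qed

text \<open>At z = it the argument is 1 + i/t: the 1 produces the signs (-1)^<x,x>, whose series
  inverts to the shadow at it. In the denominator it turns theta3 into theta4, which inverts to
  theta2 with the same factor sqrt t.\<close>

lemma theta_lattice_cusp1:
  assumes z: "z \<in> uhp"
  shows "theta_set n \<Lambda> (1 - 1 / z) / theta3 (1 - 1 / z) ^ n = theta_set n (shadow n \<Lambda>) z / theta2 z ^ n"
proof (rule uhp_identity[OF _ _ _ z])
  have h: "(\<lambda>z. theta_set n \<Lambda> z / theta3 z ^ n) holomorphic_on uhp"
    by (intro holomorphic_intros theta_lattice_holomorphic theta3_holomorphic) (simp add: theta_nonzero)
  show "(\<lambda>z. theta_set n \<Lambda> (1 - 1 / z) / theta3 (1 - 1 / z) ^ n) holomorphic_on uhp"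
    by (rule holomorphic_on_compose_gen[OF _ h, of "\<lambda>z. 1 - 1 / z", unfolded o_def])
       (auto intro!: holomorphic_intros uhp_cusp1 dest: uhp_nonzero)
  show "(\<lambda>z. theta_set n (shadow n \<Lambda>) z / theta2 z ^ n) holomorphic_on uhp"
    by (intro holomorphic_intros theta_shadow_holomorphic theta2_holomorphic) (simp add: theta_nonzero)
  fix t :: real assume t: "t > 0"
  have u: "\<i> * of_real (1 / t) \<in> uhp" using t by (simp add: uhp_def)
  have "1 - 1 / (\<i> * complex_of_real t) = 1 + - 1 / (\<i> * of_real t)" by simp
  then have e: "1 - 1 / (\<i> * complex_of_real t) = 1 + \<i> * of_real (1 / t)" unfolding neg_inverse_imaginary .
  have "theta_set n \<Lambda> (1 + \<i> * of_real (1 / t)) = of_real (1 / sqrt (1 / t) ^ n * (\<Sum>\<^sub>\<infinity>w\<in>shadow n \<Lambda>. exp (- pi * ip n w w / (1 / t))))"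
    unfolding theta_set_1_imaginary shadow_eq_twisted_dual[OF sd]
    using t by (intro lattice_theta_inversion[OF sd]) simp
  also have "\<dots> = of_real (sqrt t) ^ n * theta_set n (shadow n \<Lambda>) (\<i> * of_real t)"
    unfolding theta_set_imaginary using infsum_complex_of_real[OF summable_shadow[OF t]]
    by (simp add: real_sqrt_divide power_divide mult_ac)
  finally have 1: "theta_set n \<Lambda> (1 + \<i> * of_real (1 / t)) = of_real (sqrt t) ^ n * theta_set n (shadow n \<Lambda>) (\<i> * of_real t)" .
  have "theta3 (1 + \<i> * of_real (1 / t)) = theta4 (\<i> * of_real (1 / t))"
    using theta3_add_1[OF u] by (simp add: add.commute)
  also have "\<dots> = of_real (sqrt t) * theta2 (\<i> * of_real t)"
    unfolding theta2_inversion_imaginary[OF t] using t by simp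
  finally have 2: "theta3 (1 + \<i> * of_real (1 / t)) ^ n = of_real (sqrt t) ^ n * theta2 (\<i> * of_real t) ^ n"
    by (simp add: power_mult_distrib)
  show "theta_set n \<Lambda> (1 - 1 / (\<i> * of_real t)) / theta3 (1 - 1 / (\<i> * of_real t)) ^ n =
      theta_set n (shadow n \<Lambda>) (\<i> * of_real t) / theta2 (\<i> * of_real t) ^ n"
    unfolding e 1 2 using t by simp
qed

end

section \<open>Coefficients\<close>

text \<open>\<open>qexp\<close> covers only the punctured disc; at q = 0 the agreement comes from
  the limit at the cusp.\<close>

lemma fps_eq_if_eval_eq:
  fixes f g :: "complex fps"
  assumes f: "fps_conv_radius f \<ge> 1" and g: "fps_conv_radius g \<ge> 1"
    and eq: "\<And>z. z \<in> uhp \<Longrightarrow> eval_fps f (qexp z) = eval_fps g (qexp z)"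
  shows "f = g"
proof -
  have eq': "eval_fps f q = eval_fps g q" if q: "norm q < 1" for q
  proof (cases "q = 0")
    case True
    have "((\<lambda>z. eval_fps g (qexp z)) \<longlongrightarrow> fps_nth f 0) at_cusp"
      using eval_fps_at_cusp[OF f] eventually_mono[OF eventually_uhp_at_cusp eq] by (rule Lim_transform_eventually)
    then have "fps_nth f 0 = fps_nth g 0"
      using tendsto_unique[OF at_cusp_neq_bot _ eval_fps_at_cusp[OF g]] by blast
    then show ?thesis by (simp add: True eval_fps_at_0)
  next
    case False
    then obtain z where "z \<in> uhp" "qexp z = q" using ex_qexp[of q] q by auto
    then show ?thesis using eq by blast
  qed
  have pos: "0 < fps_conv_radius h" if "fps_conv_radius h \<ge> 1" for h :: "complex fps"
    using that norm_less_conv_radius[of h 0] by (simp add: zero_ereal_def)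
  have "eventually (\<lambda>q. q \<in> ball 0 1) (nhds (0::complex))" by (rule eventually_nhds_in_open) auto
  then have "eventually (\<lambda>q. eval_fps g q = eval_fps f q) (nhds 0)"
    by eventually_elim (use eq' in auto)
  then have "eval_fps f has_fps_expansion g" unfolding has_fps_expansion_def using pos[OF g] by simp
  moreover have "eval_fps f has_fps_expansion f" by (rule eval_fps_has_fps_expansion[OF pos[OF f]])
  ultimately show ?thesis by (metis fps_expansion_unique_complex)
qed

lemma fps_conv_radius_mult_ge1:
  fixes f g :: "complex fps"
  shows "fps_conv_radius f \<ge> 1 \<Longrightarrow> fps_conv_radius g \<ge> 1 \<Longrightarrow> fps_conv_radius (f * g) \<ge> 1"
  by (rule order_trans[OF _ fps_conv_radius_mult]) simp

lemma fps_conv_radius_power_ge1: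
  fixes f :: "complex fps"
  shows "fps_conv_radius f \<ge> 1 \<Longrightarrow> fps_conv_radius (f ^ m) \<ge> 1"
  by (rule order_trans[OF _ fps_conv_radius_power])

lemma fps_conv_radius_sum_ge1:
  fixes f :: "'i \<Rightarrow> complex fps"
  assumes "finite I" "\<And>i. i \<in> I \<Longrightarrow> fps_conv_radius (f i) \<ge> 1"
  shows "fps_conv_radius (sum f I) \<ge> 1"
  using assms
proof (induction I rule: finite_induct)
  case (insert i I)
  then show ?case using order_trans[OF _ fps_conv_radius_add[of "f i" "sum f I"], of 1] by simp
qed simp

lemma eval_fps_sum_ge1:
  fixes f :: "'i \<Rightarrow> complex fps"
  assumes "finite I" "\<And>i. i \<in> I \<Longrightarrow> fps_conv_radius (f i) \<ge> 1" "norm q < 1"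
  shows "eval_fps (sum f I) q = (\<Sum>i\<in>I. eval_fps (f i) q)"
  using assms
proof (induction I rule: finite_induct)
  case (insert i I)
  then show ?case
    by (simp add: eval_fps_add norm_less_conv_radius fps_conv_radius_sum_ge1)
qed simp

lemma fps_power_nth_1:
  fixes f :: "complex fps"
  assumes "fps_nth f 0 = 1"
  shows "fps_nth (f ^ m) 1 = of_nat m * fps_nth f 1"
proof (induction m)
  case (Suc m)
  have "fps_nth (f ^ Suc m) 1 = fps_nth f 1 + fps_nth (f ^ m) 1"
    using assms by (simp add: fps_mult_nth fps_nth_power_0)
  then show ?case using Suc by (simp add: algebra_simps)
qed simp

lemma fps_power_nth_2:
  fixes f :: "complex fps"
  assumes "fps_nth f 0 = 1"
  shows "fps_nth (f ^ m) 2 = of_nat m * fps_nth f 2 + of_nat m * (of_nat m - 1) / 2 * fps_nth f 1 ^ 2"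
proof (induction m)
  case (Suc m)
  have "fps_nth (f ^ Suc m) 2 = fps_nth f 2 + fps_nth f 1 * fps_nth (f ^ m) 1 + fps_nth (f ^ m) 2"
    using assms by (simp add: fps_mult_nth fps_nth_power_0 numeral_2_eq_2 algebra_simps)
  then show ?case unfolding Suc fps_power_nth_1[OF assms]
    by (simp add: field_simps power2_eq_square)
qed simp

definition fps_Ints :: "complex fps \<Rightarrow> bool" where
  "fps_Ints f \<longleftrightarrow> (\<forall>j. fps_nth f j \<in> \<int>)"

lemma fps_Ints_mult: "fps_Ints f \<Longrightarrow> fps_Ints g \<Longrightarrow> fps_Ints (f * g)"
  unfolding fps_Ints_def fps_mult_nth by (intro allI Ints_sum Ints_mult) auto

lemma fps_Ints_power: "fps_Ints f \<Longrightarrow> fps_Ints (f ^ m)"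
  by (induction m) (auto intro: fps_Ints_mult, simp add: fps_Ints_def)

lemma fps_Ints_fibre: "fps_Ints (fibre_fps e I)"
  by (simp add: fps_Ints_def fibre_fps_nth)

lemma fps_Ints_theta: "fps_Ints theta3_fps" "fps_Ints theta4_fps" "fps_Ints psi_fps"
proof -
  show "fps_Ints theta3_fps" "fps_Ints psi_fps" unfolding theta3_fps_def psi_fps_def by (rule fps_Ints_fibre)+
  then show "fps_Ints theta4_fps" unfolding fps_Ints_def theta4_fps_def by (auto intro!: Ints_mult Ints_power)
qed

text \<open>\<open>basis_fps n i\<close> is the expansion of \<open>\<Delta>\<^sub>8\<^sup>i \<theta>\<^sub>3\<^bsup>n-8i\<^esup>\<close>.\<close>

definition basis_fps :: "nat \<Rightarrow> nat \<Rightarrow> complex fps" where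
  "basis_fps n i = fps_X ^ i * ((psi_fps ^ 4 * theta4_fps ^ 4) ^ i * theta3_fps ^ (n - 8 * i))"

lemma basis_fps_conv: "fps_conv_radius (basis_fps n i) \<ge> 1"
  unfolding basis_fps_def
  by (intro fps_conv_radius_mult_ge1 fps_conv_radius_power_ge1 psi_fps_conv theta4_fps_conv theta3_fps_conv) simp

lemma basis_fps_eval:
  assumes z: "z \<in> uhp"
  shows "eval_fps (basis_fps n i) (qexp z) = Delta8 z ^ i * theta3 z ^ (n - 8 * i)"
proof -
  have q: "norm (qexp z) < 1" using qexp_in_ball[OF z] by simp
  note ev = eval_fps_mult[OF norm_less_conv_radius[OF _ q] norm_less_conv_radius[OF _ q]]
    eval_fps_power[OF norm_less_conv_radius[OF _ q]]
  show ?thesis unfolding basis_fps_def Delta8_eval[OF z] theta3_eval[OF z]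
    by (simp add: ev psi_fps_conv theta4_fps_conv theta3_fps_conv fps_conv_radius_mult_ge1 fps_conv_radius_power_ge1 power_mult_distrib mult_ac)
qed

lemma basis_fps_Ints: "fps_Ints (basis_fps n i)"
  unfolding basis_fps_def
  by (intro fps_Ints_mult fps_Ints_power fps_Ints_theta) (simp add: fps_Ints_def)

lemma basis_fps_nth_less: "j < i \<Longrightarrow> fps_nth (basis_fps n i) j = 0"
  by (simp add: basis_fps_def fps_X_power_mult_nth)

lemma basis_fps_nth_eq: "fps_nth (basis_fps n i) i = 1"
  by (simp add: basis_fps_def fps_X_power_mult_nth fps_nth_power_0 theta3_fps_0 theta4_fps_0 psi_fps_0)

lemma basis_fps_0_nth: "fps_nth (basis_fps n 0) 1 = 2 * of_nat n"
  "fps_nth (basis_fps n 0) 2 = 2 * of_nat n * (of_nat n - 1)"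
  using fps_power_nth_1[OF theta3_fps_0, of n] fps_power_nth_2[OF theta3_fps_0, of n] by (simp_all add: basis_fps_def theta3_fps_1 theta3_fps_2 flip: One_nat_def)

lemma basis_fps_1_nth:
  assumes "n \<ge> 8"
  shows "fps_nth (basis_fps n 1) 2 = 2 * of_nat n - 24"
proof -
  have "fps_nth (basis_fps n 1) 2 = fps_nth (psi_fps ^ 4 * theta4_fps ^ 4 * theta3_fps ^ (n - 8)) 1"
    by (simp add: basis_fps_def numeral_2_eq_2)
  also have "\<dots> = fps_nth (psi_fps ^ 4) 1 + fps_nth (theta4_fps ^ 4) 1 + fps_nth (theta3_fps ^ (n - 8)) 1"
    by (simp add: fps_mult_nth fps_nth_power_0 theta3_fps_0 theta4_fps_0 psi_fps_0)
  \<comment> \<open>theta4^4 contributes 4 * (-2), theta3^(n-8) contributes 2(n - 8), and psi has no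
    linear term. The assumption n >= 8 makes the subtraction of naturals exact.\<close>
  also have "\<dots> = - 8 + 2 * (of_nat n - 8)"
    unfolding fps_power_nth_1[OF theta3_fps_0] fps_power_nth_1[OF theta4_fps_0] fps_power_nth_1[OF psi_fps_0] theta3_fps_1 theta4_fps_1 psi_fps_1
    using assms by (simp add: of_nat_diff)
  finally show ?thesis by simp
qed

text \<open>The i-th basis series is q^i plus higher terms with integral coefficients, so each c i
  is the i-th coefficient of \<open>P\<close> minus an integral combination of earlier c l.\<close>

lemma basis_coeffs_Ints:
  fixes c :: "nat \<Rightarrow> complex"
  assumes P: "fps_Ints P" and eq: "P = (\<Sum>i\<le>k. fps_const (c i) * basis_fps n i)" and i: "i \<le> k"
  shows "c i \<in> \<int>"
  using i
proof (induction i rule: less_induct)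
  case (less i)
  have "fps_nth P i = (\<Sum>l\<le>k. c l * fps_nth (basis_fps n l) i)"
    unfolding eq by (simp add: fps_sum_nth)
  also have "\<dots> = (\<Sum>l\<le>i. c l * fps_nth (basis_fps n l) i)"
    using less.prems by (intro sum.mono_neutral_right) (auto simp: basis_fps_nth_less)
  also have "\<dots> = (\<Sum>l<i. c l * fps_nth (basis_fps n l) i) + c i"
    by (simp add: basis_fps_nth_eq flip: lessThan_Suc_atMost)
  finally have "c i = fps_nth P i - (\<Sum>l<i. c l * fps_nth (basis_fps n l) i)" by simp
  moreover have "(\<Sum>l<i. c l * fps_nth (basis_fps n l) i) \<in> \<int>"
    using less basis_fps_Ints[of n] by (intro Ints_sum Ints_mult) (auto simp: fps_Ints_def)
  moreover have "fps_nth P i \<in> \<int>" using P by (simp add: fps_Ints_def)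
  ultimately show ?case by simp
qed

section \<open>The second cusp and the polynomial expression\<close>

lemma filterlim_quarter_at_cusp: "filterlim (\<lambda>z. z / 4) at_cusp at_cusp"
  unfolding at_cusp_def filterlim_filtercomap_iff
proof -
  have "filterlim (\<lambda>z. 1 / 4 * Im z) at_top (filtercomap Im at_top)"
    by (rule filterlim_tendsto_pos_mult_at_top[OF tendsto_const _ filterlim_filtercomap]) simp
  then show "filterlim (Im \<circ> (\<lambda>z. z / 4)) at_top (filtercomap Im at_top)"
    by (simp add: o_def)
qed

context
  fixes n \<Lambda> assumes sd: "selfdual n \<Lambda>"
begin

lemma lattice_fps_nth: "fps_nth (lattice_fps n \<Lambda>) j = of_nat (card (shell n \<Lambda> (real j)))"
proof -
  have "{x \<in> \<Lambda>. nat \<lfloor>ip n x x\<rfloor> = j} = shell n \<Lambda> (real j)"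
    using selfdual_norm[OF sd] by (force simp: shell_def)
  then show ?thesis by (simp add: lattice_fps_def[OF sd] fibre_fps_nth)
qed

lemma lattice_fps_0: "fps_nth (lattice_fps n \<Lambda>) 0 = 1"
proof -
  have "x \<in> vecs n" if "x \<in> \<Lambda>" for x using that selfdual_mem[OF sd, of x] by blast
  then have "shell n \<Lambda> 0 = {\<lambda>_. 0}"
    using selfdual_zero[OF sd] ip_self_eq_0[of _ n] by (auto simp: shell_def) (simp add: ip_def)
  then show ?thesis using lattice_fps_nth[of 0] by simp
qed

lemma shadow_fps_nth: "fps_nth (shadow_fps n \<Lambda>) j = of_nat (card (shell n (shadow n \<Lambda>) (real j / 4)))"
proof -
  have "{x \<in> shadow n \<Lambda>. nat \<lfloor>4 * ip n x x\<rfloor> = j} = shell n (shadow n \<Lambda>) (real j / 4)"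
    using shadow_norm[OF sd] by (force simp: shell_def)
  then show ?thesis by (simp add: shadow_fps_def[OF sd] fibre_fps_nth)
qed

text \<open>With an empty shadow, \<open>theta_lattice_cusp1\<close> would make the theta series
  vanish at all points 1 - 1/z, that is on all of \<open>uhp\<close>, against its constant term 1.
  The infimum in \<open>sigma\<close> is thus taken over a nonempty set.\<close>

lemma shadow_nonempty: "shadow n \<Lambda> \<noteq> {}"
proof
  assume "shadow n \<Lambda> = {}"
  then have z: "theta_set n \<Lambda> (1 - 1 / z) = 0" if "z \<in> uhp" for z
    using theta_lattice_cusp1[OF sd that] theta_nonzero(2)[OF uhp_cusp1[OF that]] by (simp add: theta_set_def)
  have "eval_fps (lattice_fps n \<Lambda>) (qexp y) = 0" if y: "y \<in> uhp" for y
  proof -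
    have y1: "y - 1 \<in> uhp" using y by (simp add: uhp_def)
    then have "1 - 1 / (- 1 / (y - 1)) = y" using uhp_nonzero[OF y1] by simp
    then show ?thesis using z[OF uhp_inverse[OF y1]] theta_lattice_eval[OF sd y] by simp
  qed
  then have "lattice_fps n \<Lambda> = 0" by (intro fps_eq_if_eval_eq lattice_fps_conv[OF sd]) auto
  then show False using lattice_fps_0 by simp
qed

context
  fixes k assumes sigma: "sigma n \<Lambda> = real n - 8 * real k"
begin

lemma shadow_norm_ge: "x \<in> shadow n \<Lambda> \<Longrightarrow> ip n x x \<ge> (real n - 8 * real k) / 4"
proof -
  assume "x \<in> shadow n \<Lambda>"
  then have "Inf ((\<lambda>x. ip n x x) ` shadow n \<Lambda>) \<le> ip n x x"
    by (intro cInf_lower bdd_belowI2[where m = 0]) (auto simp: ip_self_nonneg)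
  then show ?thesis using sigma by (simp add: sigma_def)
qed

text \<open>An infimum of nonnegative norms is nonnegative. It follows that \<open>n - 8 * i\<close>
  is an honest subtraction for every i <= k.\<close>

lemma dimension_ge: "8 * k \<le> n"
proof -
  have "Inf ((\<lambda>x. ip n x x) ` shadow n \<Lambda>) \<ge> 0"
    using shadow_nonempty by (intro cInf_greatest) (auto simp: ip_self_nonneg)
  then have "8 * real k \<le> real n" using sigma by (simp add: sigma_def)
  then show ?thesis by linarith
qed

text \<open>In r = q^(1/4) the shadow series is r^(n-8k) times a series whose constant term counts
  the shell, theta2^n is 2^n r^n times a series with constant term 1, and q^(2k) = r^(8k): all
  powers of r cancel.\<close>

lemma shadow_cusp_limit:
  "((\<lambda>z. theta_set n (shadow n \<Lambda>) z / theta2 z ^ n * qexp z ^ (2 * k)) \<longlongrightarrow>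
     of_nat (card (shell n (shadow n \<Lambda>) ((real n - 8 * real k) / 4))) / 2 ^ n) at_cusp"
proof -
  let ?s = "complex_of_nat (card (shell n (shadow n \<Lambda>) ((real n - 8 * real k) / 4)))"
  define j where "j = n - 8 * k"
  have j: "real j = real n - 8 * real k" using dimension_ge by (simp add: j_def of_nat_diff)
  define P where "P = fps_shift j (shadow_fps n \<Lambda>)"
  have "fps_nth (shadow_fps n \<Lambda>) i = 0" if "i < j" for i
  proof -
    have "shell n (shadow n \<Lambda>) (real i / 4) = {}"
      using shadow_norm_ge that unfolding j[symmetric] by (force simp: shell_def)
    then show ?thesis by (simp add: shadow_fps_nth)
  qed
  then have eq: "shadow_fps n \<Lambda> = fps_X ^ j * P"
    by (intro fps_ext) (auto simp: P_def fps_X_power_mult_nth)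
  have Pc: "fps_conv_radius P \<ge> 1" unfolding P_def using shadow_fps_conv[OF sd] by simp
  have P0: "fps_nth P 0 = ?s"
    by (simp add: P_def shadow_fps_nth j)
  have "((\<lambda>z. eval_fps P (qexp (z / 4)) / (2 ^ n * eval_fps psi_fps (qexp z) ^ n)) \<longlongrightarrow>
      fps_nth P 0 / (2 ^ n * fps_nth psi_fps 0 ^ n)) at_cusp"
    by (intro tendsto_intros filterlim_compose[OF eval_fps_at_cusp[OF Pc] filterlim_quarter_at_cusp]
        eval_fps_at_cusp psi_fps_conv) (simp add: psi_fps_0)
  then have *: "((\<lambda>z. eval_fps P (qexp (z / 4)) / (2 ^ n * eval_fps psi_fps (qexp z) ^ n)) \<longlongrightarrow>
      ?s / 2 ^ n) at_cusp"
    by (simp add: psi_fps_0 P0)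
  show ?thesis
  proof (rule Lim_transform_eventually[OF *])
    show "\<forall>\<^sub>F z in at_cusp. eval_fps P (qexp (z / 4)) / (2 ^ n * eval_fps psi_fps (qexp z) ^ n) =
        theta_set n (shadow n \<Lambda>) z / theta2 z ^ n * qexp z ^ (2 * k)"
      using eventually_uhp_at_cusp
    proof eventually_elim
      case (elim z)
      define r where "r = qexp (z / 4)"
      have r0: "r \<noteq> 0" by (simp add: r_def qexp_nonzero)
      have "z / 4 \<in> uhp" using elim by (simp add: uhp_def Im_divide_of_nat)
      then have r1: "norm r < 1" using qexp_in_ball by (auto simp: r_def)
      have sh: "theta_set n (shadow n \<Lambda>) z = r ^ j * eval_fps P r"
        unfolding theta_shadow_eval[OF sd elim] r_def[symmetric] eq
        by (simp add: eval_fps_mult norm_less_conv_radius[OF _ r1] Pc eval_fps_power fps_conv_radius_power_ge1)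
      have "qexp z ^ (2 * k) = (r ^ 4) ^ (2 * k)" by (simp add: r_def qexp_quarter)
      then have q: "qexp z ^ (2 * k) = r ^ (8 * k)" by (simp flip: power_mult)
      have "r ^ j * r ^ (8 * k) = r ^ n" using dimension_ge by (simp add: j_def flip: power_add)
      then have "theta_set n (shadow n \<Lambda>) z / theta2 z ^ n * qexp z ^ (2 * k) =
          (r ^ n * eval_fps P r) / (r ^ n * (2 ^ n * eval_fps psi_fps (qexp z) ^ n))"
        unfolding sh q theta2_eval[OF elim] r_def[symmetric] power_mult_distrib
        by (simp add: mult_ac)
      also have "\<dots> = eval_fps P r / (2 ^ n * eval_fps psi_fps (qexp z) ^ n)" using r0 by simp
      finally show ?case by (simp add: r_def)
    qed
  qed
qed

text \<open>Multiplication by theta3^n turns the powers of t into Delta8^i theta3^(n-8i). The second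
  equation is the comparison at the second cusp, where t q^2 tends to -1/4096.\<close>

lemma theta_lattice_polynomial:
  "\<exists>c::nat \<Rightarrow> int. lattice_fps n \<Lambda> = (\<Sum>i\<le>k. fps_const (of_int (c i)) * basis_fps n i) \<and>
    of_int (c k) * (- 1 / 4096) ^ k = (of_nat (card (shell n (shadow n \<Lambda>) ((real n - 8 * real k) / 4))) / 2 ^ n :: complex)"
proof -
  let ?s = "complex_of_nat (card (shell n (shadow n \<Lambda>) ((real n - 8 * real k) / 4)))"
  define F where "F q = eval_fps (lattice_fps n \<Lambda>) q / eval_fps theta3_fps q ^ n" for q
  have Fq: "F (qexp z) = theta_set n \<Lambda> z / theta3 z ^ n" if "z \<in> uhp" for z
    using that by (simp add: F_def theta_lattice_eval[OF sd] theta3_eval)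
  have "\<exists>c. (\<forall>z\<in>uhp. F (qexp z) = (\<Sum>i\<le>k. c i * haupt z ^ i)) \<and>
      c k * (- 1 / 4096) ^ k = ?s / 2 ^ n"
  proof (rule polynomial_in_hauptmodul[where F = F, OF haupt_disc_holomorphic haupt_disc_nonzero haupt_eval haupt_inversion haupt_cusp1_limit])
    show "F holomorphic_on ball 0 1" unfolding F_def[abs_def]
      by (intro holomorphic_intros holomorphic_eval_fps_ball lattice_fps_conv[OF sd] theta3_fps_conv) (auto simp: eval_theta_fps_nonzero)
    show "F (qexp (- 1 / z)) = F (qexp z)" if "z \<in> uhp" for z
      using theta_lattice_inversion[OF sd that] Fq[OF that] Fq[OF uhp_inverse[OF that]] by simp
    show "((\<lambda>z. F (qexp (1 - 1 / z)) * qexp z ^ (2 * k)) \<longlongrightarrow>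
        ?s / 2 ^ n) at_cusp"
    proof (rule Lim_transform_eventually[OF shadow_cusp_limit])
      show "\<forall>\<^sub>F z in at_cusp. theta_set n (shadow n \<Lambda>) z / theta2 z ^ n * qexp z ^ (2 * k) = F (qexp (1 - 1 / z)) * qexp z ^ (2 * k)"
        using eventually_uhp_at_cusp
        by eventually_elim (simp add: theta_lattice_cusp1[OF sd, symmetric] Fq[OF uhp_cusp1])
    qed
  qed auto
  then obtain c where c: "\<And>z. z \<in> uhp \<Longrightarrow> F (qexp z) = (\<Sum>i\<le>k. c i * haupt z ^ i)"
    and ck: "c k * (- 1 / 4096) ^ k = ?s / 2 ^ n" by blast
  define R where "R = (\<Sum>i\<le>k. fps_const (c i) * basis_fps n i)"
  have term_conv: "fps_conv_radius (fps_const (c i) * basis_fps n i) \<ge> 1" for i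
    by (intro fps_conv_radius_mult_ge1 basis_fps_conv) simp
  have eq: "lattice_fps n \<Lambda> = R"
  proof (rule fps_eq_if_eval_eq[OF lattice_fps_conv[OF sd]])
    show "fps_conv_radius R \<ge> 1" unfolding R_def by (intro fps_conv_radius_sum_ge1 term_conv) auto
    fix z assume z: "z \<in> uhp"
    have q: "norm (qexp z) < 1" using qexp_in_ball[OF z] by simp
    have t3: "theta3 z \<noteq> 0" using theta_nonzero[OF z] by simp
    have "eval_fps (lattice_fps n \<Lambda>) (qexp z) = F (qexp z) * theta3 z ^ n"
      using t3 by (simp add: Fq[OF z] theta_lattice_eval[OF sd z])
    also have "\<dots> = (\<Sum>i\<le>k. c i * (Delta8 z ^ i * theta3 z ^ (n - 8 * i)))"
      unfolding c[OF z] sum_distrib_right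
    proof (rule sum.cong[OF refl])
      fix i assume "i \<in> {..k}"
      then have "8 * i \<le> n" using dimension_ge by simp
      then have "theta3 z ^ n = theta3 z ^ (8 * i) * theta3 z ^ (n - 8 * i)" by (simp flip: power_add)
      then show "c i * haupt z ^ i * theta3 z ^ n = c i * (Delta8 z ^ i * theta3 z ^ (n - 8 * i))"
        using t3 by (simp add: haupt_def power_divide power_mult)
    qed
    also have "\<dots> = eval_fps R (qexp z)"
      unfolding R_def eval_fps_sum_ge1[OF finite_atMost term_conv q]
      by (simp add: eval_fps_mult norm_less_conv_radius[OF _ q] basis_fps_conv basis_fps_eval[OF z])
    finally show "eval_fps (lattice_fps n \<Lambda>) (qexp z) = eval_fps R (qexp z)" .
  qed
  have ints: "c i \<in> \<int>" if "i \<le> k" for i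
    by (rule basis_coeffs_Ints[OF _ eq[unfolded R_def] that]) (simp add: lattice_fps_def[OF sd] fps_Ints_fibre)
  \<comment> \<open>Arbitrary beyond k; only indices up to k enter the sum.\<close>
  define d where "d i = (SOME m::int. c i = of_int m)" for i
  have d: "c i = of_int (d i)" if "i \<le> k" for i
    unfolding d_def by (rule someI_ex) (use ints[OF that] in \<open>auto elim: Ints_cases\<close>)
  have "lattice_fps n \<Lambda> = (\<Sum>i\<le>k. fps_const (of_int (d i)) * basis_fps n i)"
    unfolding eq R_def by (rule sum.cong) (auto simp: d)
  then show ?thesis using ck d[of k] by auto
qed

end

end

section \<open>Splitting off the cubic summand, and the coefficients\<close>

lemma sum_lessThan_add: "(\<Sum>i<p + (N::nat). f i) = (\<Sum>i<p. f i) + (\<Sum>i<N. f (p + i) :: 'a::comm_monoid_add)"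
  by (induction N) (auto simp: add_ac)

lemma theta_set_isometric:
  assumes "isometric n A B"
  shows "theta_set n A z = theta_set n B z"
proof -
  obtain f where f: "bij_betw f A B" "\<And>x. x \<in> A \<Longrightarrow> ip n (f x) (f x) = ip n x x"
    using assms unfolding isometric_def by blast
  show ?thesis unfolding theta_set_def infsum_reindex_bij_betw[OF f(1), symmetric]
    by (rule infsum_cong) (simp add: f(2))
qed

lemma theta_set_cubic_sum:
  assumes L: "L \<subseteq> vecs N" and z: "z \<in> uhp"
    and summ: "(\<lambda>x. exp (\<i> * of_real pi * z * of_real (ip (p + N) x x))) summable_on cubic_sum p N L"
  shows "theta_set (p + N) (cubic_sum p N L) z = theta3 z ^ p * theta_set N L z"
proof -
  \<comment> \<open>Concatenation of an integral p-tuple with a vector of L. Norms add, so the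
    exponential factors.\<close>
  define J where "J = (\<lambda>(m :: nat \<Rightarrow> int, y :: nat \<Rightarrow> real) i. if i < p then of_int (m i) else y (i - p))"
  define Z where "Z = PiE {..<p} (\<lambda>_. UNIV :: int set)"
  have bij: "bij_betw J (Z \<times> L) (cubic_sum p N L)"
  proof (rule bij_betwI[where g = "\<lambda>x. (\<lambda>i\<in>{..<p}. \<lfloor>x i\<rfloor>, \<lambda>j. x (p + j))"])
    show "J \<in> Z \<times> L \<rightarrow> cubic_sum p N L"
      using L by (auto simp: J_def cubic_sum_def vecs_def)
    show "(\<lambda>x. (\<lambda>i\<in>{..<p}. \<lfloor>x i\<rfloor>, \<lambda>j. x (p + j))) \<in> cubic_sum p N L \<rightarrow> Z \<times> L"
      by (auto simp: Z_def cubic_sum_def)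
    show "(\<lambda>i\<in>{..<p}. \<lfloor>J u i\<rfloor>, \<lambda>j. J u (p + j)) = u" if "u \<in> Z \<times> L" for u
    proof -
      obtain m y where u: "u = (m, y)" by (cases u)
      have "(\<lambda>i\<in>{..<p}. \<lfloor>J u i\<rfloor>) = m"
        using that unfolding u by (intro ext) (auto simp: J_def Z_def PiE_def extensional_def)
      then show ?thesis by (simp add: u J_def)
    qed
    show "J (\<lambda>i\<in>{..<p}. \<lfloor>x i\<rfloor>, \<lambda>j. x (p + j)) = x" if "x \<in> cubic_sum p N L" for x
      using that by (intro ext) (auto simp: J_def cubic_sum_def)
  qed
  define h where "h m = exp (\<i> * of_real pi * z * (of_int m)\<^sup>2)" for m :: int
  define g where "g y = exp (\<i> * of_real pi * z * of_real (ip N y y))" for y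
  have J: "exp (\<i> * of_real pi * z * of_real (ip (p + N) (J (m, y)) (J (m, y)))) = (\<Prod>i<p. h (m i)) * g y" for m y
  proof -
    have "ip (p + N) (J (m, y)) (J (m, y)) = (\<Sum>i<p. (of_int (m i))\<^sup>2) + ip N y y"
      unfolding ip_def sum_lessThan_add by (simp add: J_def power2_eq_square)
    then have "\<i> * of_real pi * z * of_real (ip (p + N) (J (m, y)) (J (m, y))) =
        (\<Sum>i<p. \<i> * of_real pi * z * (of_int (m i))\<^sup>2) + \<i> * of_real pi * z * of_real (ip N y y)"
      by (simp add: sum_distrib_left distrib_left)
    then show ?thesis by (simp add: exp_add exp_sum h_def g_def)
  qed
  have "(\<lambda>u. exp (\<i> * of_real pi * z * of_real (ip (p + N) (J u) (J u)))) summable_on Z \<times> L"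
    using summable_on_reindex_bij_betw[OF bij, of "\<lambda>x. exp (\<i> * of_real pi * z * of_real (ip (p + N) x x))"] summ by simp
  then have s: "(\<lambda>(m, y). (\<Prod>i<p. h (m i)) * g y) summable_on Z \<times> L"
    by (rule summable_on_cong[THEN iffD1, rotated]) (auto simp: J)
  have "theta_set (p + N) (cubic_sum p N L) z = (\<Sum>\<^sub>\<infinity>u\<in>Z \<times> L. exp (\<i> * of_real pi * z * of_real (ip (p + N) (J u) (J u))))"
    unfolding theta_set_def by (rule infsum_reindex_bij_betw[OF bij, symmetric])
  also have "\<dots> = (\<Sum>\<^sub>\<infinity>(m, y)\<in>Z \<times> L. (\<Prod>i<p. h (m i)) * g y)"
    by (rule infsum_cong) (auto simp: J)
  also have "\<dots> = (\<Sum>\<^sub>\<infinity>m\<in>Z. \<Sum>\<^sub>\<infinity>y\<in>L. (\<Prod>i<p. h (m i)) * g y)"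
    by (rule infsum_Sigma'_banach[symmetric, OF s])
  also have "\<dots> = (\<Sum>\<^sub>\<infinity>m\<in>Z. \<Prod>i<p. h (m i)) * infsum g L"
    by (simp add: infsum_cmult_right' infsum_cmult_left')
  also have "(\<Sum>\<^sub>\<infinity>m\<in>Z. \<Prod>i<p. h (m i)) = (\<Prod>i<p. infsum h UNIV)"
    unfolding Z_def
  proof (rule infsum_prod_PiE_abs)
    have "norm (h m) = norm (qexp z) ^ nat (m\<^sup>2)" for m
      by (simp add: h_def norm_power flip: qexp_power_square)
    then show "(\<lambda>m. norm (h m)) summable_on UNIV"
      using summable_squares[of "norm (qexp z)"] qexp_in_ball[OF z] by simp
  qed simp
  also have "\<dots> = theta3 z ^ p" by (simp add: theta3_def h_def[abs_def])
  finally show ?thesis by (simp add: theta_set_def g_def[abs_def])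
qed

theorem proposition6p1:
  fixes n k p N :: nat and \<Lambda> L :: "(nat \<Rightarrow> real) set"
  assumes "selfdual n \<Lambda>"
    and "sigma n \<Lambda> = real n - 8 * real k"
    and "p + N = n"
    and "selfdual N L"
    and "\<forall>x\<in>L. x \<noteq> (\<lambda>_. 0) \<longrightarrow> ip N x x \<ge> 2"
    and "isometric n \<Lambda> (cubic_sum p N L)"
  shows "\<exists>c :: nat \<Rightarrow> int. c 0 = 1 \<and> (\<forall>i>k. c i = 0) \<and>
    (\<forall>z. Im z > 0 \<longrightarrow>
       theta_set n \<Lambda> z = (\<Sum>i\<le>k. of_int (c i) * Delta8 z ^ i * theta3 z ^ (n - 8 * i))) \<and>
    c 1 = - 2 * int N \<and>
    (N > 0 \<longrightarrow> real_of_int (c 2) =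
        (real (card (shell N L 2)) / real N - 46 + 2 * real N) * real N) \<and>
    real_of_int (c k) = (-1) ^ k * 2 powr (real (12 * k) - real n)
        * real (card (shell n (shadow n \<Lambda>) ((real n - 8 * real k) / 4)))"
proof -
  note sd = assms(1) and sigma = assms(2) and sdL = assms(4)
  define S where "S = real (card (shell n (shadow n \<Lambda>) ((real n - 8 * real k) / 4)))"
  obtain d :: "nat \<Rightarrow> int" where d: "lattice_fps n \<Lambda> = (\<Sum>i\<le>k. fps_const (of_int (d i)) * basis_fps n i)"
    and dk: "of_int (d k) * (- 1 / 4096) ^ k = (of_nat (card (shell n (shadow n \<Lambda>) ((real n - 8 * real k) / 4))) / 2 ^ n :: complex)"
    using theta_lattice_polynomial[OF sd sigma] by blast
  define c where "c i = (if i \<le> k then d i else 0)" for i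
  \<comment> \<open>Padding with zeros up to k + 2 makes the coefficients at 1 and 2 available for
    every k.\<close>
  have c_eq: "lattice_fps n \<Lambda> = (\<Sum>i\<le>k + 2. fps_const (of_int (c i)) * basis_fps n i)"
    unfolding d by (rule sum.mono_neutral_cong_left) (auto simp: c_def)
  have nth: "fps_nth (lattice_fps n \<Lambda>) j = (\<Sum>i\<le>j. of_int (c i) * fps_nth (basis_fps n i) j)" if "j \<le> 2" for j
  proof -
    have "fps_nth (lattice_fps n \<Lambda>) j = (\<Sum>i\<le>k + 2. of_int (c i) * fps_nth (basis_fps n i) j)"
      unfolding c_eq by (simp add: fps_sum_nth)
    also have "\<dots> = (\<Sum>i\<le>j. of_int (c i) * fps_nth (basis_fps n i) j)"
      using that by (intro sum.mono_neutral_right) (auto simp: basis_fps_nth_less)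
    finally show ?thesis .
  qed
  have "of_int (c 0) = (1::complex)" using nth[of 0] lattice_fps_0[OF sd] basis_fps_nth_eq[of n 0] by simp
  then have c0: "c 0 = 1" by simp
  have n1: "fps_nth (lattice_fps n \<Lambda>) 1 = 2 * of_nat n + of_int (c 1)"
    using nth[of 1] basis_fps_0_nth(1)[of n] basis_fps_nth_eq[of n 1] c0 by simp
  have n2: "fps_nth (lattice_fps n \<Lambda>) 2 = 2 * of_nat n * (of_nat n - 1) + of_int (c 1) * (2 * of_nat n - 24) + of_int (c 2)"
  proof -
    have "{..2::nat} = {0, 1, 2}" by auto
    then have "fps_nth (lattice_fps n \<Lambda>) 2 = 2 * of_nat n * (of_nat n - 1) + of_int (c 1) * fps_nth (basis_fps n 1) 2 + of_int (c 2)"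
      using nth[of 2] basis_fps_0_nth(2)[of n] basis_fps_nth_eq[of n 2] c0 by simp
    \<comment> \<open>For k = 0 the dimension may be below 8, outside the range of
      \<open>basis_fps_1_nth\<close>, but then c 1 = 0; for k > 0 it is at least 8.\<close>
    moreover have "of_int (c 1) * fps_nth (basis_fps n 1) 2 = of_int (c 1) * (2 * of_nat n - 24)"
    proof (cases "k = 0")
      case True
      then show ?thesis by (simp add: c_def)
    next
      case False
      then have "n \<ge> 8" using dimension_ge[OF sd sigma] by linarith
      then show ?thesis using basis_fps_1_nth[of n] by simp
    qed
    ultimately show ?thesis by simp
  qed
  \<comment> \<open>This second expression for the series computes its low coefficients from p and
    the shells of L; comparing it with the expansion in the basis yields c 1 and c 2.\<close>
  have prod: "lattice_fps n \<Lambda> = theta3_fps ^ p * lattice_fps N L"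
  proof (rule fps_eq_if_eval_eq[OF lattice_fps_conv[OF sd]])
    show "fps_conv_radius (theta3_fps ^ p * lattice_fps N L) \<ge> 1"
      by (intro fps_conv_radius_mult_ge1 fps_conv_radius_power_ge1 theta3_fps_conv lattice_fps_conv[OF sdL])
    fix z assume z: "z \<in> uhp"
    have q: "norm (qexp z) < 1" using qexp_in_ball[OF z] by simp
    obtain f where f: "bij_betw f \<Lambda> (cubic_sum p N L)" "\<And>x. x \<in> \<Lambda> \<Longrightarrow> ip n (f x) (f x) = ip n x x"
      using assms(6) unfolding isometric_def by blast
    define E where "E x = exp (\<i> * of_real pi * z * of_real (ip n x x))" for x
    have nE: "norm (E x) = exp (- pi * Im z * ip n x x)" for x
      by (simp add: E_def norm_exp_eq_Re)
    have "E summable_on \<Lambda>"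
      by (rule abs_summable_summable) (use summable_selfdual[OF sd, of "Im z"] z in \<open>simp add: nE uhp_def\<close>)
    then have "(\<lambda>x. E (f x)) summable_on \<Lambda>"
      by (rule summable_on_cong[THEN iffD1, rotated]) (simp add: E_def f(2))
    then have "E summable_on cubic_sum p N L" using summable_on_reindex_bij_betw[OF f(1), of E] by simp
    then have "theta_set (p + N) (cubic_sum p N L) z = theta3 z ^ p * theta_set N L z"
      unfolding E_def assms(3)[symmetric]
      by (rule theta_set_cubic_sum[OF _ z, rotated]) (use selfdual_mem[OF sdL] in blast)
    then have "theta_set n \<Lambda> z = theta3 z ^ p * theta_set N L z"
      by (simp only: theta_set_isometric[OF assms(6)] assms(3))
    then show "eval_fps (lattice_fps n \<Lambda>) (qexp z) = eval_fps (theta3_fps ^ p * lattice_fps N L) (qexp z)"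
      using z by (simp add: theta_lattice_eval[OF sd] theta_lattice_eval[OF sdL] theta3_eval eval_fps_mult eval_fps_power
          norm_less_conv_radius[OF _ q] fps_conv_radius_power_ge1 theta3_fps_conv lattice_fps_conv[OF sdL])
  qed
  have L0: "fps_nth (lattice_fps N L) 0 = 1" by (rule lattice_fps_0[OF sdL])
  have "shell N L 1 = {}" using assms(5) by (force simp: shell_def ip_def)
  then have L1: "fps_nth (lattice_fps N L) 1 = 0" using lattice_fps_nth[OF sdL, of 1] by simp
  have L2: "fps_nth (lattice_fps N L) 2 = of_nat (card (shell N L 2))" using lattice_fps_nth[OF sdL, of 2] by simp
  have p1: "fps_nth (lattice_fps n \<Lambda>) 1 = 2 * of_nat p"
    unfolding prod using fps_power_nth_1[OF theta3_fps_0, of p] theta3_fps_1 L0 L1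
    by (simp add: fps_mult_nth fps_nth_power_0 theta3_fps_0)
  have p2: "fps_nth (lattice_fps n \<Lambda>) 2 = 2 * of_nat p * (of_nat p - 1) + of_nat (card (shell N L 2))"
    unfolding prod using fps_power_nth_1[OF theta3_fps_0, of p] fps_power_nth_2[OF theta3_fps_0, of p] theta3_fps_1 theta3_fps_2 L0 L1 L2
    by (simp add: fps_mult_nth fps_nth_power_0 theta3_fps_0 numeral_2_eq_2)
  have np: "n = p + N" using assms(3) by simp
  have "complex_of_int (2 * int n + c 1) = of_int (2 * int p)" using n1 p1 by simp
  then have "2 * int n + c 1 = 2 * int p" by (simp only: of_int_eq_iff)
  then have c1: "c 1 = - 2 * int N" using np by simp
  have "complex_of_int (2 * int n * (int n - 1) + c 1 * (2 * int n - 24) + c 2) =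
      of_int (2 * int p * (int p - 1) + int (card (shell N L 2)))" using n2 p2 by simp
  then have "2 * int n * (int n - 1) + c 1 * (2 * int n - 24) + c 2 = 2 * int p * (int p - 1) + int (card (shell N L 2))"
    by (simp only: of_int_eq_iff)
  then have "c 2 = 2 * int p * (int p - 1) + int (card (shell N L 2)) - 2 * int n * (int n - 1) - c 1 * (2 * int n - 24)"
    by linarith
  \<comment> \<open>With n = p + N all terms containing p cancel; -46 arises as 2 - 48.\<close>
  also have "\<dots> = int (card (shell N L 2)) - 46 * int N + 2 * int N * int N"
    unfolding c1 np by (simp add: algebra_simps)
  finally have c2: "c 2 = int (card (shell N L 2)) - 46 * int N + 2 * int N * int N" .
  have c2': "real_of_int (c 2) = (real (card (shell N L 2)) / real N - 46 + 2 * real N) * real N" if "N > 0"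
    using that by (simp add: c2 algebra_simps)
  have "complex_of_real (real_of_int (d k) * (- 1 / 4096) ^ k) = complex_of_real (S / 2 ^ n)" using dk by (simp add: S_def)
  then have "real_of_int (d k) * (- 1 / 4096) ^ k = S / 2 ^ n" by (simp only: of_real_eq_iff)
  \<comment> \<open>Solving for the last coefficient: -1/4096 is the limit of t q^2 at the second
    cusp, and 4096 = 2^12 gives the exponent 12k.\<close>
  then have "real_of_int (d k) * (- 1 / 4096) ^ k * (- 4096) ^ k = S / 2 ^ n * (- 4096) ^ k" by simp
  then have "real_of_int (d k) * ((- 1 / 4096) * (- 4096)) ^ k = S / 2 ^ n * (- 4096) ^ k"
    by (simp only: power_mult_distrib mult.assoc)
  moreover have "(- 4096 :: real) ^ k = (- 1) ^ k * 2 ^ (12 * k)"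
  proof -
    have "(- 4096 :: real) = (- 1) * 2 ^ 12" by simp
    then show ?thesis by (simp only: power_mult_distrib power_mult)
  qed
  ultimately have "real_of_int (d k) = (- 1) ^ k * (2 ^ (12 * k) / 2 ^ n) * S" by simp
  \<comment> \<open>The exponent 12k - n can be negative, hence \<open>powr\<close> with a real
    exponent.\<close>
  also have "(2 ^ (12 * k) / 2 ^ n :: real) = 2 powr (real (12 * k) - real n)"
    by (simp only: powr_diff powr_realpow zero_less_numeral)
  finally have ck: "real_of_int (c k) = (- 1) ^ k * 2 powr (real (12 * k) - real n) * S" by (simp add: c_def)
  have theta: "theta_set n \<Lambda> z = (\<Sum>i\<le>k. of_int (c i) * Delta8 z ^ i * theta3 z ^ (n - 8 * i))" if "Im z > 0" for z
  proof -
    have z: "z \<in> uhp" using that by (simp add: uhp_def)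
    have q: "norm (qexp z) < 1" using qexp_in_ball[OF z] by simp
    have conv: "fps_conv_radius (fps_const (of_int (d i)) * basis_fps n i) \<ge> 1" for i
      by (intro fps_conv_radius_mult_ge1 basis_fps_conv) simp
    show ?thesis
      unfolding theta_lattice_eval[OF sd z] d eval_fps_sum_ge1[OF finite_atMost conv q]
      by (rule sum.cong) (simp_all add: c_def eval_fps_mult norm_less_conv_radius[OF _ q] basis_fps_conv basis_fps_eval[OF z])
  qed
  show ?thesis
    using c0 c1 c2' ck theta by (intro exI[of _ c]) (auto simp: c_def S_def)
qed

end
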